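(* Suppose that $\mathbf{E}[\ln\rho_0]<0$; that there exists a unique $\kappa>0$ such that $\mathbf{E}[\rho_0^{\kappa}]=1$ and $\mathbf{E}[\rho_0^{\kappa}\ln^+\rho_0]<\infty$; and that there exists $\epsilon_0>0$ such that $\mathbf{E}[\rho_0^{-\epsilon_0}]<\infty$. Then for $\nu\in(\kappa,1)$ (so in particular $\kappa<1$), $$\lim_{n\to\infty}\frac{\ln(-\ln P_\omega[X_n>n^{\nu}])}{\ln n}=\lim_{n\to\infty}\frac{\ln(-\ln P_\omega[T_{n^{\nu}}<n])}{\ln n}=\frac{\nu-\kappa}{1-\kappa},\qquad\mathbf{P}\text{-a.s.},$$ and $$\lim_{n\to\infty}\frac{\ln(-\ln\mathbb{P}[X_n>n^{\nu}])}{\ln n}=\lim_{n\to\infty}\frac{\ln(-\ln\mathbb{P}[T_{n^{\nu}}<n])}{\ln n}=\frac{\nu-\kappa}{1-\kappa}.$$ The same result holds for the random walk in random environment with reflection at the origin, i.e. with $P_{\tilde\omega}$ and $\tilde{\mathbb{P}}$ in place of $P_\omega$ and $\mathbb{P}$.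
   Context: Let $\omega=(\omega_i,\ i\in\mathbb{Z})$ be a family of i.i.d. random variables with values in $(0,1)$ (the environment); $\mathbf{P}$ is its law and $\mathbf{E}$ the corresponding expectation. Put $\rho_i=(1-\omega_i)/\omega_i$. Given $\omega$, the quenched law $P_\omega$ is the law of the nearest-neighbour Markov chain $(X_n)_{n\ge0}$ on $\mathbb{Z}$ with $X_0=0$ and $P_\omega[X_{n+1}=x+1\mid X_n=x]=\omega_x$, $P_\omega[X_{n+1}=x-1\mid X_n=x]=1-\omega_x$. The annealed law is $\mathbb{P}=\mathbf{P}\times P_\omega$ (semi-direct product), i.e. $\mathbb{P}[\cdot]=\int P_\omega[\cdot]\,d\mathbf{P}(\omega)$ for walk events. The walk reflected at the origin is the walk on $\mathbb{Z}_+$ started at $0$ and defined in the same way in the environment $\tilde\omega$ with $\tilde\omega_i=\omega_i$ for $i\neq0$ and $\tilde\omega_0=1$; its quenched law is $P_{\tilde\omega}$ and its annealed law is $\tilde{\mathbb{P}}$. For $a\in\mathbb{Z}$, $T_a=\min\{n\ge0:X_n=a\}$, and for non-integer $a$, $T_a:=T_{\lfloor a\rfloor}$. Also $\ln^+x=\max(\ln x,0)$. *)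

theory Defs
  imports "HOL-Probability.Probability"
begin

definition rho :: "real \<Rightarrow> real" where
  "rho p = (1 - p) / p"

definition ln_plus :: "real \<Rightarrow> real" where
  "ln_plus x = max (ln x) 0"

definition walk_step :: "real \<Rightarrow> int \<Rightarrow> int pmf" where
  "walk_step p x = map_pmf (\<lambda>b. if b then x + 1 else x - 1) (bernoulli_pmf p)"

text \<open>
  Conditional law of \<open>X\<^sub>n\<close> given the history \<open>h\<close>, of which only \<open>h 0, \<dots>, h (n - 1)\<close> is
  meaningful; at time \<open>0\<close> it is the unit mass at the origin.
\<close>

definition walk_kernel :: "(int \<Rightarrow> real) \<Rightarrow> nat \<Rightarrow> (nat \<Rightarrow> int) \<Rightarrow> int measure" where
  "walk_kernel w n h =
     measure_pmf (case n of 0 \<Rightarrow> return_pmf 0 | Suc m \<Rightarrow> walk_step (w (h m)) (h m))"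

abbreviation path_space :: "(nat \<Rightarrow> int) measure" where
  "path_space \<equiv> PiM UNIV (\<lambda>_. count_space UNIV)"

lemma space_path_space [simp]: "space path_space = UNIV"
  by (simp add: space_PiM)

lemma space_PiM_int: "space (PiM J (\<lambda>_. count_space (UNIV :: int set))) = extensional J"
  by (auto simp: space_PiM PiE_def)

lemma sets_PiM_int:
  assumes "finite (J :: nat set)"
  shows "sets (PiM J (\<lambda>_. count_space (UNIV :: int set))) = Pow (extensional J)"
proof -
  have "sets (PiM J (\<lambda>_. count_space (UNIV :: int set))) = sets (count_space (PiE J (\<lambda>_. UNIV)))"
    by (subst count_space_PiM_finite) (use assms in auto)
  then show ?thesis by (simp add: PiE_def)
qed

lemma Ionescu_Tulcea_walk_kernel: "Ionescu_Tulcea (walk_kernel w) (\<lambda>_. count_space UNIV)"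
proof -
  have "walk_kernel w i h \<in> space (subprob_algebra (count_space UNIV))" for i h
    by (auto simp: walk_kernel_def space_subprob_algebra intro!: prob_space_imp_subprob_space
        measure_pmf.prob_space_axioms)
  then have "walk_kernel w i \<in> measurable (PiM {0..<i} (\<lambda>_. count_space UNIV))
      (subprob_algebra (count_space UNIV))" for i
    by (intro measurableI) (auto simp: sets_PiM_int space_PiM_int)
  moreover have "prob_space (walk_kernel w i x)" for i x
    by (simp add: walk_kernel_def measure_pmf.prob_space_axioms)
  ultimately show ?thesis
    by (simp add: Ionescu_Tulcea_def)
qed

interpretation walk: Ionescu_Tulcea "walk_kernel w" "\<lambda>_. count_space UNIV" for w
  by (rule Ionescu_Tulcea_walk_kernel)

definition quenched_law :: "(int \<Rightarrow> real) \<Rightarrow> (nat \<Rightarrow> int) measure" where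
  "quenched_law w = walk.PF.lim w"

text \<open>
  The marginal on path space of the semi-direct product of the law \<open>M\<close> of the environment
  \<open>e\<close> with the quenched laws.
\<close>

definition annealed_law :: "'a measure \<Rightarrow> ('a \<Rightarrow> int \<Rightarrow> real) \<Rightarrow> (nat \<Rightarrow> int) measure" where
  "annealed_law M e = M \<bind> (\<lambda>s. quenched_law (e s))"

definition reflect :: "(int \<Rightarrow> real) \<Rightarrow> int \<Rightarrow> real" where
  "reflect w = w(0 := 1)"

text \<open>The infimum of the empty set is \<open>\<infinity>\<close>.\<close>

definition hitting_time :: "real \<Rightarrow> (nat \<Rightarrow> int) \<Rightarrow> enat" where
  "hitting_time a X = Inf {enat n | n. X n = \<lfloor>a\<rfloor>}"


lemma sets_quenched_law [simp]: "sets (quenched_law w) = sets path_space"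
  by (simp add: quenched_law_def)

lemma space_quenched_law [simp]: "space (quenched_law w) = UNIV"
  by (simp add: quenched_law_def space_PiM)

lemma emeasure_C_singleton:
  assumes "x \<in> extensional {0..<n}"
  shows "emeasure (walk.C w 0 n (\<lambda>_. undefined)) {x} = (\<Prod>i<n. emeasure (walk_kernel w i x) {x i})"
  using assms
proof (induction n arbitrary: x)
  case 0
  then show ?case by (auto simp: PiM_empty fun_eq_iff)
next
  case (Suc n)
  let ?u = "\<lambda>_::nat. undefined :: int"
  let ?y = "restrict x {0..<n}"
  have u: "?u \<in> space (PiM {0..<0} (\<lambda>_. count_space UNIV))" by (simp add: space_PiM_int)
  have sC: "space (walk.C w 0 n ?u) = extensional {0..<n}"
    using walk.space_C[OF u] by (simp add: space_PiM_int)
  have setC: "sets (walk.C w 0 n ?u) = Pow (extensional {0..<n})"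
    using walk.sets_C[OF u] by (simp add: sets_PiM_int)
  have x: "{x} \<in> sets (PiM {0..<Suc n} (\<lambda>_. count_space UNIV))"
    using Suc.prems by (simp add: sets_PiM_int)
  have ker: "walk_kernel w n ?y = walk_kernel w n x"
    by (auto simp: walk_kernel_def split: nat.split)
  have ker': "walk_kernel w i ?y = walk_kernel w i x" if "i < n" for i
    using that by (auto simp: walk_kernel_def split: nat.split)
  have eP: "emeasure (walk.eP w n h) {x} = emeasure (walk_kernel w n x) {x n} * indicator {?y} h"
    if h: "h \<in> extensional {0..<n}" for h
  proof -
    have "emeasure (walk.eP w n h) {x} = emeasure (walk_kernel w n h) ((\<lambda>v. h(n := v)) -` {x})"
      using walk.emeasure_eP[of h n "{x}" w] h x by (simp add: space_PiM_int)
    also have "(\<lambda>v. h(n := v)) -` {x} = (if h = ?y then {x n} else {})"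
    proof -
      have "h(n := v) = x \<longleftrightarrow> v = x n \<and> h = ?y" for v
      proof
        assume *: "h(n := v) = x"
        have "h i = ?y i" for i
          using h * by (cases "i < n") (auto simp: extensional_def)
        then have "h = ?y" by auto
        then show "v = x n \<and> h = ?y" using fun_cong[OF *, of n] by simp
      next
        assume "v = x n \<and> h = ?y"
        then show "h(n := v) = x"
          using Suc.prems by (auto simp: fun_eq_iff extensional_def)
      qed
      then show ?thesis by (intro set_eqI) (simp del: restrict_apply)
    qed
    finally show ?thesis using ker by (simp add: indicator_def del: restrict_apply)
  qed
  have "emeasure (walk.C w 0 (Suc n) ?u) {x} = (\<integral>\<^sup>+h. emeasure (walk.eP w n h) {x} \<partial>walk.C w 0 n ?u)"
  proof -
    have "walk.eP w n \<in> measurable (walk.C w 0 n ?u) (subprob_algebra (PiM {0..<Suc n} (\<lambda>_. count_space UNIV)))"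
      using walk.measurable_eP[of w n] by (simp add: measurable_cong_sets[OF walk.sets_C[OF u] refl])
    moreover have "space (walk.C w 0 n ?u) \<noteq> {}"
      unfolding sC by (auto intro: exI[of _ ?u])
    ultimately show ?thesis
      using x by (simp add: emeasure_bind)
  qed
  also have "\<dots> = (\<integral>\<^sup>+h. emeasure (walk_kernel w n x) {x n} * indicator {?y} h \<partial>walk.C w 0 n ?u)"
    by (intro nn_integral_cong) (simp add: sC eP)
  also have "\<dots> = emeasure (walk_kernel w n x) {x n} * emeasure (walk.C w 0 n ?u) {?y}"
    by (subst nn_integral_cmult_indicator) (auto simp: setC)
  also have "emeasure (walk.C w 0 n ?u) {?y} = (\<Prod>i<n. emeasure (walk_kernel w i x) {x i})"
    by (subst Suc.IH) (auto intro!: prod.cong simp: ker')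
  finally show ?case by (simp add: mult.commute)
qed

lemma emeasure_quenched_law_cylinder:
  "emeasure (quenched_law w) {X. \<forall>i<n. X i = x i} = (\<Prod>i<n. emeasure (walk_kernel w i x) {x i})"
proof -
  let ?y = "restrict x {0..<n}"
  have y: "{?y} \<in> sets (PiM {0..<n} (\<lambda>_. count_space UNIV))"
    by (simp add: sets_PiM_int)
  have eq: "{X. \<forall>i<n. X i = x i} = prod_emb UNIV (\<lambda>_. count_space UNIV) {0..<n} {?y}"
    by (force simp: prod_emb_def fun_eq_iff restrict_def split: if_splits)
  have "emeasure (quenched_law w) {X. \<forall>i<n. X i = x i} = emeasure (walk.CI w {0..<n}) {?y}"
    unfolding eq quenched_law_def by (rule walk.lim) (use y in auto)
  also have "\<dots> = emeasure (walk.C w 0 n (\<lambda>_. undefined)) {?y}"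
    by (subst walk.emeasure_CI[of _ n]) (use y in \<open>auto simp: space_PiM_int prod_emb_id sets_PiM_int\<close>)
  also have "\<dots> = (\<Prod>i<n. emeasure (walk_kernel w i ?y) {?y i})"
    by (rule emeasure_C_singleton) simp
  also have "\<dots> = (\<Prod>i<n. emeasure (walk_kernel w i x) {x i})"
    by (intro prod.cong) (auto simp: walk_kernel_def split: nat.split)
  finally show ?thesis .
qed

lemma prob_space_quenched_law: "prob_space (quenched_law w)"
  using emeasure_quenched_law_cylinder[of w 0] by (intro prob_spaceI) simp

lemma measure_walk_step:
  assumes "0 \<le> p" "p \<le> 1"
  shows "measure (measure_pmf (walk_step p x)) {y} =
    (if y = x + 1 then p else if y = x - 1 then 1 - p else 0)"
proof -
  have "measure (measure_pmf (walk_step p x)) {y} =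
      (\<integral>b. indicator ((\<lambda>b. if b then x + 1 else x - 1) -` {y}) b \<partial>bernoulli_pmf p)"
    by (simp add: walk_step_def)
  then show ?thesis using assms
    by (simp add: indicator_def del: Bochner_Integration.integral_indicator)
qed

text \<open>The law of the nearest-neighbour Markov chain started at \<open>0\<close>.\<close>

theorem measure_quenched_law_path:
  assumes "\<And>i. 0 \<le> w i \<and> w i \<le> 1" and "x 0 = 0"
  shows "measure (quenched_law w) {X. \<forall>i\<le>n. X i = x i} =
    (\<Prod>i<n. if x (Suc i) = x i + 1 then w (x i)
            else if x (Suc i) = x i - 1 then 1 - w (x i) else 0)"
proof -
  have "measure (quenched_law w) {X. \<forall>i\<le>n. X i = x i} =
      (\<Prod>i<Suc n. measure (walk_kernel w i x) {x i})"
  proof -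
    have "enn2real (\<Prod>i<m. emeasure (walk_kernel w i x) {x i}) =
        (\<Prod>i<m. measure (walk_kernel w i x) {x i})" for m
      by (induction m) (simp_all add: enn2real_mult measure_def)
    then show ?thesis
      using emeasure_quenched_law_cylinder[of w "Suc n" x]
      by (simp add: measure_def less_Suc_eq_le del: prod.lessThan_Suc)
  qed
  also have "\<dots> = measure (walk_kernel w 0 x) {x 0} * (\<Prod>i<n. measure (walk_kernel w (Suc i) x) {x (Suc i)})"
    by (rule prod.lessThan_Suc_shift)
  finally show ?thesis using assms by (simp add: walk_kernel_def measure_walk_step)
qed

lemma measurable_cylinder [measurable]: "{X. \<forall>i<n. X i = x i} \<in> sets path_space"
proof -
  have "{X \<in> space path_space. \<forall>i<n. X i = x i} \<in> sets path_space" by measurable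
  then show ?thesis by simp
qed

lemma sets_path_space:
  "sets path_space = sigma_sets UNIV (insert {} (range (\<lambda>(n, x). {X. \<forall>i<n. X i = x i})))"
    (is "_ = sigma_sets UNIV ?G")
proof
  have "?G \<subseteq> sets path_space" by auto
  then show "sigma_sets UNIV ?G \<subseteq> sets path_space"
    using sets.sigma_sets_subset[of ?G path_space] by simp
  have *: "{X. X i \<in> A} \<in> sigma_sets UNIV ?G" for i :: nat and A :: "int set"
  proof -
    let ?H = "{h \<in> PiE {..<Suc i} (\<lambda>_. UNIV :: int set). h i \<in> A}"
    have "{X. X i \<in> A} = (\<Union>h\<in>?H. {X. \<forall>j<Suc i. X j = h j})"
    proof (intro set_eqI iffI)
      fix X :: "nat \<Rightarrow> int" assume "X \<in> {X. X i \<in> A}"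
      then show "X \<in> (\<Union>h\<in>?H. {X. \<forall>j<Suc i. X j = h j})"
        by (intro UN_I[of "restrict X {..<Suc i}"]) auto
    qed auto
    also have "\<dots> \<in> sigma_sets UNIV ?G"
    proof -
      interpret sigma_algebra UNIV "sigma_sets UNIV ?G"
        by (rule sigma_algebra_sigma_sets) simp
      have "countable ?H"
        by (rule countable_subset[OF _ countable_PiE[of "{..<Suc i}" "\<lambda>_. UNIV"]]) auto
      then show ?thesis
        by (intro countable_UN'') (auto intro!: sigma_sets.Basic)
    qed
    finally show ?thesis .
  qed
  show "sets path_space \<subseteq> sigma_sets UNIV ?G"
    unfolding sets_PiM_single
    using sigma_sets_mono[of "{{f \<in> PiE UNIV (\<lambda>_. space (count_space UNIV)). f i \<in> A} |i A.
      i \<in> UNIV \<and> A \<in> sets (count_space (UNIV :: int set))}" UNIV ?G]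
    by (simp add: PiE_UNIV_domain) (use * in blast)
qed

lemma emeasure_walk_step:
  "emeasure (measure_pmf (walk_step p x)) {y} =
    ennreal (if y = x + 1 then min 1 (max 0 p) else if y = x - 1 then 1 - min 1 (max 0 p) else 0)"
proof -
  have "bernoulli_pmf p = bernoulli_pmf (min 1 (max 0 p))"
    by (rule pmf_eqI) (simp add: bernoulli_pmf.rep_eq)
  then have "walk_step p x = walk_step (min 1 (max 0 p)) x"
    by (simp add: walk_step_def)
  then show ?thesis
    by (simp add: measure_walk_step measure_pmf.emeasure_eq_measure)
qed

lemma measurable_quenched_law [measurable]:
  "quenched_law \<in> measurable (PiM UNIV (\<lambda>_. borel)) (subprob_algebra path_space)"
proof (rule measurable_subprob_algebra_generated[OF sets_path_space])
  let ?G = "insert {} (range (\<lambda>(n, x). {X :: nat \<Rightarrow> int. \<forall>i<n. X i = x i}))"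
  have cyl: "{X. \<forall>i<n. X i = x i} \<inter> {X. \<forall>i<m. X i = y i} \<in> ?G" if "n \<le> m"
    for n m :: nat and x y :: "nat \<Rightarrow> int"
  proof (cases "\<forall>i<n. x i = y i")
    case True
    then have "{X. \<forall>i<n. X i = x i} \<inter> {X. \<forall>i<m. X i = y i} = {X. \<forall>i<m. X i = y i}"
      using that by auto
    then show ?thesis by auto
  next
    case False
    then have "{X. \<forall>i<n. X i = x i} \<inter> {X. \<forall>i<m. X i = y i} = {}"
      using that by fastforce
    then show ?thesis by simp
  qed
  show "Int_stable ?G"
  proof (rule Int_stableI)
    fix a b assume "a \<in> ?G" "b \<in> ?G"
    then consider "a = {} \<or> b = {}"
      | n x m y where "a = {X. \<forall>i<n. X i = x i}" "b = {X. \<forall>i<m. X i = y i}"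
      by auto
    then show "a \<inter> b \<in> ?G"
    proof cases
      case 2
      then show ?thesis
        using cyl[of n m x y] cyl[of m n y x] by (cases "n \<le> m") (simp_all add: Int_commute)
    qed auto
  qed
  show "?G \<subseteq> Pow UNIV" by simp
  show "subprob_space (quenched_law a)" for a
    by (intro prob_space_imp_subprob_space prob_space_quenched_law)
  show "sets (quenched_law a) = sets path_space" for a by simp
  have ker: "(\<lambda>w. emeasure (walk_kernel w i x) {x i}) \<in> borel_measurable (PiM UNIV (\<lambda>_. borel))" for i x
    by (cases i) (simp_all add: walk_kernel_def emeasure_walk_step)
  show "(\<lambda>a. emeasure (quenched_law a) A) \<in> borel_measurable (PiM UNIV (\<lambda>_. borel))"
    if "A \<in> ?G" for A
    using that ker by (auto simp: emeasure_quenched_law_cylinder)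
  have "(\<lambda>a. emeasure (quenched_law a) UNIV) = (\<lambda>a. 1)"
    using prob_space.emeasure_space_1[OF prob_space_quenched_law] by simp
  then show "(\<lambda>a. emeasure (quenched_law a) UNIV) \<in> borel_measurable (PiM UNIV (\<lambda>_. borel))"
    by simp
qed

lemma
  assumes "prob_space M" and e: "\<And>i. (\<lambda>s. e s i) \<in> borel_measurable M"
  shows sets_annealed_law: "sets (annealed_law M e) = sets path_space"
    and space_annealed_law: "space (annealed_law M e) = UNIV"
    and measure_annealed_law:
      "A \<in> sets path_space \<Longrightarrow> measure (annealed_law M e) A = (\<integral>s. measure (quenched_law (e s)) A \<partial>M)"
proof -
  interpret prob_space M by fact
  have "e \<in> measurable M (PiM UNIV (\<lambda>_. borel))"
    by (rule measurable_PiM_single'[where f="\<lambda>i s. e s i"]) (use e in \<open>simp_all add: PiE_UNIV_domain\<close>)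
  then have q: "(\<lambda>s. quenched_law (e s)) \<in> measurable M (subprob_algebra path_space)"
    by (rule measurable_compose[OF _ measurable_quenched_law])
  show "sets (annealed_law M e) = sets path_space"
    unfolding annealed_law_def by (rule sets_bind) (simp_all add: not_empty)
  from sets_eq_imp_space_eq[OF this] show "space (annealed_law M e) = UNIV" by simp
  show "measure (annealed_law M e) A = (\<integral>s. measure (quenched_law (e s)) A \<partial>M)"
    if "A \<in> sets path_space"
    unfolding annealed_law_def
    using measure_bind[OF q that] .
qed

end

theory Submission
  imports Defs "HOL-Real_Asymp.Real_Asymp"
begin

text \<open>
  Write \<open>\<beta> = (\<nu> - \<kappa>) / (1 - \<kappa>)\<close>. Reaching \<open>n\<^sup>\<nu>\<close> by time \<open>n\<close> is a finite-horizon problem, governed by the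
  one-step recursion of the walk. This recursion is monotone in the environment, so the upper bound
  is needed only for the reflected walk and the lower bound only for the walk on \<open>\<int>\<close>.

  Upper bound: the Laplace transform at \<open>l = n powr (-a)\<close> of the time to cross from \<open>x\<close> to \<open>x + 1\<close> is at most
  \<open>1 / (1 + \<zeta>\<^sub>x)\<close>, where \<open>\<zeta>\<^sub>x = l / \<omega>\<^sub>x + \<rho>\<^sub>x \<zeta> / (1 + \<zeta>)\<close> with \<open>\<zeta> = \<zeta>\<^bsub>x-1\<^esub>\<close>. On a block in which some partial
  product of the \<open>\<rho>\<^sub>i\<close> exceeds \<open>1 / l\<close> the product of the \<open>1 + \<zeta>\<^sub>i\<close> is at least \<open>2\<close>. Such blocks have
  probability about \<open>l powr \<kappa>\<close> and are independent, and \<open>a\<close> slightly above \<open>1 - \<beta>\<close> gives the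
  annealed bound, hence the quenched one by Markov's inequality.

  Lower bound: put a reflecting wall at every site whose expected crossing time exceeds \<open>H = n powr a\<close>, with
  \<open>a\<close> slightly below \<open>1 - \<beta>\<close>. Since crossing times have finite moments of every order below
  \<open>\<kappa>\<close>, about \<open>n\<^sup>\<beta>\<close> walls suffice for the total expected crossing time to be at most \<open>n / 2\<close>, and each wall costs only a
  factor \<open>\<omega>\<^sub>x / n\<close>. Almost sure statements follow along \<open>n = 2 ^ k\<close>.
\<close>

subsection \<open>The walk in a fixed environment\<close>

text \<open>Both halves balance two exponents at the same point a = 1 - \<beta> = (1 - \<nu>) / (1 -
  \<kappa>). In the upper bound the discount costs \<open>n powr (1 - a)\<close> in the exponent,
  while about \<open>n powr \<nu>\<close> sites with climbs of probability
  \<open>n powr (- \<kappa> * a)\<close> gain \<open>n powr (\<nu> - \<kappa> * a)\<close>. In the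
  lower bound there are about \<open>n powr (\<nu> - \<kappa> * a)\<close> walls, and the remaining
  crossing times add up to about \<open>n powr (\<nu> + a * (1 - \<kappa>))\<close>. At this a the
  first three exponents equal \<beta> and the last equals 1; since \<kappa> < 1, moving a slightly
  up or down makes the needed inequality strict. The slack so gained replaces sharp tail estimates:
  moments of order below \<kappa> control crossing times, and a truncated moment of order above
  \<kappa>, which exceeds 1, produces climbs. Being above the level at time n asks for more than
  reaching it: the walk must not fall back. The target is therefore moved to the right by a number
  of sites logarithmic in n, and the scale function bounds the chance of a return.\<close>

text \<open>The transition operator of the walk. Iterating it turns quenched estimates into
  inductions on time; path measures enter only when the recursions are identified with probabilities
  of events.\<close>

definition walk_avg :: "(int \<Rightarrow> real) \<Rightarrow> (int \<Rightarrow> real) \<Rightarrow> int \<Rightarrow> real" where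
  "walk_avg w f x = w x * f (x + 1) + (1 - w x) * f (x - 1)"

text \<open>For a walk started from \<open>x\<close>, \<open>hit w a n x\<close> is the probability of reaching \<open>[a, \<infinity>)\<close> by
  time \<open>n\<close>, and \<open>above_at w y n x\<close> that of being above \<open>y\<close> at time \<open>n\<close>.\<close>

primrec hit :: "(int \<Rightarrow> real) \<Rightarrow> int \<Rightarrow> nat \<Rightarrow> int \<Rightarrow> real" where
  "hit w a 0 = (\<lambda>x. of_bool (a \<le> x))"
| "hit w a (Suc n) = (\<lambda>x. if a \<le> x then 1 else walk_avg w (hit w a n) x)"

primrec above_at :: "(int \<Rightarrow> real) \<Rightarrow> int \<Rightarrow> nat \<Rightarrow> int \<Rightarrow> real" where
  "above_at w y 0 = (\<lambda>x. of_bool (y < x))"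
| "above_at w y (Suc n) = walk_avg w (above_at w y n)"

text \<open>The closed interval admits the value 1, which reflecting walls and the reflected origin
  take.\<close>

definition env :: "(int \<Rightarrow> real) \<Rightarrow> bool" where
  "env w \<longleftrightarrow> (\<forall>x. 0 \<le> w x \<and> w x \<le> 1)"

lemma envD: "env w \<Longrightarrow> 0 \<le> w x" "env w \<Longrightarrow> w x \<le> 1"
  by (auto simp: env_def)

lemma walk_avg_mono:
  assumes "env w" "f (x + 1) \<le> g (x + 1)" "f (x - 1) \<le> g (x - 1)"
  shows "walk_avg w f x \<le> walk_avg w g x"
  unfolding walk_avg_def using assms by (intro add_mono mult_left_mono) (auto simp: env_def)

lemma walk_avg_affine: "walk_avg w (\<lambda>x. c * f x + d) x = c * walk_avg w f x + d"
  by (simp add: walk_avg_def algebra_simps)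

lemma walk_avg_le:
  assumes "env w" "f (x + 1) \<le> c" "f (x - 1) \<le> c"
  shows "walk_avg w f x \<le> c"
  using walk_avg_mono[OF assms(1), of f x "\<lambda>_. c"] assms by (simp add: walk_avg_def algebra_simps)

lemma walk_avg_ge:
  assumes "env w" "c \<le> f (x + 1)" "c \<le> f (x - 1)"
  shows "c \<le> walk_avg w f x"
  using walk_avg_mono[OF assms(1), of "\<lambda>_. c" x f] assms by (simp add: walk_avg_def algebra_simps)

text \<open>The difference of the two sides is
  \<open>(w' x - w x) * (f (x + 1) - f (x - 1))\<close>. This replaces a coupling of the two
  walks.\<close>

lemma walk_avg_mono_env:
  assumes "w x \<le> w' x" "f (x - 1) \<le> f (x + 1)"
  shows "walk_avg w f x \<le> walk_avg w' f x"
proof -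
  have "0 \<le> (w' x - w x) * (f (x + 1) - f (x - 1))"
    using assms by simp
  then show ?thesis by (simp add: walk_avg_def algebra_simps)
qed

lemma hit_ge [simp]: "a \<le> x \<Longrightarrow> hit w a n x = 1"
  by (cases n) auto

lemma hit_bounds: "env w \<Longrightarrow> 0 \<le> hit w a n x \<and> hit w a n x \<le> 1"
  by (induction n arbitrary: x) (auto intro!: walk_avg_le walk_avg_ge)

lemma above_bounds: "env w \<Longrightarrow> 0 \<le> above_at w y n x \<and> above_at w y n x \<le> 1"
  by (induction n arbitrary: x) (auto intro!: walk_avg_le walk_avg_ge)

lemma hit_mono_time_Suc: "env w \<Longrightarrow> hit w a n x \<le> hit w a (Suc n) x"
proof (induction n arbitrary: x)
  case 0
  then show ?case by (auto intro!: walk_avg_ge)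
next
  case (Suc n)
  then show ?case
    by (simp del: hit.simps add: hit.simps(2)[of w a n] hit.simps(2)[of w a "Suc n"])
       (auto simp del: hit.simps intro!: walk_avg_mono)
qed

text \<open>Starting points of equal parity cannot overtake each other without meeting, and a gap of
  2 is what \<open>walk_avg_mono_env\<close> asks for. In the induction the value at the middle
  point \<open>x + 1\<close>, with one step less, separates the two sides.\<close>

lemma hit_mono_space: "env w \<Longrightarrow> hit w a n x \<le> hit w a n (x + 2)"
proof (induction n arbitrary: x)
  case (Suc n)
  show ?case
  proof (cases "a \<le> x + 2")
    case True
    then show ?thesis using hit_bounds[OF Suc.prems] by (simp del: hit.simps)
  next
    case False
    have "walk_avg w (hit w a n) x \<le> hit w a n (x + 1)"
      using Suc.IH[OF Suc.prems, of "x - 1"] by (intro walk_avg_le Suc.prems) (auto simp: algebra_simps)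
    also have "\<dots> \<le> walk_avg w (hit w a n) (x + 2)"
      using Suc.IH[OF Suc.prems, of "x + 1"] by (intro walk_avg_ge Suc.prems) (auto simp: algebra_simps)
    finally show ?thesis using False by simp
  qed
qed auto

text \<open>Here a gap of 1 would fail for parity reasons: with \<open>w y = 1\<close> and
  \<open>w (y + 1) = 0\<close> a single step leads above \<open>y\<close> from \<open>y\<close> but
  not from \<open>y + 1\<close>.\<close>

lemma above_mono_space: "env w \<Longrightarrow> above_at w y n x \<le> above_at w y n (x + 2)"
proof (induction n arbitrary: x)
  case (Suc n)
  have "walk_avg w (above_at w y n) x \<le> above_at w y n (x + 1)"
    using Suc.IH[OF Suc.prems, of "x - 1"] by (intro walk_avg_le Suc.prems) (auto simp: algebra_simps)
  also have "\<dots> \<le> walk_avg w (above_at w y n) (x + 2)"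
    using Suc.IH[OF Suc.prems, of "x + 1"] by (intro walk_avg_ge Suc.prems) (auto simp: algebra_simps)
  finally show ?case by simp
qed auto

lemma hit_mono_env:
  assumes "env w" "env w'" "\<And>x. w x \<le> w' x"
  shows "hit w a n x \<le> hit w' a n x"
proof (induction n arbitrary: x)
  case (Suc n)
  have "walk_avg w (hit w a n) x \<le> walk_avg w (hit w' a n) x"
    by (intro walk_avg_mono assms Suc)
  also have "\<dots> \<le> walk_avg w' (hit w' a n) x"
    using hit_mono_space[OF assms(2), of a n "x - 1"] by (intro walk_avg_mono_env assms) (simp add: algebra_simps)
  finally show ?case by simp
qed auto

lemma above_mono_env:
  assumes "env w" "env w'" "\<And>x. w x \<le> w' x"
  shows "above_at w y n x \<le> above_at w' y n x"
proof (induction n arbitrary: x)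
  case (Suc n)
  have "walk_avg w (above_at w y n) x \<le> walk_avg w (above_at w' y n) x"
    by (intro walk_avg_mono assms Suc)
  also have "\<dots> \<le> walk_avg w' (above_at w' y n) x"
    using above_mono_space[OF assms(2), of y n "x - 1"] by (intro walk_avg_mono_env assms) (simp add: algebra_simps)
  finally show ?case by simp
qed auto

lemma above_antimono:
  assumes "env w" "y \<le> y'"
  shows "above_at w y' n x \<le> above_at w y n x"
proof (induction n arbitrary: x)
  case (Suc n)
  then show ?case by (auto intro!: walk_avg_mono assms)
qed (use assms in auto)

text \<open>Steps have size 1, so being strictly beyond \<open>a\<close> at time
  \<open>Suc n\<close> forces a visit to \<open>[a, \<infinity>)\<close> by time \<open>n\<close>.
  The unit of time saved matches the strict inequality for the hitting time in the theorem.\<close>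

lemma above_Suc_le_hit:
  assumes "env w"
  shows "above_at w a (Suc n) x \<le> hit w a n x"
proof (induction n arbitrary: x)
  case 0
  have "walk_avg w (\<lambda>x. of_bool (a < x)) x \<le> of_bool (a \<le> x)"
    by (cases "a \<le> x") (auto intro!: walk_avg_le assms)
  then show ?case by simp
next
  case (Suc n)
  show ?case
  proof (cases "a \<le> x")
    case True
    then show ?thesis using above_bounds[OF assms, of a "Suc (Suc n)" x] by (simp del: above_at.simps)
  next
    case False
    then show ?thesis
      by (simp del: above_at.simps add: above_at.simps(2)[of w a "Suc n"])
        (intro walk_avg_mono assms Suc)
  qed
qed

text \<open>The strong Markov property at the first visit to \<open>m\<close>: whatever time
  remains, the walk is then above \<open>y\<close> with probability at least
  \<open>c\<close>.\<close>

lemma above_ge_hit: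
  assumes "env w" "0 \<le> c" "\<And>k. k \<le> n \<Longrightarrow> c \<le> above_at w y k m" "x \<le> m"
  shows "c * hit w m n x \<le> above_at w y n x"
  using assms(3,4)
proof (induction n arbitrary: x)
  case 0
  then show ?case using assms by auto
next
  case (Suc n)
  show ?case
  proof (cases "x = m")
    case True
    then show ?thesis using Suc.prems by (simp del: above_at.simps hit.simps)
  next
    case False
    have "c * walk_avg w (hit w m n) x = walk_avg w (\<lambda>x. c * hit w m n x) x"
      by (simp add: walk_avg_def algebra_simps)
    also have "\<dots> \<le> walk_avg w (above_at w y n) x"
    proof -
      have "c * hit w m n v \<le> above_at w y n v" if "v \<le> m" for v
        by (rule Suc.IH) (use Suc.prems(1) that in auto)
      then show ?thesis using False Suc.prems by (intro walk_avg_mono assms) auto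
    qed
    finally show ?thesis using False Suc.prems by simp
  qed
qed

section \<open>Odds ratios and the scale function\<close>

lemma rho_nonneg: "0 \<le> p \<Longrightarrow> p \<le> 1 \<Longrightarrow> 0 \<le> rho p"
  by (simp add: rho_def)

lemma rho_add_1: "p \<noteq> 0 \<Longrightarrow> 1 + rho p = 1 / p"
  by (simp add: rho_def field_simps)

lemma mult_rho: "p \<noteq> 0 \<Longrightarrow> p * rho p = 1 - p"
  by (simp add: rho_def)

definition rho_prod :: "(int \<Rightarrow> real) \<Rightarrow> int \<Rightarrow> int \<Rightarrow> real" where
  "rho_prod w y j = (\<Prod>i\<in>{y<..j}. rho (w i))"

lemma rho_prod_nonneg: "env w \<Longrightarrow> 0 \<le> rho_prod w y j"
  by (auto simp: rho_prod_def env_def intro!: prod_nonneg rho_nonneg)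

lemma rho_prod_step: "y < x \<Longrightarrow> rho_prod w y x = rho_prod w y (x - 1) * rho (w x)"
proof -
  assume "y < x"
  then have "{y<..x} = insert x {y<..x - 1}" by auto
  then show ?thesis by (simp add: rho_prod_def)
qed

text \<open>The scale function of the walk, normalised to vanish far to the right, controls backtracking
  to \<open>y\<close>.\<close>

lemma above_ge_scale:
  assumes "env w" "\<And>x. 0 < w x" "y \<le> x" "x + int k \<le> M + 1" "y \<le> M"
  shows "1 - (\<Sum>j\<in>{x..M}. rho_prod w y j) \<le> above_at w y k x"
  using assms(3,4)
proof (induction k arbitrary: x)
  case 0
  have s: "0 \<le> (\<Sum>j\<in>{x..M}. rho_prod w y j)" for x
    by (intro sum_nonneg rho_prod_nonneg assms)
  \<comment> \<open>The term at \<open>y\<close> is an empty product, so the claimed bound is at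
    most 0 for a walk sitting at \<open>y\<close>.\<close>
  have "1 \<le> (\<Sum>j\<in>{y..M}. rho_prod w y j)"
  proof -
    have "rho_prod w y y \<le> (\<Sum>j\<in>{y..M}. rho_prod w y j)"
      using assms by (intro member_le_sum rho_prod_nonneg) auto
    then show ?thesis by (simp add: rho_prod_def)
  qed
  then show ?case using 0 s[of x] by (cases "x = y") auto
next
  case (Suc k)
  let ?s = "\<lambda>x. \<Sum>j\<in>{x..M}. rho_prod w y j"
  show ?case
  proof (cases "x = y")
    case True
    have "rho_prod w y y \<le> ?s y"
      using assms by (intro member_le_sum rho_prod_nonneg) auto
    then have "1 \<le> ?s x" using True by (simp add: rho_prod_def)
    then show ?thesis using above_bounds[OF assms(1), of y "Suc k" x] by linarith
  next
    case False
    then have xy: "y < x" using Suc.prems by simp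
    have "{x - 1..M} = insert (x - 1) {x..M}" "{x..M} = insert x {x+1..M}"
      using Suc.prems by auto
    then have 1: "?s (x - 1) = rho_prod w y (x - 1) + ?s x" and 2: "?s x = rho_prod w y x + ?s (x + 1)"
      by (simp_all)
    \<comment> \<open>Detailed balance: it makes \<open>1 - ?s\<close> harmonic at every site right
      of \<open>y\<close>. The condition \<open>x + int k \<le> M + 1\<close> keeps the walk away
      from the truncation of the sum at \<open>M\<close>.\<close>
    have "w x * rho_prod w y x = (1 - w x) * rho_prod w y (x - 1)"
      using mult_rho[of "w x"] assms(2)[of x] by (simp add: rho_prod_step[OF xy])
    moreover have 3: "?s (x + 1) = ?s x - rho_prod w y x" using 2 by linarith
    ultimately have "1 - ?s x = walk_avg w (\<lambda>x. 1 - ?s x) x"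
      unfolding walk_avg_def 1 3 by (simp add: algebra_simps)
    also have "\<dots> \<le> walk_avg w (above_at w y k) x"
      using Suc xy by (intro walk_avg_mono assms Suc.IH) auto
    finally show ?thesis by simp
  qed
qed

section \<open>Reflecting walls\<close>

text \<open>The factor \<open>n\<close> comes from decomposing at the last visit to the wall \<open>x\<close>.\<close>

lemma hit_wall:
  assumes w: "env w" and x: "0 < w x" and "k \<le> n" "1 \<le> n"
  shows "hit (w(x := 1)) a k z \<le> (real n / w x) * hit w a k z"
proof -
  let ?u = "hit (w(x := 1)) a" and ?h = "hit w a"
  have w': "env (w(x := 1))" using w by (auto simp: env_def)
  have c: "1 \<le> real n / w x" using assms envD(2)[OF w, of x] by (simp add: field_simps)
  have other: "?u (Suc t) z = (if a \<le> z then 1 else walk_avg w (?u t) z)" if "z \<noteq> x" for t z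
    using that by (simp add: walk_avg_def)
  have base: "?u t x \<le> real t * ?h t x / w x" if xa: "x < a" for t
  proof -
    \<comment> \<open>Right of \<open>x\<close> the wall is not felt before the first visit to
      \<open>x\<close>. Either \<open>a\<close> is reached without such a visit, which
      \<open>?h\<close> counts, or \<open>x\<close> is visited after at least one step and at most
      \<open>t\<close> steps remain.\<close>
    have right: "?u (Suc t) z \<le> ?h (Suc t) z + ?u t x" if "x < z" for t z
      using that
    proof (induction t arbitrary: z)
      case 0
      then show ?case using xa by (auto simp: walk_avg_def)
    next
      case (Suc t)
      have "?u (Suc t) v \<le> ?h (Suc t) v + ?u (Suc t) x" if "x \<le> v" for v
      proof (cases "v = x")
        case True
        then show ?thesis using hit_bounds[OF w, of a "Suc t" x] by (simp del: hit.simps)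
      next
        case False
        then show ?thesis
          using Suc.IH[of v] that hit_mono_time_Suc[OF w', of a t x] by linarith
      qed
      then have "walk_avg w (?u (Suc t)) z \<le> walk_avg w (\<lambda>v. 1 * ?h (Suc t) v + ?u (Suc t) x) z"
        using Suc.prems by (intro walk_avg_mono w) (simp_all del: hit.simps)
      also have "\<dots> = walk_avg w (?h (Suc t)) z + ?u (Suc t) x"
        by (subst walk_avg_affine) simp
      finally show ?case
        using Suc.prems hit_bounds[OF w', of a "Suc t" x]
        by (subst other) (auto simp del: hit.simps simp: hit.simps(2)[of w a "Suc t"])
    qed
    have step: "?h t (x + 1) \<le> ?h (Suc t) x / w x" for t
    proof -
      have "w x * ?h t (x + 1) \<le> ?h (Suc t) x"
        using xa hit_bounds[OF w, of a t "x - 1"] envD[OF w, of x] by (simp add: walk_avg_def)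
      then show ?thesis using x by (simp add: field_simps del: hit.simps)
    qed
    have wall: "?u (Suc t) x = ?u t (x + 1)" for t
      using xa by (simp add: walk_avg_def)
    \<comment> \<open>One step to the right from the wall, followed by \<open>right\<close>: each
      further unit of time adds at most \<open>?h (Suc t) x / w x\<close>. Summing these increments
      gives the factor \<open>t\<close>.\<close>
    have inc: "?u (Suc t) x \<le> ?h (Suc t) x / w x + ?u t x" for t
    proof (cases t)
      case 0
      then show ?thesis using wall[of 0] step[of 0] xa by simp
    next
      case (Suc s)
      have "?u (Suc t) x \<le> ?h t (x + 1) + ?u s x"
        using right[of "x + 1" s] by (simp del: hit.simps add: wall Suc)
      also have "\<dots> \<le> ?h (Suc t) x / w x + ?u t x"
        using step[of t] hit_mono_time_Suc[OF w', of a s x] by (simp del: hit.simps add: Suc)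
      finally show ?thesis .
    qed
    show ?thesis
    proof (induction t)
      case 0
      then show ?case using xa by simp
    next
      case (Suc t)
      have "?u (Suc t) x \<le> ?h (Suc t) x / w x + real t * ?h t x / w x"
        using inc[of t] Suc by linarith
      also have "\<dots> \<le> ?h (Suc t) x / w x + real t * ?h (Suc t) x / w x"
        using hit_mono_time_Suc[OF w, of a t x] x by (intro add_left_mono divide_right_mono mult_left_mono) auto
      finally show ?case
        by (simp del: hit.simps fun_upd_apply add: add_divide_distrib distrib_right)
    qed
  qed
  show ?thesis using \<open>k \<le> n\<close>
  proof (induction k arbitrary: z)
    case 0
    then show ?case using c by (simp add: of_bool_def)
  next
    case (Suc k)
    show ?case
    proof (cases "z = x")
      case True
      show ?thesis
      proof (cases "a \<le> x")
        case False
        then have "?u (Suc k) x \<le> real (Suc k) * ?h (Suc k) x / w x" by (intro base) simp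
        also have "\<dots> \<le> real n * ?h (Suc k) x / w x"
          using Suc.prems hit_bounds[OF w, of a "Suc k" x] x
          by (intro divide_right_mono mult_right_mono) auto
        finally show ?thesis using True by (simp del: hit.simps fun_upd_apply)
      qed (use True c in auto)
    next
      case False
      show ?thesis
      proof (cases "a \<le> z")
        case False
        have "walk_avg w (?u k) z \<le> walk_avg w (\<lambda>v. (real n / w x) * ?h k v + 0) z"
          using Suc by (intro walk_avg_mono w) (auto simp del: fun_upd_apply)
        also have "\<dots> = (real n / w x) * walk_avg w (?h k) z"
          by (subst walk_avg_affine) simp
        finally have "walk_avg w (?u k) z \<le> (real n / w x) * walk_avg w (?h k) z" .
        then show ?thesis using False other[OF \<open>z \<noteq> x\<close>, of k]
          by (simp del: fun_upd_apply)
      qed (use c in auto)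
    qed
  qed
qed

text \<open>The walls are put in one at a time; a site outside \<open>D\<close> still carries its
  old \<open>w x\<close>, so the factors from \<open>hit_wall\<close> multiply.\<close>

lemma hit_walls:
  assumes "finite D" "env w" "\<And>x. 0 < w x" "1 \<le> n"
  shows "hit (\<lambda>x. if x \<in> D then 1 else w x) a n z \<le> (\<Prod>x\<in>D. real n / w x) * hit w a n z"
  using assms(1)
proof (induction D)
  case (insert x D)
  let ?w = "\<lambda>x. if x \<in> D then 1 else w x"
  have "env ?w" using assms(2) by (auto simp: env_def)
  moreover have "(\<lambda>y. if y \<in> insert x D then 1 else w y) = ?w(x := 1)"
    by auto
  ultimately have "hit (\<lambda>y. if y \<in> insert x D then 1 else w y) a n z \<le> (real n / ?w x) * hit ?w a n z"
    using hit_wall[of ?w x n n a z] assms by (simp only:) (auto simp: less_imp_le)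
  also have "\<dots> \<le> (real n / w x) * ((\<Prod>x\<in>D. real n / w x) * hit w a n z)"
    using insert assms(3)[of x] by (intro mult_mono) (auto intro!: hit_bounds[THEN conjunct1] \<open>env ?w\<close>)
  finally show ?case using insert by (simp add: mult.assoc)
qed simp

text \<open>Markov's inequality for the time needed to reach \<open>m\<close>, with
  \<open>t i\<close> a supersolution of the recursion for the expected time from \<open>i\<close> to
  \<open>i + 1\<close>. It is proved by induction on \<open>n\<close>, so no expectation of a
  hitting time has to be formed.\<close>

lemma hit_ge_markov:
  fixes t :: "nat \<Rightarrow> real"
  assumes w: "env w" "w 0 = 1" and t: "1 \<le> t 0" "\<And>j. 0 \<le> t j"
    and rec: "\<And>j. Suc j < m \<Longrightarrow> 1 + (1 - w (int (Suc j))) * t j \<le> w (int (Suc j)) * t (Suc j)"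
    and "j \<le> m"
  shows "real n * (1 - hit w (int m) n (int j)) \<le> (\<Sum>i\<in>{j..<m}. t i)"
  using \<open>j \<le> m\<close>
proof (induction n arbitrary: j)
  case 0
  then show ?case using t by (auto intro!: sum_nonneg)
next
  case (Suc n)
  let ?S = "\<lambda>j. \<Sum>i\<in>{j..<m}. t i"
  show ?case
  proof (cases "j = m")
    case False
    then have jm: "j < m" using Suc.prems by simp
    have S: "?S j = t j + ?S (Suc j)" using jm by (simp add: sum.atLeast_Suc_lessThan)
    \<comment> \<open>Passing from the factor \<open>n\<close> to \<open>n + 1\<close> costs at most
      1, since \<open>1 - hit\<close> is at most 1; this is the unit of time spent by the next
      step.\<close>
    have IH: "(real n + 1) * (1 - hit w (int m) n (int i)) \<le> 1 + ?S i" if "i \<le> m" for i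
      using Suc.IH[OF that] hit_bounds[OF w(1), of "int m" n "int i"] by (simp add: algebra_simps)
    let ?g = "\<lambda>x. (real n + 1) * (1 - hit w (int m) n x)"
    have "real (Suc n) * (1 - hit w (int m) (Suc n) (int j)) = walk_avg w ?g (int j)"
      using jm by (simp add: walk_avg_def algebra_simps)
    also have "\<dots> \<le> ?S j"
    proof (cases j)
      case 0
      have "?g 1 \<le> 1 + ?S 1" using IH[of 1] jm 0 by simp
      then show ?thesis using S t w 0 by (simp add: walk_avg_def)
    next
      case (Suc i)
      have S': "?S i = t i + ?S j" using jm Suc by (simp add: sum.atLeast_Suc_lessThan)
      have "walk_avg w ?g (int j) \<le> w (int j) * (1 + ?S (Suc j)) + (1 - w (int j)) * (1 + ?S i)"
        using IH[of "Suc j"] IH[of i] jm Suc unfolding walk_avg_def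
        by (intro add_mono mult_left_mono) (auto simp: envD[OF w(1)] add.commute simp del: sum.op_ivl_Suc)
      also have "\<dots> = 1 + ?S j - w (int j) * t j + (1 - w (int j)) * t i"
        using S S' by (simp add: algebra_simps del: sum.op_ivl_Suc)
      also have "\<dots> \<le> ?S j" using rec[of i] jm Suc by simp
      finally show ?thesis .
    qed
    finally show ?thesis .
  qed simp
qed

section \<open>The Laplace transform of crossing times\<close>

text \<open>The discount is \<open>1 / (1 + l)\<close> per step. The starting value is that of a
  reflecting origin: with \<open>w = 1\<close> and \<open>rho 1 = 0\<close> the recursion gives
  exactly \<open>l\<close>.\<close>

primrec decay :: "real \<Rightarrow> (int \<Rightarrow> real) \<Rightarrow> nat \<Rightarrow> real" where
  "decay l w 0 = l"
| "decay l w (Suc j) = l / w (int (Suc j)) + rho (w (int (Suc j))) * (decay l w j / (1 + decay l w j))"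

lemma decay_nonneg: "0 \<le> l \<Longrightarrow> env w \<Longrightarrow> 0 \<le> decay l w j"
  by (induction j) (auto simp: env_def intro!: add_nonneg_nonneg mult_nonneg_nonneg divide_nonneg_nonneg rho_nonneg)

text \<open>The product on the right is a supersolution for the Laplace transform of the hitting time.\<close>

lemma hit_le_decay:
  assumes w: "env w" "\<And>x. 0 < w x" "w 0 = 1" and l: "0 \<le> l" and "j \<le> m"
  shows "hit w (int m) n (int j) \<le> (1 + l) ^ n * (\<Prod>i\<in>{j..<m}. 1 / (1 + decay l w i))"
  using \<open>j \<le> m\<close>
proof (induction n arbitrary: j)
  case 0
  have "0 \<le> (\<Prod>i\<in>{j..<m}. 1 / (1 + decay l w i))"
    using decay_nonneg[OF l w(1)] by (intro prod_nonneg) (auto simp: add_nonneg_nonneg)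
  then show ?case using 0 by (cases "j = m") auto
next
  case (Suc n)
  let ?z = "decay l w" and ?P = "\<lambda>j. \<Prod>i\<in>{j..<m}. 1 / (1 + decay l w i)"
  have z: "0 \<le> ?z i" for i by (rule decay_nonneg[OF l w(1)])
  have z1: "0 < 1 + ?z i" for i using z[of i] by linarith
  show ?case
  proof (cases "j = m")
    case True
    then show ?thesis using one_le_power[of "1 + l" "Suc n"] l by (simp del: power_Suc)
  next
    case False
    then have jm: "j < m" using Suc.prems by simp
    have P: "?P (Suc j) = (1 + ?z j) * ?P j"
      using z1[of j] jm by (simp add: prod.atLeast_Suc_lessThan del: prod.op_ivl_Suc)
    have P0: "0 \<le> ?P j" using z1 by (intro prod_nonneg) (auto simp: less_imp_le)
    have l0: "0 \<le> (1 + l) ^ n" using l by simp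
    have up: "hit w (int m) n (int j + 1) \<le> (1 + l) ^ n * ?P (Suc j)"
      using Suc.IH[of "Suc j"] jm by (simp add: add.commute)
    have "walk_avg w (hit w (int m) n) (int j) \<le> (1 + l) ^ n * ((1 + l) * ?P j)"
    proof (cases j)
      case 0
      then show ?thesis using up P w(3) by (simp add: walk_avg_def)
    next
      case (Suc i)
      have down: "hit w (int m) n (int j - 1) \<le> (1 + l) ^ n * ?P i"
        using Suc.IH[of i] jm Suc by simp
      have Pi: "?P i = 1 / (1 + ?z i) * ?P j"
        using jm Suc by (simp add: prod.atLeast_Suc_lessThan)
      have "walk_avg w (hit w (int m) n) (int j) \<le>
          w (int j) * ((1 + l) ^ n * ?P (Suc j)) + (1 - w (int j)) * ((1 + l) ^ n * ?P i)"
        unfolding walk_avg_def using up down envD[OF w(1), of "int j"]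
        by (intro add_mono mult_left_mono) auto
      also have "\<dots> = (1 + l) ^ n * ((w (int j) * (1 + ?z j) + (1 - w (int j)) * (1 / (1 + ?z i))) * ?P j)"
        unfolding P Pi by (simp only: algebra_simps)
      \<comment> \<open>The equation from which \<open>decay\<close> arises: one step of the walk
        multiplies the product by exactly \<open>1 + l\<close>, and solving for \<open>?z j\<close>
        gives the recursion.\<close>
      also have "w (int j) * (1 + ?z j) + (1 - w (int j)) * (1 / (1 + ?z i)) = 1 + l"
      proof -
        have "w (int j) * ?z j = l + (w (int j) * rho (w (int j))) * (?z i / (1 + ?z i))"
          using w(2)[of "int j"] Suc by (simp add: distrib_left)
        also have "w (int j) * rho (w (int j)) = 1 - w (int j)"
          using w(2)[of "int j"] by (intro mult_rho) simp
        also have "?z i / (1 + ?z i) = 1 - 1 / (1 + ?z i)"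
          using z1[of i] by (simp add: field_simps)
        finally show ?thesis by (simp add: algebra_simps)
      qed
      finally show ?thesis .
    qed
    then show ?thesis using jm by (simp add: mult_ac)
  qed
qed

text \<open>Dropping the term \<open>l / w\<close> from the recursion leaves z' * (1 + z) \<ge>
  \<rho> * z for consecutive values z, z'. Iterating it, the growth of the product of the \<rho>
  shows up either in the last value of \<open>decay\<close> or in the collected factors
  \<open>1 + decay\<close>.\<close>

lemma decay_climb:
  assumes w: "env w" "\<And>x. 0 < w x" and l: "0 \<le> l"
  shows "l * rho_prod w (int b) (int (b + Suc j)) \<le>
    decay l w (b + Suc j) * (\<Prod>i\<in>{b<..<b + Suc j}. 1 + decay l w i)"
proof (induction j)
  case 0
  have e: "{b<..<b + Suc 0} = {}" "{int b<..int b + 1} = {int b + 1}" by auto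
  have "0 \<le> rho (w (int b + 1)) * (decay l w b / (1 + decay l w b))"
    using decay_nonneg[OF l w(1), of b] w(1)
    by (auto simp: env_def intro!: mult_nonneg_nonneg divide_nonneg_nonneg rho_nonneg)
  moreover have "l / w (int b + 1) = l + l * rho (w (int b + 1))"
    using rho_add_1[of "w (int b + 1)"] w(2)[of "int b + 1"]
    by (metis distrib_left less_irrefl mult.right_neutral times_divide_eq_right)
  ultimately show ?case using e l by (simp add: rho_prod_def add.commute)
next
  case (Suc j)
  let ?c = "b + Suc j" and ?z = "decay l w"
  let ?P = "\<Prod>i\<in>{b<..<?c}. 1 + ?z i"
  have z: "0 \<le> ?z i" for i by (rule decay_nonneg[OF l w(1)])
  have z1: "0 < 1 + ?z i" for i using z[of i] by linarith
  have r: "0 \<le> rho (w x)" for x using w(1) by (auto simp: env_def intro!: rho_nonneg)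
  have P: "0 \<le> ?P" using z1 by (intro prod_nonneg) (auto simp: less_imp_le)
  have split: "(\<Prod>i\<in>{b<..<b + Suc (Suc j)}. 1 + ?z i) = (1 + ?z ?c) * ?P"
  proof -
    have "{b<..<b + Suc (Suc j)} = insert ?c {b<..<?c}" by auto
    then show ?thesis by simp
  qed
  have "l * rho_prod w (int b) (int (b + Suc (Suc j))) =
      rho (w (int (Suc ?c))) * (l * rho_prod w (int b) (int ?c))"
    by (subst rho_prod_step) (simp_all add: algebra_simps)
  also have "\<dots> \<le> rho (w (int (Suc ?c))) * (?z ?c * ?P)"
    by (intro mult_left_mono Suc r)
  also have "\<dots> = (rho (w (int (Suc ?c))) * (?z ?c / (1 + ?z ?c))) * ((1 + ?z ?c) * ?P)"
    using z1[of ?c] by simp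
  also have "\<dots> \<le> ?z (Suc ?c) * ((1 + ?z ?c) * ?P)"
    using l w(2)[of "int (Suc ?c)"] P z1[of ?c]
    by (intro mult_right_mono mult_nonneg_nonneg) (auto simp: less_imp_le)
  finally show ?case unfolding split by simp
qed

text \<open>If c is the site of the climb and P the product over the earlier sites of the block,
  then (1 + z) * P = P + z * P with z the value of \<open>decay\<close> at c. The first summand is
  at least 1 trivially, the second by \<open>decay_climb\<close>.\<close>

lemma decay_block:
  assumes w: "env w" "\<And>x. 0 < w x" and l: "0 \<le> l" and j: "j < L"
    and climb: "1 \<le> l * rho_prod w (int b) (int (b + Suc j))"
  shows "2 \<le> (\<Prod>i\<in>{b<..b + L}. 1 + decay l w i)"
proof -
  let ?z = "decay l w"
  have z: "0 \<le> ?z i" for i by (rule decay_nonneg[OF l w(1)])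
  have z1: "1 \<le> 1 + ?z i" for i using z[of i] by linarith
  let ?P = "\<Prod>i\<in>{b<..<b + Suc j}. 1 + ?z i"
  have "1 \<le> ?P" using z by (intro prod_ge_1) auto
  then have "2 \<le> (1 + ?z (b + Suc j)) * ?P"
    using decay_climb[OF w l, of b j] climb by (simp only: distrib_right)
  also have "\<dots> = (\<Prod>i\<in>{b<..b + Suc j}. 1 + ?z i)"
  proof -
    have "{b<..b + Suc j} = insert (b + Suc j) {b<..<b + Suc j}" by auto
    then show ?thesis by simp
  qed
  also have "\<dots> \<le> (\<Prod>i\<in>{b<..b + L}. 1 + ?z i)"
    using j z by (intro prod_mono2) (auto simp: add_nonneg_nonneg)
  finally show ?thesis .
qed

section \<open>Expected crossing times and the choice of walls\<close>

text \<open>The expected time E' to cross from one site satisfies w * E' = 1 + (1 - w) * E with E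
  that of its left neighbour; dividing by w gives this recursion. The starting value is
  \<open>1 / w 0\<close>, the expected number of attempts to step right from the origin.\<close>

primrec cross :: "(int \<Rightarrow> real) \<Rightarrow> nat \<Rightarrow> real" where
  "cross w 0 = 1 + rho (w 0)"
| "cross w (Suc z) = 1 + rho (w (int (Suc z))) * (1 + cross w z)"

text \<open>The crossing times after the walls are put in. The test compares \<open>cross\<close>,
  not \<open>cross_walls\<close>, with \<open>H\<close>: the set of walls is thus governed by a
  sequence whose moments are known, and \<open>cross_walls\<close> is still at most \<open>H\<close>
  everywhere.\<close>

primrec cross_walls :: "real \<Rightarrow> (int \<Rightarrow> real) \<Rightarrow> nat \<Rightarrow> real" where
  "cross_walls H w 0 = 1"
| "cross_walls H w (Suc z) =
    (if H < cross w (Suc z) then 1 else 1 + rho (w (int (Suc z))) * (1 + cross_walls H w z))"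

text \<open>Since \<open>1 + rho p = 1 / p\<close>, the price \<open>1 / w\<close> of a wall is
  bounded by the crossing time at its site.\<close>

lemma cross_ge_rho:
  assumes "env w"
  shows "1 + rho (w (int z)) \<le> cross w z"
proof -
  have r: "0 \<le> rho (w x)" for x using assms by (auto simp: env_def intro!: rho_nonneg)
  have "0 \<le> cross w z" for z
    by (induction z) (use r in \<open>auto intro!: add_nonneg_nonneg mult_nonneg_nonneg\<close>)
  then have "rho (w (int (Suc y))) * 1 \<le> rho (w (int (Suc y))) * (1 + cross w y)" for y
    using r by (intro mult_left_mono) auto
  then show ?thesis by (cases z) auto
qed

lemma cross_ge_1: "env w \<Longrightarrow> 1 \<le> cross w z"
  using cross_ge_rho[of w z] rho_nonneg[of "w (int z)"] envD[of w "int z"] by linarith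

lemma cross_walls_bounds:
  assumes w: "env w" and H: "1 \<le> H"
  shows "0 \<le> cross_walls H w z \<and> cross_walls H w z \<le> cross w z \<and> cross_walls H w z \<le> H"
proof (induction z)
  case 0
  then show ?case using H w by (auto simp: env_def intro!: rho_nonneg)
next
  case (Suc z)
  have r: "0 \<le> rho (w (int (Suc z)))" using w by (auto simp: env_def intro!: rho_nonneg)
  then have "rho (w (int (Suc z))) * (1 + cross_walls H w z) \<le> rho (w (int (Suc z))) * (1 + cross w z)"
    using Suc by (intro mult_left_mono) auto
  moreover have "0 \<le> rho (w (int (Suc z))) * (1 + cross_walls H w z)"
    using r Suc by (intro mult_nonneg_nonneg) auto
  ultimately show ?case using H cross_ge_1[OF w, of "Suc z"] by auto
qed

lemma ln_le_powr:
  fixes d x :: real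
  assumes "0 < d" "1 \<le> x"
  shows "ln x \<le> x powr d / d"
proof -
  have "d * ln x = ln (x powr d)" using assms by (simp add: ln_powr)
  also have "\<dots> \<le> x powr d" using assms ln_le_minus_one[of "x powr d"] by simp
  finally show ?thesis using assms by (simp add: field_simps)
qed

text \<open>Walls are put at the origin and wherever the expected crossing time exceeds \<open>H\<close>.\<close>

lemma hit_ge_cross:
  fixes q d H :: real
  assumes w: "env w" "\<And>x. 0 < w x" and H: "1 \<le> H" and q: "0 < d" "d < q" "q \<le> 1"
    and n: "1 \<le> n" and m: "1 \<le> m"
    and S: "H powr (1 - q) * (\<Sum>z<m. cross w z powr q) \<le> real n / 2"
  shows "exp (- (ln n + ln (cross w 0) +
      (ln n + 1 / d) * (H powr (- (q - d)) * (\<Sum>z<m. cross w z powr q)))) / 2 \<le> hit w (int m) n 0"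
proof -
  let ?U = "cross w" and ?t = "cross_walls H w"
  \<comment> \<open>The origin is a wall in any case, as \<open>hit_ge_markov\<close> requires; its
    price appears as the separate summand \<open>ln (cross w 0)\<close>.\<close>
  define Z where "Z = {z. z < m \<and> (z = 0 \<or> H < ?U z)}"
  define w' where "w' = (\<lambda>x. if x \<in> int ` Z then 1 else w x)"
  have finZ: "finite Z" by (simp add: Z_def)
  have U1: "1 \<le> ?U z" for z by (rule cross_ge_1[OF w(1)])
  have w': "env w'" using w(1) by (auto simp: env_def w'_def)
  have "real n * (1 - hit w' (int m) n (int 0)) \<le> (\<Sum>i\<in>{0..<m}. ?t i)"
  proof (rule hit_ge_markov[OF w'])
    show "w' 0 = 1" using m by (auto simp: w'_def Z_def image_iff)
    show "0 \<le> ?t j" for j using cross_walls_bounds[OF w(1) H] by blast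
    fix j assume j: "Suc j < m"
    show "1 + (1 - w' (int (Suc j))) * ?t j \<le> w' (int (Suc j)) * ?t (Suc j)"
    proof (cases "H < ?U (Suc j)")
      case True
      then have "w' (int (Suc j)) = 1"
        unfolding w'_def Z_def using j by (auto simp del: of_nat_Suc cross.simps)
      then show ?thesis using True by (simp del: of_nat_Suc cross.simps)
    next
      case False
      then have "int (Suc j) \<notin> int ` Z" by (auto simp: Z_def simp del: of_nat_Suc cross.simps)
      then have w'j: "w' (int (Suc j)) = w (int (Suc j))" by (simp add: w'_def del: of_nat_Suc)
      have "w (int (Suc j)) * (1 + rho (w (int (Suc j))) * (1 + ?t j)) =
          w (int (Suc j)) + (w (int (Suc j)) * rho (w (int (Suc j)))) * (1 + ?t j)"
        by (simp add: algebra_simps)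
      also have "w (int (Suc j)) * rho (w (int (Suc j))) = 1 - w (int (Suc j))"
        using w(2)[of "int (Suc j)"] by (intro mult_rho) simp
      finally show ?thesis using False unfolding w'j by (simp add: algebra_simps del: of_nat_Suc cross.simps)
    qed
  qed (use m in auto)
  also have "\<dots> \<le> (\<Sum>i\<in>{0..<m}. H powr (1 - q) * ?U i powr q)"
  proof (rule sum_mono)
    fix i
    have b: "0 \<le> ?t i" "?t i \<le> ?U i" "?t i \<le> H"
      using cross_walls_bounds[OF w(1) H] by blast+
    \<comment> \<open>Interpolation: the bound by \<open>H\<close> is used for the power
      \<open>1 - q\<close>, the bound by \<open>cross\<close> for the power \<open>q\<close>. Only
      the moment of order \<open>q\<close> will be needed.\<close>
    have "?t i = ?t i powr (1 - q) * ?t i powr q"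
      using b by (simp flip: powr_add)
    also have "\<dots> \<le> H powr (1 - q) * ?U i powr q"
      using b q by (intro mult_mono powr_mono2) auto
    finally show "?t i \<le> H powr (1 - q) * ?U i powr q" .
  qed
  also have "\<dots> \<le> real n / 2"
    using S by (simp add: sum_distrib_left atLeast0LessThan)
  finally have half: "1 / 2 \<le> hit w' (int m) n 0"
    using n by (simp add: field_simps)
  have le: "hit w' (int m) n 0 \<le> (\<Prod>x\<in>int ` Z. real n / w x) * hit w (int m) n 0"
    unfolding w'_def by (rule hit_walls) (use finZ w n in auto)
  let ?c = "\<lambda>z. ln n + ln (?U z)"
  let ?Q = "ln n + ln (?U 0) + (ln n + 1 / d) * (H powr (- (q - d)) * (\<Sum>z<m. ?U z powr q))"
  have c0: "0 \<le> ?c z" for z using U1[of z] n by simp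
  have "(\<Prod>x\<in>int ` Z. real n / w x) = (\<Prod>z\<in>Z. real n / w (int z))"
    by (subst prod.reindex) auto
  also have "\<dots> \<le> (\<Prod>z\<in>Z. exp (?c z))"
  proof (rule prod_mono)
    fix z
    have "1 / w (int z) \<le> ?U z"
      using cross_ge_rho[OF w(1), of z] rho_add_1[of "w (int z)"] w(2)[of "int z"] by simp
    then have "real n * (1 / w (int z)) \<le> real n * ?U z" by (intro mult_left_mono) auto
    then show "0 \<le> real n / w (int z) \<and> real n / w (int z) \<le> exp (?c z)"
      using n U1[of z] w(2)[of "int z"] by (auto simp: exp_add less_imp_le)
  qed
  also have "\<dots> = exp (\<Sum>z\<in>Z. ?c z)" by (simp add: exp_sum[OF finZ])
  also have "\<dots> \<le> exp ?Q"
  proof -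
    have "(\<Sum>z\<in>Z. ?c z) \<le> (\<Sum>z\<in>insert 0 {z. z < m \<and> H < ?U z}. ?c z)"
      by (rule sum_mono2) (use c0 in \<open>auto simp: Z_def\<close>)
    also have "\<dots> \<le> ?c 0 + (\<Sum>z\<in>{z. z < m \<and> H < ?U z}. ?c z)"
      using c0[of 0] by (subst sum.insert_if) auto
    also have "(\<Sum>z\<in>{z. z < m \<and> H < ?U z}. ?c z) \<le>
        (\<Sum>z\<in>{z. z < m \<and> H < ?U z}. (ln n + 1 / d) * (H powr (- (q - d)) * ?U z powr q))"
    proof (rule sum_mono)
      fix z assume "z \<in> {z. z < m \<and> H < ?U z}"
      then have Hz: "H \<le> ?U z" by simp
      \<comment> \<open>Chebyshev's inequality with a reserve: at a wall
        \<open>(?U z / H) powr (q - d)\<close> is at least 1, and the spare factor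
        \<open>?U z powr d\<close> absorbs \<open>ln (?U z)\<close> at the price of
        \<open>1 / d\<close>.\<close>
      have e: "H powr (- (q - d)) * ?U z powr q = ?U z powr d * (?U z / H) powr (q - d)"
        using H U1[of z] by (simp add: powr_divide powr_minus field_simps flip: powr_add)
      have f: "1 \<le> (?U z / H) powr (q - d)" using Hz H q by (intro ge_one_powr_ge_zero) auto
      have g: "1 \<le> ?U z powr d" using U1[of z] q by (intro ge_one_powr_ge_zero) auto
      have "1 \<le> H powr (- (q - d)) * ?U z powr q"
        unfolding e using f g mult_mono[of 1 _ 1] by fastforce
      then have "ln n * 1 \<le> ln n * (H powr (- (q - d)) * ?U z powr q)"
        using n by (intro mult_left_mono) auto
      moreover have "ln (?U z) \<le> 1 / d * (H powr (- (q - d)) * ?U z powr q)"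
      proof -
        have "ln (?U z) \<le> ?U z powr d / d * 1" using ln_le_powr[of d "?U z"] U1[of z] q by simp
        also have "\<dots> \<le> ?U z powr d / d * (?U z / H) powr (q - d)"
          using f q by (intro mult_left_mono) auto
        finally show ?thesis unfolding e by simp
      qed
      ultimately show "?c z \<le> (ln n + 1 / d) * (H powr (- (q - d)) * ?U z powr q)"
        by (simp only: distrib_right)
    qed
    also have "\<dots> \<le> (\<Sum>z<m. (ln n + 1 / d) * (H powr (- (q - d)) * ?U z powr q))"
      using n q by (intro sum_mono2) (auto intro!: mult_nonneg_nonneg add_nonneg_nonneg)
    finally show ?thesis by (simp add: sum_distrib_left)
  qed
  finally have "1 / 2 \<le> exp ?Q * hit w (int m) n 0"
    using half le hit_bounds[OF w(1), of "int m" n 0]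
    by (smt (verit) mult_right_mono)
  then have "exp (- ?Q) * (1 / 2) \<le> exp (- ?Q) * (exp ?Q * hit w (int m) n 0)"
    by (intro mult_left_mono) auto
  also have "\<dots> = (exp ?Q * exp (- ?Q)) * hit w (int m) n 0"
    by (simp only: mult_ac)
  also have "\<dots> = hit w (int m) n 0"
    by (simp only: exp_minus_inverse mult_1)
  finally show ?thesis by simp
qed

section \<open>From the path measure to the recursions\<close>

definition path_prefix :: "nat \<Rightarrow> (nat \<Rightarrow> int) \<Rightarrow> (nat \<Rightarrow> int) set" where
  "path_prefix k p = {X. \<forall>i\<le>k. X i = p i}"

lemma sets_prefix [measurable]: "path_prefix k p \<in> sets path_space"
  using measurable_cylinder[of "Suc k" p] by (simp add: path_prefix_def less_Suc_eq_le)

lemma measure_prefix_Suc: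
  assumes "env w" "p 0 = 0"
  shows "measure (quenched_law w) (path_prefix (Suc k) (p(Suc k := p k + 1))) =
      w (p k) * measure (quenched_law w) (path_prefix k p)"
    and "measure (quenched_law w) (path_prefix (Suc k) (p(Suc k := p k - 1))) =
      (1 - w (p k)) * measure (quenched_law w) (path_prefix k p)"
proof -
  have w: "0 \<le> w i \<and> w i \<le> 1" for i using assms(1) by (auto simp: env_def)
  have eq: "measure (quenched_law w) (path_prefix n q) =
      (\<Prod>i<n. if q (Suc i) = q i + 1 then w (q i) else if q (Suc i) = q i - 1 then 1 - w (q i) else 0)"
    if "q 0 = 0" for n q
    unfolding path_prefix_def by (rule measure_quenched_law_path) (use w that in auto)
  show "measure (quenched_law w) (path_prefix (Suc k) (p(Suc k := p k + 1))) =
      w (p k) * measure (quenched_law w) (path_prefix k p)"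
    using assms(2) by (auto simp: eq intro!: prod.cong)
  show "measure (quenched_law w) (path_prefix (Suc k) (p(Suc k := p k - 1))) =
      (1 - w (p k)) * measure (quenched_law w) (path_prefix k p)"
    using assms(2) by (auto simp: eq intro!: prod.cong)
qed

text \<open>The two nearest-neighbour continuations already carry the whole mass of the prefix,
  because their weights add up to 1. Any other continuation is therefore null, inside
  \<open>Q\<close> as well.\<close>

lemma measure_prefix_split:
  assumes w: "env w" and p: "p 0 = 0" and Q [measurable]: "Q \<in> sets path_space"
  shows "measure (quenched_law w) (path_prefix k p \<inter> Q) =
    measure (quenched_law w) (path_prefix (Suc k) (p(Suc k := p k + 1)) \<inter> Q) +
    measure (quenched_law w) (path_prefix (Suc k) (p(Suc k := p k - 1)) \<inter> Q)"
proof -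
  interpret q: prob_space "quenched_law w" by (rule prob_space_quenched_law)
  let ?U = "path_prefix (Suc k) (p(Suc k := p k + 1))" and ?D = "path_prefix (Suc k) (p(Suc k := p k - 1))"
  let ?N = "path_prefix k p - (?U \<union> ?D)"
  have sub: "?U \<subseteq> path_prefix k p" "?D \<subseteq> path_prefix k p" and disj: "?U \<inter> ?D = {}"
    by (auto simp: path_prefix_def)
  have [measurable]: "path_prefix n p \<in> q.events" for n p by simp
  have [measurable]: "Q \<in> q.events" using Q by simp
  have "q.prob (?U \<union> ?D) = q.prob (path_prefix k p)"
    using disj by (subst q.finite_measure_Union)
      (auto simp: measure_prefix_Suc[where p=p and k=k, OF w p] distrib_right[symmetric])
  then have N: "q.prob ?N = 0"
    using sub by (subst q.finite_measure_Diff) auto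
  have "q.prob (path_prefix k p \<inter> Q) = q.prob ((?U \<inter> Q) \<union> (?D \<inter> Q) \<union> (?N \<inter> Q))"
    using sub by (intro arg_cong[where f=q.prob]) auto
  also have "\<dots> = q.prob ((?U \<inter> Q) \<union> (?D \<inter> Q)) + q.prob (?N \<inter> Q)"
    by (rule q.finite_measure_Union) auto
  also have "q.prob (?N \<inter> Q) = 0"
    using q.finite_measure_mono[of "?N \<inter> Q" ?N] N by (auto intro: antisym)
  also have "q.prob ((?U \<inter> Q) \<union> (?D \<inter> Q)) = q.prob (?U \<inter> Q) + q.prob (?D \<inter> Q)"
    using disj by (intro q.finite_measure_Union) auto
  finally show ?thesis by simp
qed

lemma sets_events [measurable]:
  "{X :: nat \<Rightarrow> int. y < X n} \<in> sets path_space" "{X :: nat \<Rightarrow> int. \<exists>i<n. X i = y} \<in> sets path_space"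
proof -
  have "{X \<in> space path_space. y < X n} \<in> sets path_space"
    "{X \<in> space path_space. \<exists>i<n. X i = y} \<in> sets path_space" by measurable
  then show "{X :: nat \<Rightarrow> int. y < X n} \<in> sets path_space" "{X :: nat \<Rightarrow> int. \<exists>i<n. X i = y} \<in> sets path_space"
    by simp_all
qed

text \<open>The Markov property at time \<open>k\<close>, by induction on the remaining time; the
  prefix has to stay arbitrary, since each step lengthens it by one.\<close>

lemma measure_prefix_above:
  assumes w: "env w"
  shows "p 0 = 0 \<Longrightarrow> measure (quenched_law w) (path_prefix k p \<inter> {X. y < X (k + n)}) =
    measure (quenched_law w) (path_prefix k p) * above_at w y n (p k)"
proof (induction n arbitrary: k p)
  case 0
  have "path_prefix k p \<inter> {X. y < X k} = (if y < p k then path_prefix k p else {})"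
    by (auto simp: path_prefix_def)
  then show ?case by simp
next
  case (Suc n)
  let ?m = "measure (quenched_law w)" and ?Q = "{X. y < X (k + Suc n)}"
  define u d where "u = p(Suc k := p k + 1)" and "d = p(Suc k := p k - 1)"
  have [simp]: "u 0 = 0" "d 0 = 0" "u (Suc k) = p k + 1" "d (Suc k) = p k - 1"
    using Suc.prems by (simp_all add: u_def d_def)
  have m: "?m (path_prefix (Suc k) u) = w (p k) * ?m (path_prefix k p)"
    "?m (path_prefix (Suc k) d) = (1 - w (p k)) * ?m (path_prefix k p)"
    unfolding u_def d_def by (rule measure_prefix_Suc[where p=p and k=k, OF w Suc.prems])+
  have "?m (path_prefix k p \<inter> ?Q) = ?m (path_prefix (Suc k) u \<inter> ?Q) +
      ?m (path_prefix (Suc k) d \<inter> ?Q)"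
    unfolding u_def d_def by (intro measure_prefix_split w Suc.prems sets_events)
  also have "?m (path_prefix (Suc k) u \<inter> ?Q) =
      w (p k) * ?m (path_prefix k p) * above_at w y n (p k + 1)"
    using Suc.IH[of u "Suc k"] by (simp add: m)
  also have "?m (path_prefix (Suc k) d \<inter> ?Q) =
      (1 - w (p k)) * ?m (path_prefix k p) * above_at w y n (p k - 1)"
    using Suc.IH[of d "Suc k"] by (simp add: m)
  finally show ?case by (simp add: walk_avg_def algebra_simps)
qed

lemma measure_quenched_above:
  assumes "env w"
  shows "measure (quenched_law w) {X. y < X n} = above_at w y n 0"
proof -
  interpret q: prob_space "quenched_law w" by (rule prob_space_quenched_law)
  have one: "q.prob (path_prefix 0 (\<lambda>_. 0)) = 1"
    using measure_quenched_law_path[of w "\<lambda>_. 0" 0] assms by (simp add: path_prefix_def env_def)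
  have [measurable]: "{X. y < X n} \<in> q.events" by (simp add: sets_events)
  have [measurable]: "path_prefix 0 (\<lambda>_. 0) \<in> q.events" by simp
  have "q.prob {X. y < X n} = q.prob (path_prefix 0 (\<lambda>_. 0) \<inter> {X. y < X n})"
    by (intro q.finite_measure_eq_AE)
       (use q.AE_prob_1[OF one] sets_events in auto)
  then show ?thesis using measure_prefix_above[OF assms, of "\<lambda>_. 0" 0 y n] one by simp
qed

text \<open>The recursion \<open>hit\<close> stops on all of \<open>[a, \<infinity>)\<close>, the
  event asks for a visit to \<open>a\<close> itself. From a position at or below \<open>a\<close>
  the two agree, as unit steps cannot skip \<open>a\<close>.\<close>

lemma measure_prefix_hit:
  assumes w: "env w"
  shows "p 0 = 0 \<Longrightarrow> p k \<le> a \<Longrightarrow> measure (quenched_law w) (path_prefix k p \<inter> {X. \<exists>i\<in>{k..k + n}. X i = a}) =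
    measure (quenched_law w) (path_prefix k p) * hit w a n (p k)"
proof (induction n arbitrary: k p)
  case 0
  have "path_prefix k p \<inter> {X. X k = a} = (if a \<le> p k then path_prefix k p else {})"
    using 0 by (auto simp: path_prefix_def)
  then show ?case by simp
next
  case (Suc n)
  have sets: "{X. \<exists>i\<in>{l..k + Suc n}. X i = a} \<in> sets path_space" for l
  proof -
    have "{X \<in> space path_space. \<exists>i\<in>{l..k + Suc n}. X i = a} \<in> sets path_space" by measurable
    then show ?thesis by simp
  qed
  show ?case
  proof (cases "p k = a")
    case True
    then have "path_prefix k p \<inter> {X. \<exists>i\<in>{k..k + Suc n}. X i = a} = path_prefix k p"
      by (auto simp: path_prefix_def)
    then show ?thesis using True by (simp del: hit.simps)
  next
    case False
    have "{k..k + Suc n} = insert k {Suc k..Suc k + n}" by auto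
    then have eq: "path_prefix (Suc k) (p(Suc k := v)) \<inter> {X. \<exists>i\<in>{k..k + Suc n}. X i = a} =
        path_prefix (Suc k) (p(Suc k := v)) \<inter> {X. \<exists>i\<in>{Suc k..Suc k + n}. X i = a}" for v
      using False by (auto simp: path_prefix_def)
    let ?m = "measure (quenched_law w)" and ?Q = "{X. \<exists>i\<in>{k..k + Suc n}. X i = a}"
    define u d where "u = p(Suc k := p k + 1)" and "d = p(Suc k := p k - 1)"
    have [simp]: "u 0 = 0" "d 0 = 0" "u (Suc k) = p k + 1" "d (Suc k) = p k - 1"
      using Suc.prems by (simp_all add: u_def d_def)
    have m: "?m (path_prefix (Suc k) u) = w (p k) * ?m (path_prefix k p)"
      "?m (path_prefix (Suc k) d) = (1 - w (p k)) * ?m (path_prefix k p)"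
      unfolding u_def d_def by (rule measure_prefix_Suc[where p=p and k=k, OF w Suc.prems(1)])+
    have "?m (path_prefix k p \<inter> ?Q) = ?m (path_prefix (Suc k) u \<inter> ?Q) +
        ?m (path_prefix (Suc k) d \<inter> ?Q)"
      unfolding u_def d_def by (intro measure_prefix_split w Suc.prems sets)
    also have "?m (path_prefix (Suc k) u \<inter> ?Q) =
        w (p k) * ?m (path_prefix k p) * hit w a n (p k + 1)"
      unfolding eq[of "p k + 1", folded u_def] using Suc.IH[of u "Suc k"] Suc.prems False
      by (simp add: m)
    also have "?m (path_prefix (Suc k) d \<inter> ?Q) =
        (1 - w (p k)) * ?m (path_prefix k p) * hit w a n (p k - 1)"
      unfolding eq[of "p k - 1", folded d_def] using Suc.IH[of d "Suc k"] Suc.prems False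
      by (simp add: m)
    finally show ?thesis using False Suc.prems by (simp add: walk_avg_def algebra_simps)
  qed
qed

lemma measure_quenched_hit:
  assumes "env w" "0 \<le> a"
  shows "measure (quenched_law w) {X. \<exists>i<Suc n. X i = a} = hit w a n 0"
proof -
  interpret q: prob_space "quenched_law w" by (rule prob_space_quenched_law)
  have one: "q.prob (path_prefix 0 (\<lambda>_. 0)) = 1"
    using measure_quenched_law_path[of w "\<lambda>_. 0" 0] assms by (simp add: path_prefix_def env_def)
  have Q: "{X. \<exists>i\<in>{0..n}. X i = a} \<in> sets path_space"
  proof -
    have "{X \<in> space path_space. \<exists>i\<in>{0..n}. X i = a} \<in> sets path_space" by measurable
    then show ?thesis by simp
  qed
  have [measurable]: "path_prefix 0 (\<lambda>_. 0) \<in> q.events" by simp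
  have ev: "{X. \<exists>i<Suc n. X i = a} = {X. \<exists>i\<in>{0..n}. X i = a}"
    by (auto simp: less_Suc_eq_le)
  have "q.prob {X. \<exists>i\<in>{0..n}. X i = a} = q.prob (path_prefix 0 (\<lambda>_. 0) \<inter> {X. \<exists>i\<in>{0..n}. X i = a})"
    by (intro q.finite_measure_eq_AE) (use q.AE_prob_1[OF one] Q in auto)
  then show ?thesis
    unfolding ev using measure_prefix_hit[OF assms(1), of "\<lambda>_. 0" 0 a n] one assms
    by (simp del: Set.bex_simps)
qed

lemma event_above: "{X :: nat \<Rightarrow> int. t < real_of_int (X n)} = {X. \<lfloor>t\<rfloor> < X n}"
  by (auto simp: floor_less_iff)

lemma event_hit: "{X. hitting_time t X < enat n} = {X. \<exists>i<n. X i = \<lfloor>t\<rfloor>}"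
proof -
  have "Inf A < enat n \<longleftrightarrow> (\<exists>x\<in>A. x < enat n)" for A :: "enat set"
    by (rule Inf_less_iff)
  then show ?thesis by (auto simp: hitting_time_def)
qed

subsection \<open>Inequalities and asymptotics\<close>

text \<open>The weighted inequality of arithmetic and geometric means for \<open>r powr k\<close>
  and 1. The strict form is what yields strict inequalities for moments, on both sides of
  \<kappa>.\<close>

lemma powr_le_affine:
  fixes r q k :: real
  assumes r: "0 < r" and q: "0 < q" "q < k"
  shows "r powr q \<le> (q / k) * r powr k + (1 - q / k)"
    and "r \<noteq> 1 \<Longrightarrow> r powr q < (q / k) * r powr k + (1 - q / k)"
proof -
  define t where "t = q / k"
  have t: "0 < t" "t < 1" using q by (auto simp: t_def)
  define x where "x = k * ln r"
  have e: "r powr q = exp (t * x)" "r powr k = exp x"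
    using r q by (auto simp: powr_def t_def x_def)
  have "r powr q < (q / k) * r powr k + (1 - q / k)" if "r \<noteq> 1"
  proof -
    have x: "x \<noteq> 0" using r q that by (simp add: x_def)
    \<comment> \<open>The tangent bound 1 + u < exp u is used at u = (1 - t) * x and at u = - t * x;
      with the weights t and 1 - t the linear terms cancel.\<close>
    have 1: "exp (t * x) * (1 + (1 - t) * x) < exp x"
    proof -
      have "exp (t * x) * (1 + (1 - t) * x) < exp (t * x) * exp ((1 - t) * x)"
        using exp_minus_greater[of "- ((1 - t) * x)"] t x by simp
      also have "\<dots> = exp x" by (simp add: algebra_simps flip: exp_add)
      finally show ?thesis .
    qed
    have 2: "exp (t * x) * (1 - t * x) < 1"
    proof -
      have "exp (t * x) * (1 - t * x) < exp (t * x) * exp (- (t * x))"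
        using exp_minus_greater[of "t * x"] t x by simp
      then show ?thesis by (simp flip: exp_add)
    qed
    have "exp (t * x) = t * (exp (t * x) * (1 + (1 - t) * x)) + (1 - t) * (exp (t * x) * (1 - t * x))"
      by (simp add: algebra_simps)
    also have "\<dots> < t * exp x + (1 - t) * 1"
      using 1 2 t by (intro add_strict_mono mult_strict_left_mono) auto
    finally show ?thesis by (simp add: e t_def)
  qed
  then show "r \<noteq> 1 \<Longrightarrow> r powr q < (q / k) * r powr k + (1 - q / k)" by simp
  then show "r powr q \<le> (q / k) * r powr k + (1 - q / k)" by (cases "r = 1") auto
qed

lemma powr_add_le:
  fixes x y q :: real
  assumes "0 \<le> x" "0 \<le> y" "0 < q" "q \<le> 1"
  shows "(x + y) powr q \<le> x powr q + y powr q"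
proof (cases "x + y = 0")
  case False
  then have s: "0 < x + y" using assms by linarith
  have *: "u / (x + y) \<le> (u / (x + y)) powr q" if "0 \<le> u" "u \<le> x + y" for u
    using powr_mono'[of q 1 "u / (x + y)"] that s assms by auto
  have "1 = x / (x + y) + y / (x + y)" using s by (simp flip: add_divide_distrib)
  also have "\<dots> \<le> (x powr q + y powr q) / (x + y) powr q"
    using *[of x] *[of y] assms s by (simp add: powr_divide add_divide_distrib)
  finally show ?thesis using s by (simp add: field_simps)
next
  case True
  then have "x = 0" "y = 0" using assms by linarith+
  then show ?thesis using assms by simp
qed

text \<open>Extending a configuration on \<open>A\<close> by 0 is measurable, and by
  \<open>dep\<close> the function does not notice the extension. This passes from the full
  environment to the restricted products in which independence is formulated.\<close>

lemma measurable_finite_dep: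
  fixes F :: "(int \<Rightarrow> real) \<Rightarrow> ennreal"
  assumes F: "F \<in> borel_measurable (PiM UNIV (\<lambda>_. borel))"
    and dep: "\<And>e e'. (\<And>i. i \<in> A \<Longrightarrow> e i = e' i) \<Longrightarrow> F e = F e'"
  shows "F \<in> borel_measurable (PiM A (\<lambda>_. borel))"
proof -
  have "(\<lambda>e i. if i \<in> A then e i else 0) \<in> measurable (PiM A (\<lambda>_. borel :: real measure)) (PiM UNIV (\<lambda>_. borel))"
  proof (rule measurable_PiM_single')
    show "(\<lambda>e. if i \<in> A then e i else 0) \<in> borel_measurable (PiM A (\<lambda>_. borel :: real measure))" for i
      by (cases "i \<in> A") auto
  qed (auto simp: PiE_UNIV_domain)
  from measurable_compose[OF this F] show ?thesis
    by (rule measurable_cong[THEN iffD1, rotated]) (rule dep, auto)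
qed

lemma measurable_rho_prod [measurable]:
  "(\<lambda>e. rho_prod e y x) \<in> borel_measurable (PiM UNIV (\<lambda>_. borel))"
proof -
  have [measurable]: "rho \<in> borel_measurable borel" unfolding rho_def[abs_def] by measurable
  show ?thesis unfolding rho_prod_def by measurable
qed

lemma measurable_cross [measurable]:
  "(\<lambda>e. cross e z) \<in> borel_measurable (PiM UNIV (\<lambda>_. borel))"
proof -
  have [measurable]: "rho \<in> borel_measurable borel" unfolding rho_def[abs_def] by measurable
  show ?thesis by (induction z) (simp_all del: of_nat_Suc)
qed

lemma rho_prod_cong: "(\<And>i. i \<in> {y<..x} \<Longrightarrow> e i = e' i) \<Longrightarrow> rho_prod e y x = rho_prod e' y x"
  by (auto simp: rho_prod_def intro!: prod.cong)

lemma cross_cong: "(\<And>i. i \<in> {0..int z} \<Longrightarrow> e i = e' i) \<Longrightarrow> cross e z = cross e' z"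
  by (induction z) auto

lemma powr_sum_le:
  fixes f :: "'b \<Rightarrow> real"
  assumes "\<And>i. i \<in> I \<Longrightarrow> 0 \<le> f i" "0 < q" "q \<le> 1"
  shows "(\<Sum>i\<in>I. f i) powr q \<le> (\<Sum>i\<in>I. f i powr q)"
proof (cases "finite I")
  case True
  then show ?thesis using assms(1)
  proof (induction I)
    case (insert i I)
    have "(f i + sum f I) powr q \<le> f i powr q + sum f I powr q"
      using insert.prems by (intro powr_add_le assms(2,3) sum_nonneg) auto
    also have "\<dots> \<le> f i powr q + (\<Sum>i\<in>I. f i powr q)"
      using insert.IH insert.prems by (intro add_left_mono) simp
    finally show ?case using insert.hyps by simp
  qed simp
qed simp

text \<open>The products start at site \<open>b + 1\<close>, so the event concerns the sites of the
  block from \<open>b + 1\<close> to \<open>b + L\<close> only, and adjacent blocks are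
  disjoint.\<close>

definition climbs :: "int \<Rightarrow> nat \<Rightarrow> real \<Rightarrow> (int \<Rightarrow> real) \<Rightarrow> bool" where
  "climbs b L x e \<longleftrightarrow> (\<exists>j<L. x \<le> rho_prod e b (b + int (Suc j)))"

lemma measurable_climbs [measurable]:
  "Measurable.pred (PiM UNIV (\<lambda>_. borel)) (climbs b L x)"
  unfolding climbs_def[abs_def] by measurable

lemma climbs_cong: "(\<And>i. i \<in> {b<..b + int L} \<Longrightarrow> e i = e' i) \<Longrightarrow> climbs b L x e = climbs b L x e'"
proof -
  assume *: "\<And>i. i \<in> {b<..b + int L} \<Longrightarrow> e i = e' i"
  have "rho_prod e b (b + int (Suc j)) = rho_prod e' b (b + int (Suc j))" if "j < L" for j
    using that by (intro rho_prod_cong *) auto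
  then show ?thesis unfolding climbs_def by (metis (no_types, lifting))
qed

lemma prod_blocks:
  fixes f :: "nat \<Rightarrow> real"
  shows "(\<Prod>k<N. \<Prod>i\<in>{k * L<..k * L + L}. f i) = (\<Prod>i\<in>{0<..N * L}. f i)"
proof (induction N)
  case (Suc N)
  have "{0<..Suc N * L} = {0<..N * L} \<union> {N * L<..N * L + L}" by auto
  moreover have "{0<..N * L} \<inter> {N * L<..N * L + L} = {}" by auto
  ultimately show ?case using Suc by (simp add: prod.union_disjoint)
qed simp

lemma env_reflect: "env w \<Longrightarrow> env (reflect w)"
  by (auto simp: env_def reflect_def)

lemma measurable_hit [measurable]:
  "(\<lambda>w. hit w a n x) \<in> borel_measurable (PiM UNIV (\<lambda>_. borel))"
proof (induction n arbitrary: x)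
  case (Suc n)
  then show ?case by (cases "a \<le> x") (simp_all add: walk_avg_def)
qed simp

lemma measurable_above [measurable]:
  "(\<lambda>w. above_at w a n x) \<in> borel_measurable (PiM UNIV (\<lambda>_. borel))"
  by (induction n arbitrary: x) (auto simp: walk_avg_def)

lemma measurable_reflect [measurable]:
  "reflect \<in> measurable (PiM UNIV (\<lambda>_. borel)) (PiM UNIV (\<lambda>_. borel))"
proof (rule measurable_PiM_single')
  show "(\<lambda>w. reflect w i) \<in> borel_measurable (PiM UNIV (\<lambda>_. borel))" for i
    by (cases "i = 0") (simp_all add: reflect_def)
qed (auto simp: PiE_UNIV_domain)

section \<open>Asymptotic comparisons\<close>

lemma eventually_powr_le:
  fixes p q c :: real
  assumes "p < q" "0 < c"
  shows "eventually (\<lambda>n. real n powr p \<le> c * real n powr q) sequentially"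
  using assms by real_asymp

text \<open>A lower bound for a number of blocks of length about \<open>n powr d\<close>; the
  constants 2, 1 and 1 allow for the rounding of the target, of the block length and of their
  quotient.\<close>

lemma eventually_ratio_ge:
  fixes \<nu> d :: real
  assumes "0 < d" "d < \<nu>"
  shows "eventually (\<lambda>n. real n powr (\<nu> - d) / 4 \<le> (real n powr \<nu> - 2) / (real n powr d + 1) - 1) sequentially"
  using assms by real_asymp

lemma eventually_exp_small:
  fixes d c C :: real
  assumes "0 < d" "0 < c"
  shows "eventually (\<lambda>n. exp (C * ln (real n) - c * real n powr d) \<le> 1 / 2) sequentially"
  using assms by real_asymp

lemma eventually_exp_sq:
  fixes g h :: real
  assumes "g < h" "0 < h"
  shows "eventually (\<lambda>n. exp (real n powr g - real n powr h) \<le> 1 / real n ^ 2) sequentially"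
  using assms by real_asymp

lemma eventually_half_exp:
  fixes g h :: real
  assumes "0 < g" "g < h"
  shows "eventually (\<lambda>n. exp (- (real n powr h)) \<le> exp (- (real n powr g)) / 2) sequentially"
proof -
  have "eventually (\<lambda>n. ln 2 + real n powr g \<le> real n powr h) sequentially"
    using assms by real_asymp
  then show ?thesis
  proof eventually_elim
    case (elim n)
    then have "exp (- (real n powr h)) \<le> exp (- (real n powr g) - ln 2)" by simp
    then show ?case by (simp only: exp_diff exp_ln zero_less_numeral)
  qed
qed

lemma eventually_quarter_exp:
  fixes g :: real
  assumes "0 < g"
  shows "eventually (\<lambda>n. exp (- (real n powr g)) \<le> exp (- (real n powr g / 2)) / 4) sequentially"
  using assms by real_asymp

lemma filterlim_power_2: "filterlim (\<lambda>k. (2::real) ^ k) at_top sequentially"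
  by real_asymp

lemma eventually_dyadic_m:
  fixes \<nu> :: real
  assumes "0 < \<nu>"
  shows "eventually (\<lambda>k. (2 * 2 ^ k) powr \<nu> + real k + 1 \<le> 2 * (2 * 2 ^ k) powr \<nu>) sequentially"
proof -
  have "eventually (\<lambda>k. real k + 1 \<le> exp (real k * (ln 2 * \<nu>))) sequentially"
    using assms by real_asymp
  then show ?thesis
  proof eventually_elim
    case (elim k)
    have "exp (real k * (ln 2 * \<nu>)) = (2 ^ k) powr \<nu>"
      by (simp add: powr_def ln_realpow mult_ac)
    also have "\<dots> \<le> (2 * 2 ^ k) powr \<nu>" using assms by (intro powr_mono2) auto
    finally show ?case using elim by simp
  qed
qed

lemma eventually_dyadic_cost:
  fixes u v c d :: real
  assumes "u < v" "0 < v"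
  shows "eventually (\<lambda>k::nat. ln (2 * 2 ^ k) + c + (ln (2 * 2 ^ k) + d) * (4 * (2 ^ k) powr u) \<le> (2 ^ k) powr v / 2) sequentially"
proof -
  have 1: "eventually (\<lambda>x. ln (2 * x) + c \<le> x powr v / 4) at_top"
    using assms by real_asymp
  have 2: "eventually (\<lambda>x. (ln (2 * x) + d) * 4 \<le> x powr (v - u) / 4) at_top"
    using assms by real_asymp
  have "eventually (\<lambda>x. ln (2 * x) + c + (ln (2 * x) + d) * (4 * x powr u) \<le> x powr v / 2) at_top"
    using 1 2 eventually_gt_at_top[of 0]
  proof eventually_elim
    case (elim x)
    have "(ln (2 * x) + d) * 4 * x powr u \<le> x powr (v - u) / 4 * x powr u"
      using elim by (intro mult_right_mono) auto
    also have "\<dots> = x powr v / 4" by (simp flip: powr_add)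
    finally have "(ln (2 * x) + d) * (4 * x powr u) \<le> x powr v / 4"
      by (simp only: mult.assoc)
    then show ?case using elim(1) by linarith
  qed
  from filterlim_iff[THEN iffD1, OF filterlim_power_2, rule_format, OF this] show ?thesis .
qed

lemma eventually_dyadic_time:
  fixes u :: real
  assumes "u < 1"
  shows "eventually (\<lambda>k::nat. 4 * (2 ^ k) powr u \<le> (2::real) ^ k / 2) sequentially"
proof -
  have "eventually (\<lambda>x. 4 * x powr u \<le> x / 2) at_top"
    using assms by real_asymp
  from filterlim_iff[THEN iffD1, OF filterlim_power_2, rule_format, OF this] show ?thesis .
qed

text \<open>The exponents run through two sequences converging to \<beta>, so that almost sure
  bounds need only countably many null sets. The lower sequence stays positive, which the upper
  bound on probabilities requires.\<close>

lemma filterlim_ln_ln: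
  fixes \<beta> :: real and lo p up :: "nat \<Rightarrow> real"
  assumes "0 < \<beta>"
    and lo: "\<And>j::nat. eventually (\<lambda>n. exp (- (real n powr (\<beta> + 1 / (real j + 1)))) \<le> lo n) sequentially"
    and up: "\<And>j::nat. eventually (\<lambda>n. up n \<le> exp (- (real n powr (\<beta> - \<beta> / (real j + 2))))) sequentially"
    and p: "eventually (\<lambda>n. lo n \<le> p n \<and> p n \<le> up n) sequentially"
  shows "(\<lambda>n. ln (- ln (p n)) / ln (real n)) \<longlonglongrightarrow> \<beta>"
proof -
  have bounds: "eventually (\<lambda>n. \<beta> - \<beta> / (real j + 2) \<le> ln (- ln (p n)) / ln (real n) \<and>
      ln (- ln (p n)) / ln (real n) \<le> \<beta> + 1 / (real j + 1)) sequentially" for j :: nat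
    using lo[of j] up[of j] p eventually_ge_at_top[of 2]
  proof eventually_elim
    case (elim n)
    let ?l = "- ln (p n)"
    \<comment> \<open>Positivity comes from the lower bound; without it \<open>ln (p n)\<close>
      would not be a genuine logarithm.\<close>
    have p0: "0 < p n"
      using elim(1,3) exp_gt_zero[of "- (real n powr (\<beta> + 1 / (real j + 1)))"] by linarith
    have n: "0 < ln (real n)" using elim(4) by simp
    have "ln (p n) \<le> - (real n powr (\<beta> - \<beta> / (real j + 2)))"
      using elim(2,3) ln_mono[OF _ p0, of "exp (- (real n powr (\<beta> - \<beta> / (real j + 2))))"] by simp
    then have 1: "real n powr (\<beta> - \<beta> / (real j + 2)) \<le> ?l" by simp
    have "- (real n powr (\<beta> + 1 / (real j + 1))) \<le> ln (p n)"
      using elim(1,3) ln_mono[OF _ exp_gt_zero, of "- (real n powr (\<beta> + 1 / (real j + 1)))" "p n"] by simp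
    then have 2: "?l \<le> real n powr (\<beta> + 1 / (real j + 1))" by simp
    have pow: "0 < real n powr e" for e using elim(4) by simp
    have l0: "0 < ?l" by (rule less_le_trans[OF pow 1])
    have "(\<beta> - \<beta> / (real j + 2)) * ln (real n) \<le> ln ?l"
      using ln_mono[OF 1 pow] elim(4) by (simp add: ln_powr)
    moreover have "ln ?l \<le> (\<beta> + 1 / (real j + 1)) * ln (real n)"
      using ln_mono[OF 2 l0] elim(4) by (simp add: ln_powr)
    ultimately show ?case using n by (simp only: pos_le_divide_eq pos_divide_le_eq)
  qed
  have l1: "(\<lambda>j. \<beta> - \<beta> / (real j + 2)) \<longlonglongrightarrow> \<beta>" and l2: "(\<lambda>j. \<beta> + 1 / (real j + 1)) \<longlonglongrightarrow> \<beta>"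
    by real_asymp+
  show ?thesis
  proof (rule order_tendstoI)
    fix a assume "a < \<beta>"
    then obtain j :: nat where j: "a < \<beta> - \<beta> / (real j + 2)"
      using order_tendstoD(1)[OF l1] by (auto simp: eventually_sequentially)
    show "eventually (\<lambda>n. a < ln (- ln (p n)) / ln (real n)) sequentially"
      by (rule eventually_mono[OF bounds[of j]]) (use j in linarith)
  next
    fix a assume "\<beta> < a"
    then obtain j :: nat where j: "\<beta> + 1 / (real j + 1) < a"
      using order_tendstoD(2)[OF l2] by (auto simp: eventually_sequentially)
    show "eventually (\<lambda>n. ln (- ln (p n)) / ln (real n) < a) sequentially"
      by (rule eventually_mono[OF bounds[of j]]) (use j in linarith)
  qed
qed

text \<open>The Borel-Cantelli argument in terms of means: the sum of the variables has finite
  expectation, so it converges almost surely and its terms tend to 0.\<close>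

lemma (in prob_space) AE_eventually_le:
  fixes Z :: "nat \<Rightarrow> 'a \<Rightarrow> real"
  assumes [measurable]: "\<And>k. Z k \<in> borel_measurable M" and Z: "\<And>k s. s \<in> space M \<Longrightarrow> 0 \<le> Z k s"
    and c: "summable c" "\<And>k. 0 \<le> c k"
    and le: "eventually (\<lambda>k. (\<integral>\<^sup>+s. ennreal (Z k s) \<partial>M) \<le> ennreal (c k)) sequentially"
    and b: "0 < b"
  shows "AE s in M. eventually (\<lambda>k. Z k s \<le> b) sequentially"
proof -
  obtain k0 where k0: "\<And>k. k0 \<le> k \<Longrightarrow> (\<integral>\<^sup>+s. ennreal (Z k s) \<partial>M) \<le> ennreal (c k)"
    using le by (auto simp: eventually_sequentially)
  \<comment> \<open>The finitely many terms for which no bound on the mean is available are set to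
    0.\<close>
  define Y where "Y k s = (if k0 \<le> k then Z k s else 0)" for k s
  have [measurable]: "Y k \<in> borel_measurable M" for k unfolding Y_def by (cases "k0 \<le> k") auto
  have "(\<integral>\<^sup>+s. (\<Sum>k. ennreal (Y k s)) \<partial>M) = (\<Sum>k. \<integral>\<^sup>+s. ennreal (Y k s) \<partial>M)"
    by (rule nn_integral_suminf) measurable
  also have "\<dots> \<le> (\<Sum>k. ennreal (c k))"
  proof (rule suminf_le)
    show "(\<integral>\<^sup>+s. ennreal (Y k s) \<partial>M) \<le> ennreal (c k)" for k
      using k0[of k] by (cases "k0 \<le> k") (auto simp: Y_def)
  qed auto
  also have "\<dots> = ennreal (suminf c)"
    using c by (intro suminf_ennreal2) auto
  finally have "(\<integral>\<^sup>+s. (\<Sum>k. ennreal (Y k s)) \<partial>M) \<noteq> \<infinity>"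
    by (auto simp: top_unique)
  then have "AE s in M. (\<Sum>k. ennreal (Y k s)) \<noteq> \<infinity>"
    by (intro nn_integral_PInf_AE) auto
  with AE_space show ?thesis
  proof eventually_elim
    case (elim s)
    have "summable (\<lambda>k. Y k s)"
      using elim Z by (intro summable_suminf_not_top) (auto simp: Y_def)
    then have "(\<lambda>k. Y k s) \<longlonglongrightarrow> 0" by (rule summable_LIMSEQ_zero)
    then have "eventually (\<lambda>k. Y k s < b) sequentially" using b by (rule order_tendstoD)
    then show ?case using eventually_ge_at_top[of k0]
      by eventually_elim (auto simp: Y_def)
  qed
qed

lemma powr_pow2: "((2::real) ^ k) powr e = 2 powr (real k * e)"
  by (simp add: powr_powr flip: powr_realpow)

lemma summable_decay_powr:
  fixes e :: real
  assumes "0 < e"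
  shows "summable (\<lambda>k. C * (2 ^ k) powr (- e))"
proof -
  have "norm (2 powr (- e) :: real) < 1" using assms by (simp add: powr_less_one)
  then have "summable (\<lambda>k. (2 powr (- e) :: real) ^ k)" by (rule summable_geometric)
  moreover have "(2 powr (- e) :: real) ^ k = (2 ^ k) powr (- e)" for k
    by (simp add: powr_pow2 powr_powr mult.commute flip: powr_realpow)
  ultimately show ?thesis by (intro summable_mult) simp
qed

subsection \<open>The random environment\<close>

locale iid_environment = prob_space M for M :: "'a measure" +
  fixes \<omega> :: "int \<Rightarrow> 'a \<Rightarrow> real" and \<kappa> :: real
  assumes indep: "indep_vars (\<lambda>_. borel) \<omega> UNIV"
    and ident: "distr M borel (\<omega> i) = distr M borel (\<omega> 0)"
    and range: "s \<in> space M \<Longrightarrow> \<omega> i s \<in> {0<..<1}"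
    and drift: "(\<integral>s. ln (rho (\<omega> 0 s)) \<partial>M) < 0"
    and kappa_pos: "\<kappa> > 0"
    and kappa_moment: "(\<integral>s. rho (\<omega> 0 s) powr \<kappa> \<partial>M) = 1"
begin

abbreviation W :: "'a \<Rightarrow> int \<Rightarrow> real" where "W s \<equiv> \<lambda>i. \<omega> i s"

lemma measurable_omega [measurable]: "\<omega> i \<in> borel_measurable M"
  using indep by (auto simp: indep_vars_def)

lemma measurable_W [measurable]: "W \<in> measurable M (PiM UNIV (\<lambda>_. borel))"
  by (rule measurable_PiM_single') (simp_all add: PiE_UNIV_domain)

lemma measurable_rho [measurable]: "rho \<in> borel_measurable borel"
  unfolding rho_def[abs_def] by measurable

lemma rho_pos: "s \<in> space M \<Longrightarrow> 0 < rho (\<omega> i s)"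
  using range[of s i] by (simp add: rho_def)

lemma env_W: "s \<in> space M \<Longrightarrow> env (W s)"
  using range by (auto simp: env_def less_imp_le)

lemma nn_integral_ident:
  assumes [measurable]: "f \<in> borel_measurable borel"
  shows "(\<integral>\<^sup>+s. f (\<omega> i s) \<partial>M) = (\<integral>\<^sup>+s. f (\<omega> 0 s) \<partial>M)"
proof -
  have "(\<integral>\<^sup>+s. f (\<omega> i s) \<partial>M) = (\<integral>\<^sup>+x. f x \<partial>distr M borel (\<omega> i))"
    by (subst nn_integral_distr) auto
  also have "\<dots> = (\<integral>\<^sup>+s. f (\<omega> 0 s) \<partial>M)"
    unfolding ident[of i] by (subst nn_integral_distr) auto
  finally show ?thesis .
qed

text \<open>The functions live on the whole environment and only their dependence on disjoint sets
  of sites is assumed, which suits recursively defined quantities. Nonnegative integrals avoid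
  integrability conditions.\<close>

lemma nn_integral_indep_mult:
  assumes F: "F \<in> borel_measurable (PiM UNIV (\<lambda>_. borel))"
    and G: "G \<in> borel_measurable (PiM UNIV (\<lambda>_. borel))"
    and "A \<inter> B = {}"
    and depF: "\<And>e e'. (\<And>i. i \<in> A \<Longrightarrow> e i = e' i) \<Longrightarrow> F e = F e'"
    and depG: "\<And>e e'. (\<And>i. i \<in> B \<Longrightarrow> e i = e' i) \<Longrightarrow> G e = G e'"
  shows "(\<integral>\<^sup>+s. F (W s) * G (W s) \<partial>M) = (\<integral>\<^sup>+s. F (W s) \<partial>M) * (\<integral>\<^sup>+s. G (W s) \<partial>M)"
proof -
  have [measurable]: "F \<in> borel_measurable (PiM A (\<lambda>_. borel))"
    "G \<in> borel_measurable (PiM B (\<lambda>_. borel))"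
    by (rule measurable_finite_dep[OF F depF], assumption) (rule measurable_finite_dep[OF G depG], assumption)
  let ?RA = "\<lambda>s. \<lambda>i\<in>A. \<omega> i s" and ?RB = "\<lambda>s. \<lambda>i\<in>B. \<omega> i s"
  have ind: "indep_var (PiM A (\<lambda>_. borel)) ?RA (PiM B (\<lambda>_. borel)) ?RB"
    by (intro indep_var_restrict[OF indep]) (use assms in auto)
  note [measurable] = indep_var_rv1[OF ind] indep_var_rv2[OF ind]
  interpret PA: prob_space "distr M (PiM A (\<lambda>_. borel)) ?RA" by (rule prob_space_distr) simp
  interpret PB: prob_space "distr M (PiM B (\<lambda>_. borel)) ?RB" by (rule prob_space_distr) simp
  interpret AB: pair_sigma_finite "distr M (PiM A (\<lambda>_. borel)) ?RA" "distr M (PiM B (\<lambda>_. borel)) ?RB" ..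
  have FG: "F (?RA s) = F (W s)" "G (?RB s) = G (W s)" for s
    by (auto intro!: depF depG)
  have "(\<integral>\<^sup>+s. F (W s) * G (W s) \<partial>M) =
      (\<integral>\<^sup>+x. F (fst x) * G (snd x) \<partial>distr M (PiM A (\<lambda>_. borel) \<Otimes>\<^sub>M PiM B (\<lambda>_. borel)) (\<lambda>s. (?RA s, ?RB s)))"
    by (subst nn_integral_distr) (auto simp: FG)
  also have "\<dots> = (\<integral>\<^sup>+x. F (fst x) * G (snd x)
      \<partial>(distr M (PiM A (\<lambda>_. borel)) ?RA \<Otimes>\<^sub>M distr M (PiM B (\<lambda>_. borel)) ?RB))"
    using ind unfolding indep_var_distribution_eq by simp
  also have "\<dots> = (\<integral>\<^sup>+x. \<integral>\<^sup>+y. F x * G y \<partial>distr M (PiM B (\<lambda>_. borel)) ?RB \<partial>distr M (PiM A (\<lambda>_. borel)) ?RA)"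
    by (subst PB.nn_integral_fst[symmetric]) auto
  also have "\<dots> = (\<integral>\<^sup>+x. F x \<partial>distr M (PiM A (\<lambda>_. borel)) ?RA) * (\<integral>\<^sup>+y. G y \<partial>distr M (PiM B (\<lambda>_. borel)) ?RB)"
    by (simp add: nn_integral_cmult nn_integral_multc)
  also have "\<dots> = (\<integral>\<^sup>+s. F (W s) \<partial>M) * (\<integral>\<^sup>+s. G (W s) \<partial>M)"
    by (simp add: nn_integral_distr FG)
  finally show ?thesis .
qed

section \<open>Moments of the odds ratio on both sides of \<kappa>\<close>

text \<open>Nondegeneracy of the environment, which excludes equality in the two applications of
  \<open>powr_le_affine\<close>.\<close>

lemma rho_not_AE_1: "\<not> (AE s in M. rho (\<omega> 0 s) = 1)"
proof
  assume "AE s in M. rho (\<omega> 0 s) = 1"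
  then have "(\<integral>s. ln (rho (\<omega> 0 s)) \<partial>M) = (\<integral>s. 0 \<partial>M)"
    by (intro integral_cong_AE) auto
  then show False using drift by simp
qed

text \<open>A non-integrable function has Bochner integral 0, so the value 1 certifies
  integrability.\<close>

lemma integrable_kappa: "integrable M (\<lambda>s. rho (\<omega> 0 s) powr \<kappa>)"
  using kappa_moment not_integrable_integral_eq by fastforce

text \<open>The affine majorant \<open>?g\<close> of the power has mean 1. Equal means would force
  equality almost everywhere, and the strict inequality allows that only for an odds ratio almost
  surely equal to 1.\<close>

lemma moment_less_1:
  assumes q: "0 < q" "q < \<kappa>"
  shows "integrable M (\<lambda>s. rho (\<omega> 0 s) powr q)" "(\<integral>s. rho (\<omega> 0 s) powr q \<partial>M) < 1"
proof -
  let ?g = "\<lambda>s. (q / \<kappa>) * rho (\<omega> 0 s) powr \<kappa> + (1 - q / \<kappa>)"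
  have g: "integrable M ?g" "(\<integral>s. ?g s \<partial>M) = 1"
    using integrable_kappa kappa_moment by (auto simp: prob_space)
  have le: "rho (\<omega> 0 s) powr q \<le> ?g s" if "s \<in> space M" for s
    by (rule powr_le_affine(1)) (use rho_pos[OF that] q in auto)
  show int: "integrable M (\<lambda>s. rho (\<omega> 0 s) powr q)"
  proof (rule Bochner_Integration.integrable_bound[OF g(1)])
    show "AE s in M. norm (rho (\<omega> 0 s) powr q) \<le> norm (?g s)"
    proof (rule AE_I2)
      fix s assume "s \<in> space M"
      from le[OF this] show "norm (rho (\<omega> 0 s) powr q) \<le> norm (?g s)"
        by (smt (verit) powr_ge_zero real_norm_def)
    qed
  qed measurable
  have "(\<integral>s. rho (\<omega> 0 s) powr q \<partial>M) \<le> (\<integral>s. ?g s \<partial>M)"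
    by (intro integral_mono int g le)
  moreover have "(\<integral>s. rho (\<omega> 0 s) powr q \<partial>M) \<noteq> (\<integral>s. ?g s \<partial>M)"
  proof
    assume eq: "(\<integral>s. rho (\<omega> 0 s) powr q \<partial>M) = (\<integral>s. ?g s \<partial>M)"
    have d: "integrable M (\<lambda>s. ?g s - rho (\<omega> 0 s) powr q)"
      by (rule Bochner_Integration.integrable_diff[OF g(1) int])
    have "(\<integral>s. ?g s - rho (\<omega> 0 s) powr q \<partial>M) = 0"
      using eq by (subst Bochner_Integration.integral_diff[OF g(1) int]) simp
    then have "AE s in M. ?g s - rho (\<omega> 0 s) powr q = 0"
      using le by (subst (asm) integral_nonneg_eq_0_iff_AE[OF d]) auto
    with AE_space have "AE s in M. rho (\<omega> 0 s) = 1"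
    proof eventually_elim
      case (elim s)
      then show ?case
        using powr_le_affine(2)[OF rho_pos[of s 0] q] by force
    qed
    then show False using rho_not_AE_1 by blast
  qed
  ultimately show "(\<integral>s. rho (\<omega> 0 s) powr q \<partial>M) < 1" using g by simp
qed

definition moment :: "real \<Rightarrow> real" where
  "moment q = (\<integral>s. rho (\<omega> 0 s) powr q \<partial>M)"

lemma moment_bounds: "0 < q \<Longrightarrow> q < \<kappa> \<Longrightarrow> 0 \<le> moment q \<and> moment q < 1"
  unfolding moment_def using moment_less_1(2) by auto

lemma nn_integral_rho_powr:
  assumes "0 < q" "q < \<kappa>"
  shows "(\<integral>\<^sup>+s. ennreal (rho (\<omega> i s) powr q) \<partial>M) = ennreal (moment q)"
proof -
  have "(\<integral>\<^sup>+s. ennreal (rho (\<omega> i s) powr q) \<partial>M) = (\<integral>\<^sup>+s. ennreal (rho (\<omega> 0 s) powr q) \<partial>M)"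
    by (rule nn_integral_ident[of "\<lambda>x. ennreal (rho x powr q)"]) measurable
  then show ?thesis
    unfolding moment_def using moment_less_1(1)[OF assms] by (simp add: nn_integral_eq_integral)
qed

text \<open>In the recursion for \<open>cross\<close> the new odds ratio is independent of the
  previous value, and powers of order at most 1 are subadditive. So the moments obey a linear
  recursion with the contracting factor \<open>moment q\<close>.\<close>

lemma nn_integral_cross:
  assumes q: "0 < q" "q < \<kappa>" "q \<le> 1"
  shows "(\<integral>\<^sup>+s. ennreal (cross (W s) z powr q) \<partial>M) \<le> ennreal (2 / (1 - moment q))"
proof -
  let ?\<eta> = "moment q"
  define C where "C = 2 / (1 - moment q)"
  have \<eta>: "0 \<le> ?\<eta>" "?\<eta> < 1" using moment_bounds[OF q(1,2)] by auto
  \<comment> \<open>The bound \<open>C\<close> has to be preserved by c \<mapsto> 1 + \<eta> +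
    \<eta> * c. The fixed point is (1 + \<eta>) / (1 - \<eta>), and 2 / (1 - \<eta>) lies above
    it.\<close>
  have bC: "1 + ?\<eta> + ?\<eta> * C = C - (1 - ?\<eta>)" "0 \<le> C" "2 \<le> C"
    using \<eta> by (auto simp: field_simps C_def)
  show ?thesis unfolding C_def[symmetric]
  proof (induction z)
    case 0
    have "(\<integral>\<^sup>+s. ennreal (cross (W s) 0 powr q) \<partial>M) \<le> (\<integral>\<^sup>+s. 1 + ennreal (rho (\<omega> 0 s) powr q) \<partial>M)"
    proof (rule nn_integral_mono)
      fix s assume "s \<in> space M"
      then show "ennreal (cross (W s) 0 powr q) \<le> 1 + ennreal (rho (\<omega> 0 s) powr q)"
        using powr_add_le[of 1 "rho (\<omega> 0 s)" q] rho_pos[of s 0] q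
        by (simp add: ennreal_leI flip: ennreal_1 ennreal_plus)
    qed
    also have "\<dots> = 1 + ennreal ?\<eta>"
      using nn_integral_rho_powr[OF q(1,2), of 0] by (subst nn_integral_add) (auto simp: emeasure_space_1)
    also have "\<dots> \<le> ennreal C"
      using bC(3) \<eta> by (simp add: ennreal_leI flip: ennreal_1 ennreal_plus)
    finally show ?case .
  next
    case (Suc z)
    let ?r = "\<lambda>s. ennreal (rho (\<omega> (int (Suc z)) s) powr q)"
    have "(\<integral>\<^sup>+s. ennreal (cross (W s) (Suc z) powr q) \<partial>M) \<le>
        (\<integral>\<^sup>+s. 1 + ?r s + ?r s * ennreal (cross (W s) z powr q) \<partial>M)"
    proof (rule nn_integral_mono)
      fix s assume s: "s \<in> space M"
      let ?\<rho> = "rho (\<omega> (int (Suc z)) s)" and ?c = "cross (W s) z"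
      have \<rho>: "0 < ?\<rho>" and c: "1 \<le> ?c" using rho_pos[OF s] cross_ge_1[OF env_W[OF s]] by auto
      have "(1 + (?\<rho> + ?\<rho> * ?c)) powr q \<le> 1 powr q + (?\<rho> + ?\<rho> * ?c) powr q"
        using \<rho> c q by (intro powr_add_le) auto
      also have "(?\<rho> + ?\<rho> * ?c) powr q \<le> ?\<rho> powr q + (?\<rho> * ?c) powr q"
        using \<rho> c q by (intro powr_add_le) auto
      also have "(?\<rho> * ?c) powr q = ?\<rho> powr q * ?c powr q"
        using \<rho> c by (simp add: powr_mult)
      finally have "(1 + (?\<rho> + ?\<rho> * ?c)) powr q \<le> 1 + ?\<rho> powr q + ?\<rho> powr q * ?c powr q" by simp
      then have "ennreal (cross (W s) (Suc z) powr q) \<le> ennreal (1 + ?\<rho> powr q + ?\<rho> powr q * ?c powr q)"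
        by (intro ennreal_leI) (simp add: distrib_left)
      also have "\<dots> = 1 + ?r s + ?r s * ennreal (?c powr q)"
        by (simp add: ennreal_plus ennreal_mult del: of_nat_Suc)
      finally show "ennreal (cross (W s) (Suc z) powr q) \<le> 1 + ?r s + ?r s * ennreal (?c powr q)" .
    qed
    also have "\<dots> = 1 + ennreal ?\<eta> + (\<integral>\<^sup>+s. ?r s * ennreal (cross (W s) z powr q) \<partial>M)"
      using nn_integral_rho_powr[OF q(1,2), of "int (Suc z)"]
      by (simp add: nn_integral_add emeasure_space_1 del: of_nat_Suc)
    also have "(\<integral>\<^sup>+s. ?r s * ennreal (cross (W s) z powr q) \<partial>M) =
        (\<integral>\<^sup>+s. ?r s \<partial>M) * (\<integral>\<^sup>+s. ennreal (cross (W s) z powr q) \<partial>M)"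
      by (rule nn_integral_indep_mult[of "\<lambda>e. ennreal (rho (e (int (Suc z))) powr q)"
            "\<lambda>e. ennreal (cross e z powr q)" "{int (Suc z)}" "{0..int z}"])
         (auto simp del: of_nat_Suc intro!: arg_cong2[where f="(powr)"] cross_cong)
    also have "\<dots> \<le> ennreal ?\<eta> * ennreal C"
      unfolding nn_integral_rho_powr[OF q(1,2)] by (intro mult_left_mono Suc) auto
    also have "1 + ennreal ?\<eta> + \<dots> = ennreal (1 + ?\<eta> + ?\<eta> * C)"
      using \<eta> bC(2) by (simp add: ennreal_plus ennreal_mult)
    also have "\<dots> \<le> ennreal C" unfolding bC using \<eta> by (intro ennreal_leI) simp
    finally show ?case by (simp add: add_left_mono del: cross.simps of_nat_Suc)
  qed
qed

lemma nn_integral_rho_prod: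
  assumes q: "0 < q" "q < \<kappa>"
  shows "(\<integral>\<^sup>+s. ennreal (rho_prod (W s) y (y + int j) powr q) \<partial>M) = ennreal (moment q ^ j)"
proof (induction j)
  case 0
  then show ?case by (simp add: rho_prod_def emeasure_space_1)
next
  case (Suc j)
  let ?x = "y + int (Suc j)"
  have "(\<integral>\<^sup>+s. ennreal (rho_prod (W s) y ?x powr q) \<partial>M) =
      (\<integral>\<^sup>+s. ennreal (rho_prod (W s) y (y + int j) powr q) * ennreal (rho (\<omega> ?x s) powr q) \<partial>M)"
  proof (rule nn_integral_cong)
    fix s assume s: "s \<in> space M"
    have "rho_prod (W s) y ?x = rho_prod (W s) y (y + int j) * rho (\<omega> ?x s)"
      by (subst rho_prod_step) auto
    then show "ennreal (rho_prod (W s) y ?x powr q) =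
        ennreal (rho_prod (W s) y (y + int j) powr q) * ennreal (rho (\<omega> ?x s) powr q)"
      using rho_pos[OF s, of ?x] rho_prod_nonneg[OF env_W[OF s]]
      by (simp add: powr_mult ennreal_mult)
  qed
  also have "\<dots> = (\<integral>\<^sup>+s. ennreal (rho_prod (W s) y (y + int j) powr q) \<partial>M) * (\<integral>\<^sup>+s. ennreal (rho (\<omega> ?x s) powr q) \<partial>M)"
    by (rule nn_integral_indep_mult[of "\<lambda>e. ennreal (rho_prod e y (y + int j) powr q)"
          "\<lambda>e. ennreal (rho (e ?x) powr q)" "{y<..y + int j}" "{?x}"])
       (auto simp del: of_nat_Suc intro!: arg_cong2[where f="(powr)"] rho_prod_cong)
  also have "\<dots> = ennreal (moment q ^ Suc j)"
    using moment_bounds[OF q] unfolding Suc nn_integral_rho_powr[OF q] by (simp add: ennreal_mult mult.commute)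
  finally show ?case .
qed

text \<open>Subadditivity reduces the claim to a geometric series. Because the sum begins
  \<open>k\<close> sites beyond \<open>y\<close>, the bound is exponentially small in
  \<open>k\<close>; this is the gain from overshooting the target.\<close>

lemma nn_integral_scale:
  assumes q: "0 < q" "q < \<kappa>" "q \<le> 1"
  shows "(\<integral>\<^sup>+s. ennreal ((\<Sum>x\<in>{y + int k..y + int k + int l}. rho_prod (W s) y x) powr q) \<partial>M)
    \<le> ennreal (moment q ^ k / (1 - moment q))"
proof -
  let ?\<eta> = "moment q"
  have \<eta>: "0 \<le> ?\<eta>" "?\<eta> < 1" using moment_bounds[OF q(1,2)] by auto
  have "{y + int k..y + int k + int l} = (\<lambda>j. y + int j) ` {k..k + l}"
  proof (intro equalityI subsetI)
    fix x assume "x \<in> {y + int k..y + int k + int l}"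
    then have "x = y + int (nat (x - y))" "nat (x - y) \<in> {k..k + l}" by auto
    then show "x \<in> (\<lambda>j. y + int j) ` {k..k + l}" by blast
  qed auto
  then have eq: "(\<Sum>x\<in>{y + int k..y + int k + int l}. f x) = (\<Sum>j\<in>{k..k + l}. f (y + int j))" for f :: "int \<Rightarrow> real"
    by (simp add: sum.reindex inj_on_def)
  have "(\<integral>\<^sup>+s. ennreal ((\<Sum>x\<in>{y + int k..y + int k + int l}. rho_prod (W s) y x) powr q) \<partial>M) \<le>
      (\<integral>\<^sup>+s. (\<Sum>j\<in>{k..k + l}. ennreal (rho_prod (W s) y (y + int j) powr q)) \<partial>M)"
    unfolding eq by (intro nn_integral_mono, subst sum_ennreal)
      (auto intro!: ennreal_leI powr_sum_le rho_prod_nonneg env_W q)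
  also have "\<dots> = (\<Sum>j\<in>{k..k + l}. ennreal (?\<eta> ^ j))"
    by (subst nn_integral_sum) (auto simp: nn_integral_rho_prod[OF q(1,2)])
  also have "\<dots> = ennreal (\<Sum>j\<in>{k..k + l}. ?\<eta> ^ j)"
    using \<eta> by simp
  also have "\<dots> \<le> ennreal (?\<eta> ^ k / (1 - ?\<eta>))"
  proof (rule ennreal_leI)
    have "(\<Sum>j\<in>{k..k + l}. ?\<eta> ^ j) = ?\<eta> ^ k * (\<Sum>j<Suc l. ?\<eta> ^ j)"
    proof -
      have "(\<Sum>j\<in>{k..k + l}. ?\<eta> ^ j) = (\<Sum>j\<in>{0..l}. ?\<eta> ^ (j + k))"
        using sum.shift_bounds_cl_nat_ivl[of "\<lambda>j. ?\<eta> ^ j" 0 k l] by (simp add: add.commute)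
      then show ?thesis
        by (simp add: power_add sum_distrib_left mult.commute atLeast0AtMost lessThan_Suc_atMost)
    qed
    also have "\<dots> \<le> ?\<eta> ^ k * (1 / (1 - ?\<eta>))"
    proof (intro mult_left_mono)
      have "(\<Sum>j<Suc l. ?\<eta> ^ j) = (1 - ?\<eta> ^ Suc l) / (1 - ?\<eta>)"
        using \<eta> by (subst sum_gp_strict) auto
      also have "\<dots> \<le> 1 / (1 - ?\<eta>)"
        using \<eta> by (intro divide_right_mono) auto
      finally show "(\<Sum>j<Suc l. ?\<eta> ^ j) \<le> 1 / (1 - ?\<eta>)" .
    qed (use \<eta> in auto)
    finally show "(\<Sum>j\<in>{k..k + l}. ?\<eta> ^ j) \<le> ?\<eta> ^ k / (1 - ?\<eta>)" by simp
  qed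
  finally show ?thesis .
qed

section \<open>The probability of a large partial product\<close>

text \<open>The moment of order \<theta> > \<kappa> exceeds 1, possibly being infinite, and by
  monotone convergence so does the part below a large \<open>K\<close>. Truncation makes it finite
  and later bounds the overshoot of a product over its level.\<close>

lemma truncated_moment_gt_1:
  assumes "\<kappa> < \<theta>"
  obtains K mm where "1 \<le> K" "1 < mm"
    "\<And>i. (\<integral>\<^sup>+s. ennreal (of_bool (rho (\<omega> i s) \<le> K) * rho (\<omega> i s) powr \<theta>) \<partial>M) = ennreal mm"
proof -
  let ?f = "\<lambda>K s. of_bool (rho (\<omega> 0 s) \<le> K) * rho (\<omega> 0 s) powr \<theta>"
  have int: "integrable M (?f K)" for K
  proof (rule integrable_const_bound[of _ "\<bar>K\<bar> powr \<theta>"])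
    show "AE s in M. norm (?f K s) \<le> \<bar>K\<bar> powr \<theta>"
    proof (rule AE_I2)
      fix s assume s: "s \<in> space M"
      show "norm (?f K s) \<le> \<bar>K\<bar> powr \<theta>"
        using rho_pos[OF s, of 0] assms kappa_pos
        by (cases "rho (\<omega> 0 s) \<le> K") (auto intro!: powr_mono2)
    qed
  qed measurable
  have "\<exists>k::nat. 1 < (\<integral>s. ?f (real (Suc k)) s \<partial>M)"
  proof (rule ccontr)
    assume "\<not> ?thesis"
    then have le: "(\<integral>s. ?f (real (Suc k)) s \<partial>M) \<le> 1" for k by (auto simp: not_less)
    have sup: "(\<Squnion>k. ennreal (?f (real (Suc k)) s)) = ennreal (rho (\<omega> 0 s) powr \<theta>)"
      if s: "s \<in> space M" for s
    proof (rule SUP_eqI)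
      fix y assume y: "\<And>i. i \<in> UNIV \<Longrightarrow> ennreal (?f (real (Suc i)) s) \<le> y"
      obtain k where "rho (\<omega> 0 s) \<le> real k" using real_arch_simple by blast
      then have e: "?f (real (Suc k)) s = rho (\<omega> 0 s) powr \<theta>" by simp
      show "ennreal (rho (\<omega> 0 s) powr \<theta>) \<le> y" using y[of k, unfolded e] by simp
    qed (auto intro!: ennreal_leI)
    have "(\<integral>\<^sup>+s. ennreal (rho (\<omega> 0 s) powr \<theta>) \<partial>M) = (\<integral>\<^sup>+s. (\<Squnion>k. ennreal (?f (real (Suc k)) s)) \<partial>M)"
      by (intro nn_integral_cong sup[symmetric])
    also have "\<dots> = (\<Squnion>k. \<integral>\<^sup>+s. ennreal (?f (real (Suc k)) s) \<partial>M)"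
      by (intro nn_integral_monotone_convergence_SUP)
         (auto simp: incseq_def le_fun_def intro!: ennreal_leI)
    also have "\<dots> \<le> 1"
      using le by (intro SUP_least, subst nn_integral_eq_integral[OF int]) auto
    finally have nn: "(\<integral>\<^sup>+s. ennreal (rho (\<omega> 0 s) powr \<theta>) \<partial>M) \<le> 1" .
    have int\<theta>: "integrable M (\<lambda>s. rho (\<omega> 0 s) powr \<theta>)"
      using nn by (intro integrableI_nonneg) (auto intro: le_less_trans)
    then have le1: "(\<integral>s. rho (\<omega> 0 s) powr \<theta> \<partial>M) \<le> 1"
      using nn by (subst (asm) nn_integral_eq_integral) auto
    \<comment> \<open>If the moment of order \<theta> were at most 1, this majorant of the power
      \<kappa> would have mean at most 1, the mean of that power itself. Equality almost everywhere
      contradicts nondegeneracy.\<close>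
    let ?g = "\<lambda>s. (\<kappa> / \<theta>) * rho (\<omega> 0 s) powr \<theta> + (1 - \<kappa> / \<theta>)"
    have g: "integrable M ?g" "(\<integral>s. ?g s \<partial>M) \<le> 1"
    proof -
      show "integrable M ?g" using int\<theta> by auto
      have "(\<integral>s. ?g s \<partial>M) = (\<kappa> / \<theta>) * (\<integral>s. rho (\<omega> 0 s) powr \<theta> \<partial>M) + (1 - \<kappa> / \<theta>)"
        using int\<theta> by (simp add: prob_space)
      also have "\<dots> \<le> (\<kappa> / \<theta>) * 1 + (1 - \<kappa> / \<theta>)"
        using le1 assms kappa_pos by (intro add_right_mono mult_left_mono) auto
      finally show "(\<integral>s. ?g s \<partial>M) \<le> 1" by simp
    qed
    have d: "integrable M (\<lambda>s. ?g s - rho (\<omega> 0 s) powr \<kappa>)"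
      by (rule Bochner_Integration.integrable_diff[OF g(1) integrable_kappa])
    have nonneg: "0 \<le> ?g s - rho (\<omega> 0 s) powr \<kappa>" if "s \<in> space M" for s
      using powr_le_affine(1)[OF rho_pos[OF that, of 0] kappa_pos assms] by simp
    have "(\<integral>s. ?g s - rho (\<omega> 0 s) powr \<kappa> \<partial>M) \<le> 0"
      using g by (subst Bochner_Integration.integral_diff[OF g(1) integrable_kappa]) (simp add: kappa_moment)
    moreover have "0 \<le> (\<integral>s. ?g s - rho (\<omega> 0 s) powr \<kappa> \<partial>M)"
      by (intro Bochner_Integration.integral_nonneg nonneg)
    ultimately have "(\<integral>s. ?g s - rho (\<omega> 0 s) powr \<kappa> \<partial>M) = 0" by simp
    then have "AE s in M. ?g s - rho (\<omega> 0 s) powr \<kappa> = 0"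
      using nonneg by (subst (asm) integral_nonneg_eq_0_iff_AE[OF d]) auto
    with AE_space have "AE s in M. rho (\<omega> 0 s) = 1"
    proof eventually_elim
      case (elim s)
      then show ?case using powr_le_affine(2)[OF rho_pos[of s 0] kappa_pos assms] by force
    qed
    then show False using rho_not_AE_1 by blast
  qed
  then obtain k :: nat where k: "1 < (\<integral>s. ?f (real (Suc k)) s \<partial>M)" by blast
  show ?thesis
  proof (rule that[of "real (Suc k)" "\<integral>s. ?f (real (Suc k)) s \<partial>M"])
    fix i
    let ?F = "\<lambda>x. ennreal (of_bool (rho x \<le> real (Suc k)) * rho x powr \<theta>)"
    have "(\<integral>\<^sup>+s. ?F (\<omega> i s) \<partial>M) = (\<integral>\<^sup>+s. ?F (\<omega> 0 s) \<partial>M)"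
      by (rule nn_integral_ident) measurable
    also have "\<dots> = ennreal (\<integral>s. ?f (real (Suc k)) s \<partial>M)"
      by (rule nn_integral_eq_integral[OF int]) auto
    finally show "(\<integral>\<^sup>+s. ?F (\<omega> i s) \<partial>M) = ennreal (\<integral>s. ?f (real (Suc k)) s \<partial>M)" .
  qed (use k in auto)
qed

text \<open>Optional stopping for the martingale of \<open>\<theta>\<close>-powers of products, stopped when they exceed \<open>x\<close>
  and killed when a factor exceeds \<open>K\<close>.\<close>

lemma prob_climbs_ge:
  assumes \<theta>: "0 < \<theta>" and K: "1 \<le> K" and mm: "1 < mm"
    and step: "\<And>i. (\<integral>\<^sup>+s. ennreal (of_bool (rho (\<omega> i s) \<le> K) * rho (\<omega> i s) powr \<theta>) \<partial>M) = ennreal mm"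
    and x: "1 \<le> x" and L: "x powr \<theta> / mm ^ L \<le> 1 / 2"
  shows "(K * x) powr (- \<theta>) / 2 \<le> prob {s \<in> space M. climbs b L x (W s)}"
proof -
  define P where "P j e = rho_prod e b (b + int j)" for j e
  \<comment> \<open>The process still alive at time \<open>j\<close>: no factor above
    \<open>K\<close>, no product at or above \<open>x\<close> so far, normalised by
    \<open>mm ^ j\<close>. The constant \<open>C\<close> below bounds what is lost when it is
    stopped by a climb.\<close>
  define G where "G j e = of_bool (\<forall>i<j. rho (e (b + 1 + int i)) \<le> K) *
      of_bool (\<forall>i<j. P (Suc i) e < x) * P j e powr \<theta> / mm ^ j" for j :: nat and e
  define f where "f j e = of_bool (rho (e (b + 1 + int j)) \<le> K) * rho (e (b + 1 + int j)) powr \<theta> / mm"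
    for j :: nat and e
  define C where "C = (K * x) powr \<theta>"
  have P_Suc: "P (Suc j) e = P j e * rho (e (b + 1 + int j))" for j e
    unfolding P_def by (subst rho_prod_step) (auto simp: algebra_simps)
  have [measurable]: "P j \<in> borel_measurable (PiM UNIV (\<lambda>_. borel))" for j
    unfolding P_def[abs_def] by measurable
  have [measurable]: "G j \<in> borel_measurable (PiM UNIV (\<lambda>_. borel))"
    "f j \<in> borel_measurable (PiM UNIV (\<lambda>_. borel))" for j
    unfolding G_def[abs_def] f_def[abs_def] by measurable
  have f0: "0 \<le> f j e" for j e using mm by (simp add: f_def)
  have G0: "0 \<le> G j e" for j e using mm by (simp add: G_def)
  have f1: "(\<integral>\<^sup>+s. ennreal (f j (W s)) \<partial>M) = 1" for j
  proof -
    have "(\<integral>\<^sup>+s. ennreal (f j (W s)) \<partial>M) =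
        (\<integral>\<^sup>+s. ennreal (of_bool (rho (\<omega> (b + 1 + int j) s) \<le> K) * rho (\<omega> (b + 1 + int j) s) powr \<theta>) * ennreal (1 / mm) \<partial>M)"
      unfolding f_def using mm by (intro nn_integral_cong) (simp flip: ennreal_mult)
    also have "\<dots> = ennreal mm * ennreal (1 / mm)"
      by (subst nn_integral_multc) (auto simp: step)
    finally show ?thesis using mm by (simp flip: ennreal_mult)
  qed
  have Pc: "P i e = P i e'" if "\<And>l. l \<in> {b<..b + int j} \<Longrightarrow> e l = e' l" "i \<le> j" for i j e e'
    unfolding P_def by (rule rho_prod_cong) (use that in auto)
  have Gc: "G j e = G j e'" if A: "\<And>l. l \<in> {b<..b + int j} \<Longrightarrow> e l = e' l" for j e e'
  proof -
    have "P i e = P i e'" if "i \<le> j" for i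
      by (rule Pc[of j, OF A that]) simp
    then have "(\<forall>i<j. P (Suc i) e < x) = (\<forall>i<j. P (Suc i) e' < x)" "P j e = P j e'"
      by (simp_all add: Suc_le_eq)
    moreover have "(\<forall>i<j. rho (e (b + 1 + int i)) \<le> K) = (\<forall>i<j. rho (e' (b + 1 + int i)) \<le> K)"
      using A by auto
    ultimately show ?thesis by (simp add: G_def)
  qed
  \<comment> \<open>Adding \<open>C\<close> on the event of a climb makes the mean nondecreasing in
    \<open>j\<close>, starting from 1.\<close>
  have main: "1 \<le> (\<integral>\<^sup>+s. ennreal (G j (W s)) + ennreal C * of_bool (climbs b j x (W s)) \<partial>M)" for j
  proof (induction j)
    case 0
    show ?case by (simp add: G_def P_def rho_prod_def climbs_def emeasure_space_1)
  next
    case (Suc j)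
    have "(\<integral>\<^sup>+s. ennreal (G j (W s)) + ennreal C * of_bool (climbs b j x (W s)) \<partial>M) =
        (\<integral>\<^sup>+s. ennreal (G j (W s)) \<partial>M) + (\<integral>\<^sup>+s. ennreal C * of_bool (climbs b j x (W s)) \<partial>M)"
      by (intro nn_integral_add) measurable
    also have "(\<integral>\<^sup>+s. ennreal (G j (W s)) \<partial>M) = (\<integral>\<^sup>+s. ennreal (G j (W s)) * ennreal (f j (W s)) \<partial>M)"
    proof -
      have "(\<integral>\<^sup>+s. ennreal (G j (W s)) * ennreal (f j (W s)) \<partial>M) =
          (\<integral>\<^sup>+s. ennreal (G j (W s)) \<partial>M) * (\<integral>\<^sup>+s. ennreal (f j (W s)) \<partial>M)"
        by (rule nn_integral_indep_mult[of "\<lambda>e. ennreal (G j e)" "\<lambda>e. ennreal (f j e)" "{b<..b + int j}" "{b + 1 + int j}"])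
           (auto intro!: arg_cong[where f=ennreal] Gc simp: f_def)
      then show ?thesis by (simp add: f1)
    qed
    also have "\<dots> + (\<integral>\<^sup>+s. ennreal C * of_bool (climbs b j x (W s)) \<partial>M) =
        (\<integral>\<^sup>+s. ennreal (G j (W s)) * ennreal (f j (W s)) + ennreal C * of_bool (climbs b j x (W s)) \<partial>M)"
      by (intro nn_integral_add[symmetric]) measurable
    also have "\<dots> \<le> (\<integral>\<^sup>+s. ennreal (G (Suc j) (W s)) + ennreal C * of_bool (climbs b (Suc j) x (W s)) \<partial>M)"
    proof (rule nn_integral_mono)
      fix s assume s: "s \<in> space M"
      let ?e = "W s"
      have P0: "0 \<le> P i ?e" for i unfolding P_def by (rule rho_prod_nonneg[OF env_W[OF s]])
      have Gf: "G j ?e * f j ?e = of_bool (\<forall>i<Suc j. rho (?e (b + 1 + int i)) \<le> K) *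
          of_bool (\<forall>i<j. P (Suc i) ?e < x) * P (Suc j) ?e powr \<theta> / mm ^ Suc j"
      proof -
        have "P (Suc j) ?e powr \<theta> = P j ?e powr \<theta> * rho (?e (b + 1 + int j)) powr \<theta>"
          unfolding P_Suc using P0 rho_pos[OF s] by (intro powr_mult)
        then show ?thesis by (auto simp: G_def f_def less_Suc_eq)
      qed
      have climb_Suc: "climbs b (Suc j) x ?e \<longleftrightarrow> climbs b j x ?e \<or> x \<le> P (Suc j) ?e"
        by (auto simp: climbs_def P_def less_Suc_eq)
      have not_climb: "climbs b j x ?e \<longleftrightarrow> \<not> (\<forall>i<j. P (Suc i) ?e < x)"
        by (auto simp: climbs_def P_def not_less)
      have "G j ?e * f j ?e + C * of_bool (climbs b j x ?e) \<le>
          G (Suc j) ?e + C * of_bool (climbs b (Suc j) x ?e)"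
      proof (cases "climbs b j x ?e")
        case True
        then have z: "G j ?e * f j ?e = 0" unfolding Gf using not_climb by auto
        show ?thesis unfolding z using G0[of "Suc j" ?e] climb_Suc True by simp
      next
        case nc: False
        then have Pj: "P j ?e \<le> x"
          using not_climb x by (cases j) (auto simp: P_def rho_prod_def less_imp_le simp del: of_nat_Suc)
        show ?thesis
        proof (cases "x \<le> P (Suc j) ?e")
          case False
          then have "G (Suc j) ?e = G j ?e * f j ?e"
            using Gf by (auto simp: G_def less_Suc_eq)
          then show ?thesis using nc climb_Suc False by simp
        next
          case True
          \<comment> \<open>On a first climb the previous product is at most \<open>x\<close> and
            the new factor at most \<open>K\<close>, so the product is at most \<open>K * x\<close>;
            if the factor exceeds \<open>K\<close>, the process is killed.\<close>
          have "G j ?e * f j ?e \<le> C"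
          proof (cases "rho (?e (b + 1 + int j)) \<le> K")
            case False
            then show ?thesis by (simp add: f_def C_def)
          next
            case rK: True
            have "P (Suc j) ?e \<le> K * x"
              unfolding P_Suc using Pj rK P0 rho_pos[OF s, of "b + 1 + int j"] x K mult_mono[of "P j ?e" x] 
              by (simp add: mult.commute[of K])
            then have "P (Suc j) ?e powr \<theta> \<le> C"
              unfolding C_def using P0 \<theta> by (intro powr_mono2) auto
            moreover have "P (Suc j) ?e powr \<theta> / mm ^ Suc j \<le> P (Suc j) ?e powr \<theta> / 1"
              using mm by (intro divide_left_mono) (auto simp del: power_Suc)
            moreover have "G j ?e * f j ?e \<le> P (Suc j) ?e powr \<theta> / mm ^ Suc j"
              unfolding Gf using mm by (auto simp: of_bool_def)
            ultimately show ?thesis by linarith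
          qed
          then show ?thesis using nc True climb_Suc G0[of "Suc j" ?e] by simp
        qed
      qed
      moreover have "0 \<le> C" by (simp add: C_def)
      ultimately show "ennreal (G j ?e) * ennreal (f j ?e) + ennreal C * of_bool (climbs b j x ?e) \<le>
          ennreal (G (Suc j) ?e) + ennreal C * of_bool (climbs b (Suc j) x ?e)"
        using f0[of j ?e] G0[of j ?e] G0[of "Suc j" ?e]
        by (simp add: of_bool_def ennreal_leI flip: ennreal_mult ennreal_plus split: if_splits)
    qed
    finally show ?case using Suc by (rule order_trans[rotated])
  qed
  \<comment> \<open>At the horizon \<open>L\<close> at most half of the initial mean can be alive,
    so the climb accounts for the other half.\<close>
  have GL: "G L (W s) \<le> 1 / 2" if s: "s \<in> space M" for s
  proof (cases "\<forall>i<L. P (Suc i) (W s) < x")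
    case True
    then have "P L (W s) \<le> x"
      using x by (cases L) (auto simp: P_def rho_prod_def less_imp_le simp del: of_nat_Suc)
    then have "P L (W s) powr \<theta> \<le> x powr \<theta>"
      using \<theta> rho_prod_nonneg[OF env_W[OF s]] by (intro powr_mono2) (auto simp: P_def)
    then have "P L (W s) powr \<theta> / mm ^ L \<le> x powr \<theta> / mm ^ L"
      using mm by (intro divide_right_mono) auto
    moreover have "G L (W s) \<le> P L (W s) powr \<theta> / mm ^ L"
      using mm by (auto simp: G_def of_bool_def)
    ultimately show ?thesis using L by linarith
  qed (auto simp: G_def)
  let ?B = "{s \<in> space M. climbs b L x (W s)}"
  have B: "?B \<in> events" by measurable
  have "1 \<le> (\<integral>\<^sup>+s. ennreal (1 / 2) + ennreal C * indicator ?B s \<partial>M)"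
  proof (rule order_trans[OF main[of L]], rule nn_integral_mono)
    fix s assume s: "s \<in> space M"
    show "ennreal (G L (W s)) + ennreal C * of_bool (climbs b L x (W s)) \<le>
        ennreal (1 / 2) + ennreal C * indicator ?B s"
      using s by (intro add_mono ennreal_leI GL) (auto simp: indicator_def)
  qed
  also have "\<dots> = ennreal (1 / 2) + ennreal C * emeasure M ?B"
    using B by (subst nn_integral_add) (auto simp: nn_integral_cmult_indicator emeasure_space_1 simp del: ennreal_half)
  also have "\<dots> = ennreal (1 / 2 + C * prob ?B)"
    by (simp add: emeasure_eq_measure C_def ennreal_mult ennreal_plus del: ennreal_half)
  finally have "ennreal 1 \<le> ennreal (1 / 2 + C * prob ?B)" by (simp only: ennreal_1)
  moreover have "0 \<le> 1 / 2 + C * prob ?B" by (simp add: C_def)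
  ultimately have "1 / 2 \<le> C * prob ?B" by (subst (asm) ennreal_le_iff) auto
  moreover have "0 < C" using K x by (simp add: C_def)
  ultimately have "1 / (2 * C) \<le> prob ?B" by (simp add: field_simps)
  then show ?thesis by (simp add: C_def powr_minus field_simps)
qed

section \<open>Upper bound: independent blocks\<close>

lemma nn_integral_blocks:
  assumes p: "\<And>b. p \<le> prob {s \<in> space M. climbs b L x (W s)}" and "0 \<le> p"
  shows "(\<integral>\<^sup>+s. ennreal (\<Prod>k<N. 1 - of_bool (climbs (int (k * L)) L x (W s)) / 2) \<partial>M)
    \<le> ennreal ((1 - p / 2) ^ N)"
proof (induction N)
  case 0
  then show ?case by (simp add: emeasure_space_1)
next
  case (Suc N)
  let ?\<phi> = "\<lambda>k e. 1 - of_bool (climbs (int (k * L)) L x e) / 2 :: real"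
  let ?B = "{s \<in> space M. climbs (int (N * L)) L x (W s)}"
  have p1: "p \<le> 1" using p prob_le_1 by (rule order_trans)
  have B: "?B \<in> events" by measurable
  have \<phi>: "0 \<le> ?\<phi> k e" for k e by (simp add: of_bool_def)
  have "(\<integral>\<^sup>+s. ennreal (\<Prod>k<Suc N. ?\<phi> k (W s)) \<partial>M) =
      (\<integral>\<^sup>+s. ennreal (\<Prod>k<N. ?\<phi> k (W s)) * ennreal (?\<phi> N (W s)) \<partial>M)"
    using \<phi> by (simp add: prod_nonneg flip: ennreal_mult)
  also have "\<dots> = (\<integral>\<^sup>+s. ennreal (\<Prod>k<N. ?\<phi> k (W s)) \<partial>M) * (\<integral>\<^sup>+s. ennreal (?\<phi> N (W s)) \<partial>M)"
  proof (rule nn_integral_indep_mult[of "\<lambda>e. ennreal (\<Prod>k<N. ?\<phi> k e)" "\<lambda>e. ennreal (?\<phi> N e)"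
        "{0<..int (N * L)}" "{int (N * L)<..int (N * L) + int L}"])
    fix e e' :: "int \<Rightarrow> real" assume eq: "\<And>i. i \<in> {0<..int (N * L)} \<Longrightarrow> e i = e' i"
    have "climbs (int (k * L)) L x e = climbs (int (k * L)) L x e'" if "k < N" for k
    proof (intro climbs_cong eq)
      fix i assume i: "i \<in> {int (k * L)<..int (k * L) + int L}"
      have "Suc k * L \<le> N * L" using that by (intro mult_le_mono1) simp
      then have "int (k * L) + int L \<le> int (N * L)" by (simp flip: of_nat_add of_nat_mult)
      moreover have "0 \<le> int (k * L)" by (rule of_nat_0_le_iff)
      ultimately show "i \<in> {0<..int (N * L)}"
        using i by (auto simp del: of_nat_mult of_nat_0_le_iff)
    qed
    then show "ennreal (\<Prod>k<N. ?\<phi> k e) = ennreal (\<Prod>k<N. ?\<phi> k e')" by simp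
  next
    fix e e' :: "int \<Rightarrow> real" assume eq: "\<And>i. i \<in> {int (N * L)<..int (N * L) + int L} \<Longrightarrow> e i = e' i"
    show "ennreal (?\<phi> N e) = ennreal (?\<phi> N e')" using climbs_cong[OF eq] by simp
  qed auto
  also have "(\<integral>\<^sup>+s. ennreal (?\<phi> N (W s)) \<partial>M) = ennreal (1 - prob ?B / 2)"
  proof -
    have int: "integrable M (\<lambda>s. indicator ?B s / 2 :: real)"
      using B by (intro integrable_divide integrable_real_indicator) (auto simp: less_top[symmetric])
    have "(\<integral>\<^sup>+s. ennreal (?\<phi> N (W s)) \<partial>M) = (\<integral>\<^sup>+s. ennreal (1 - indicator ?B s / 2) \<partial>M)"
      by (intro nn_integral_cong) (simp add: indicator_def of_bool_def)
    also have "\<dots> = ennreal (\<integral>s. 1 - indicator ?B s / 2 \<partial>M)"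
      by (rule nn_integral_eq_integral[OF Bochner_Integration.integrable_diff[OF _ int]])
         (auto simp: indicator_def)
    also have "(\<integral>s. 1 - indicator ?B s / 2 \<partial>M) = 1 - prob ?B / 2"
      using B by (subst Bochner_Integration.integral_diff[OF _ int]) (auto simp: prob_space)
    finally show ?thesis .
  qed
  also have "(\<integral>\<^sup>+s. ennreal (\<Prod>k<N. ?\<phi> k (W s)) \<partial>M) * \<dots> \<le> ennreal ((1 - p / 2) ^ N) * ennreal (1 - p / 2)"
    using p[of "int (N * L)"] by (intro mult_mono Suc ennreal_leI) auto
  also have "\<dots> = ennreal ((1 - p / 2) ^ Suc N)"
    using p1 by (simp add: mult.commute flip: ennreal_mult)
  finally show ?case .
qed

text \<open>A block with a climb at least doubles the product of the \<open>1 + decay\<close>, hence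
  contributes a factor at most 1/2. Other blocks, and the sites outside all blocks, contribute at
  most 1.\<close>

lemma hit_reflect_le_blocks:
  assumes w: "env w" "\<And>x. 0 < w x" and l: "0 < l" and a: "N * L < a"
  shows "hit (reflect w) (int a) n 0 \<le>
    (1 + l) ^ n * (\<Prod>k<N. 1 - of_bool (climbs (int (k * L)) L (1 / l) w) / 2)"
proof -
  let ?w = "reflect w" and ?z = "decay l (reflect w)"
  have w': "env ?w" "\<And>x. 0 < ?w x" "?w 0 = 1"
    using env_reflect[OF w(1)] w(2) by (auto simp: reflect_def)
  have z: "0 \<le> ?z i" for i by (rule decay_nonneg) (use l w' in auto)
  have z1: "0 < 1 + ?z i" for i using z[of i] by linarith
  have "hit ?w (int a) n (int 0) \<le> (1 + l) ^ n * (\<Prod>i\<in>{0..<a}. 1 / (1 + ?z i))"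
    by (rule hit_le_decay) (use w' l in auto)
  also have "(\<Prod>i\<in>{0..<a}. 1 / (1 + ?z i)) \<le> (\<Prod>i\<in>{0<..N * L}. 1 / (1 + ?z i))"
  proof -
    have "(\<Prod>i\<in>{0..<a}. 1 / (1 + ?z i)) =
        (\<Prod>i\<in>{0..<a} - {0<..N * L}. 1 / (1 + ?z i)) * (\<Prod>i\<in>{0<..N * L}. 1 / (1 + ?z i))"
      using a by (intro prod.subset_diff) auto
    also have "\<dots> \<le> 1 * (\<Prod>i\<in>{0<..N * L}. 1 / (1 + ?z i))"
      using z z1 by (intro mult_right_mono prod_le_1 prod_nonneg) (auto simp: less_imp_le)
    finally show ?thesis by simp
  qed
  also have "\<dots> = (\<Prod>k<N. \<Prod>i\<in>{k * L<..k * L + L}. 1 / (1 + ?z i))"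
    by (rule prod_blocks[symmetric])
  also have "\<dots> \<le> (\<Prod>k<N. 1 - of_bool (climbs (int (k * L)) L (1 / l) w) / 2)"
  proof (rule prod_mono, intro conjI)
    fix k
    let ?P = "\<Prod>i\<in>{k * L<..k * L + L}. 1 + ?z i"
    have e: "(\<Prod>i\<in>{k * L<..k * L + L}. 1 / (1 + ?z i)) = 1 / ?P"
      by (simp add: prod_dividef)
    have P1: "1 \<le> ?P" using z by (intro prod_ge_1) auto
    show "0 \<le> (\<Prod>i\<in>{k * L<..k * L + L}. 1 / (1 + ?z i))" unfolding e using P1 by simp
    show "(\<Prod>i\<in>{k * L<..k * L + L}. 1 / (1 + ?z i)) \<le> 1 - of_bool (climbs (int (k * L)) L (1 / l) w) / 2"
    proof (cases "climbs (int (k * L)) L (1 / l) w")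
      case True
      then obtain j where j: "j < L" "1 / l \<le> rho_prod w (int (k * L)) (int (k * L) + int (Suc j))"
        by (auto simp: climbs_def)
      \<comment> \<open>The product only involves sites right of \<open>k * L\<close>, hence
        positive ones, and does not see the change at the origin.\<close>
      have "rho_prod w (int (k * L)) (int (k * L) + int (Suc j)) =
          rho_prod ?w (int (k * L)) (int (k * L + Suc j))"
        unfolding rho_prod_def reflect_def using of_nat_0_le_iff[of "k * L"]
        by (intro prod.cong) (auto simp del: of_nat_mult of_nat_0_le_iff)
      then have "1 \<le> l * rho_prod ?w (int (k * L)) (int (k * L + Suc j))"
        using j(2) l by (simp only: pos_divide_le_eq mult.commute)
      then have "2 \<le> ?P" by (intro decay_block[OF w'(1,2) _ j(1)]) (use l in auto)
      then show ?thesis unfolding e using True by simp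
    next
      case False
      then show ?thesis unfolding e using P1 by simp
    qed
  qed
  finally show ?thesis using l by (simp add: mult_left_mono)
qed

lemma expectation_hit_reflect_le:
  assumes p: "\<And>b. p \<le> prob {s \<in> space M. climbs b L (1 / l) (W s)}" "0 \<le> p"
    and l: "0 < l" and a: "N * L < a"
  shows "(\<integral>s. hit (reflect (W s)) (int a) n 0 \<partial>M) \<le> exp (l * n - p * N / 2)"
proof -
  have p1: "p \<le> 1" using p(1)[of 0] prob_le_1 by (rule order_trans)
  have [measurable]: "(\<lambda>s. hit (reflect (W s)) (int a) n 0) \<in> borel_measurable M" by measurable
  have b: "0 \<le> hit (reflect (W s)) (int a) n 0" if "s \<in> space M" for s
    using hit_bounds[OF env_reflect[OF env_W[OF that]]] by blast
  have "(\<integral>\<^sup>+s. ennreal (hit (reflect (W s)) (int a) n 0) \<partial>M) \<le>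
      (\<integral>\<^sup>+s. ennreal ((1 + l) ^ n) * ennreal (\<Prod>k<N. 1 - of_bool (climbs (int (k * L)) L (1 / l) (W s)) / 2) \<partial>M)"
  proof (rule nn_integral_mono)
    fix s assume s: "s \<in> space M"
    have "ennreal (hit (reflect (W s)) (int a) n 0) \<le>
        ennreal ((1 + l) ^ n * (\<Prod>k<N. 1 - of_bool (climbs (int (k * L)) L (1 / l) (W s)) / 2))"
      by (intro ennreal_leI hit_reflect_le_blocks env_W[OF s]) (use l a range[OF s] in auto)
    then show "ennreal (hit (reflect (W s)) (int a) n 0) \<le>
        ennreal ((1 + l) ^ n) * ennreal (\<Prod>k<N. 1 - of_bool (climbs (int (k * L)) L (1 / l) (W s)) / 2)"
      using l by (subst ennreal_mult[symmetric]) (auto intro!: prod_nonneg simp: of_bool_def)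
  qed
  also have "\<dots> = ennreal ((1 + l) ^ n) * (\<integral>\<^sup>+s. ennreal (\<Prod>k<N. 1 - of_bool (climbs (int (k * L)) L (1 / l) (W s)) / 2) \<partial>M)"
    by (rule nn_integral_cmult) measurable
  also have "\<dots> \<le> ennreal ((1 + l) ^ n) * ennreal ((1 - p / 2) ^ N)"
    by (intro mult_left_mono nn_integral_blocks p) simp
  also have "\<dots> = ennreal ((1 + l) ^ n * (1 - p / 2) ^ N)"
    using l p1 by (simp add: ennreal_mult)
  also have "\<dots> \<le> ennreal (exp (l * n - p * N / 2))"
  proof (rule ennreal_leI)
    have "(1 + l) ^ n \<le> exp l ^ n" using l by (intro power_mono exp_ge_add_one_self) auto
    moreover have "(1 - p / 2) ^ N \<le> exp (- (p / 2)) ^ N"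
      using p1 exp_ge_add_one_self[of "- (p / 2)"] by (intro power_mono) auto
    ultimately have "(1 + l) ^ n * (1 - p / 2) ^ N \<le> exp l ^ n * exp (- (p / 2)) ^ N"
      using p1 by (intro mult_mono) auto
    also have "\<dots> = exp (l * n - p * N / 2)"
      unfolding exp_of_nat_mult[symmetric] exp_add[symmetric] by (simp add: algebra_simps)
    finally show "(1 + l) ^ n * (1 - p / 2) ^ N \<le> exp (l * n - p * N / 2)" .
  qed
  finally have "(\<integral>\<^sup>+s. ennreal (hit (reflect (W s)) (int a) n 0) \<partial>M) \<le> ennreal (exp (l * n - p * N / 2))" .
  then show ?thesis
    using b by (intro integral_real_bounded) auto
qed

lemma integrable_hit: "integrable M (\<lambda>s. hit (reflect (W s)) a n x)"
proof (rule integrable_const_bound[of _ 1])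
  show "AE s in M. norm (hit (reflect (W s)) a n x) \<le> 1"
    by (auto simp: abs_le_iff hit_bounds env_W env_reflect intro!: AE_I2 order_trans[of "- 1" 0])
qed measurable

lemma integrable_above: "integrable M (\<lambda>s. above_at (W s) y n x)"
proof (rule integrable_const_bound[of _ 1])
  show "AE s in M. norm (above_at (W s) y n x) \<le> 1"
    by (auto simp: abs_le_iff above_bounds env_W intro!: AE_I2 order_trans[of "- 1" 0])
qed measurable

lemma upper_exponents:
  fixes \<nu> g :: real
  assumes \<nu>: "\<kappa> < \<nu>" "\<nu> < 1" and g: "0 < g" "g < (\<nu> - \<kappa>) / (1 - \<kappa>)"
  obtains a \<theta> d where "0 < a" "\<kappa> < \<theta>" "0 < d" "d < \<nu>" "1 - a < \<nu> - d - \<theta> * a" "g < \<nu> - d - \<theta> * a"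
proof -
  define b where "b = (\<nu> - \<kappa>) / (1 - \<kappa>)"
  have \<kappa>: "0 < \<kappa>" "\<kappa> < 1" using \<nu> kappa_pos by auto
  define \<eta> where "\<eta> = (b - g) / (2 * \<kappa>)"
  define a where "a = 1 - b + \<eta>"
  have \<eta>: "0 < \<eta>" "\<kappa> * \<eta> = (b - g) / 2" using g \<kappa> by (auto simp: \<eta>_def b_def)
  have b: "b * (1 - \<kappa>) = \<nu> - \<kappa>" "b < 1" using \<kappa> \<nu> by (auto simp: b_def field_simps)
  have a: "0 < a" using b \<eta> by (simp add: a_def)
  have e: "\<nu> - \<kappa> * a = b - \<kappa> * \<eta>" using b(1) by (simp add: a_def algebra_simps)
  \<comment> \<open>With a = 1 - b + \<eta> one has 1 - a = b - \<eta> and \<nu> - \<kappa> * a = b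
    - \<kappa> * \<eta>. The margin left is cut into three parts: for \<theta> above \<kappa>, for
    the block length exponent, and for strictness.\<close>
  define \<sigma> where "\<sigma> = (b - \<kappa> * \<eta> - max (b - \<eta>) g) / 3"
  have \<sigma>: "0 < \<sigma>" "b - \<kappa> * \<eta> = max (b - \<eta>) g + 3 * \<sigma>"
  proof -
    have "\<kappa> * \<eta> < 1 * \<eta>" using \<kappa> \<eta> by (intro mult_strict_right_mono) auto
    moreover have "g < b - \<kappa> * \<eta>" using \<eta> g by (simp add: b_def)
    ultimately show "0 < \<sigma>" by (simp add: \<sigma>_def)
    have "3 * \<sigma> = b - \<kappa> * \<eta> - max (b - \<eta>) g" by (simp add: \<sigma>_def)
    then show "b - \<kappa> * \<eta> = max (b - \<eta>) g + 3 * \<sigma>" by linarith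
  qed
  define \<theta> where "\<theta> = \<kappa> + \<sigma> / a"
  have t: "\<theta> * a = \<kappa> * a + \<sigma>" using a by (simp add: \<theta>_def field_simps)
  show ?thesis
  proof (rule that[of a \<theta> \<sigma>])
    show "0 < a" "\<kappa> < \<theta>" "0 < \<sigma>" using a \<sigma> by (auto simp: \<theta>_def)
    have "\<nu> - \<sigma> - \<theta> * a = max (b - \<eta>) g + \<sigma>" using e t \<sigma>(2) by linarith
    then show "1 - a < \<nu> - \<sigma> - \<theta> * a" "g < \<nu> - \<sigma> - \<theta> * a" using \<sigma>(1) by (auto simp: a_def)
    then show "\<sigma> < \<nu>" using g(1) t \<kappa>(1) a mult_pos_pos[of \<kappa> a] \<sigma>(1) by linarith
  qed
qed

lemma eventually_expectation_hit_le:
  fixes \<nu> g :: real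
  assumes \<nu>: "\<kappa> < \<nu>" "\<nu> < 1" and g: "0 < g" "g < (\<nu> - \<kappa>) / (1 - \<kappa>)"
  shows "eventually (\<lambda>n. (\<integral>s. hit (reflect (W s)) \<lfloor>real n powr \<nu>\<rfloor> n 0 \<partial>M) \<le> exp (- (real n powr g))) sequentially"
proof -
  obtain a \<theta> d where par: "0 < a" "\<kappa> < \<theta>" "0 < d" "d < \<nu>" "1 - a < \<nu> - d - \<theta> * a" "g < \<nu> - d - \<theta> * a"
    using upper_exponents[OF \<nu> g] by blast
  obtain K mm where K: "1 \<le> K" "1 < mm"
    and step: "\<And>i. (\<integral>\<^sup>+s. ennreal (of_bool (rho (\<omega> i s) \<le> K) * rho (\<omega> i s) powr \<theta>) \<partial>M) = ennreal mm"
    using truncated_moment_gt_1[OF par(2)] by blast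
  have \<theta>: "0 < \<theta>" using par kappa_pos by simp
  \<comment> \<open>The climbing probability below is 16 * c times a power of n, and the number of
    blocks loses a factor 4. So the gain in the exponent is 2 * c times a power of n, one c for
    \<open>n powr (1 - a)\<close> and one for \<open>n powr g\<close>.\<close>
  define c where "c = K powr (- \<theta>) / 32"
  have c: "0 < c" using K by (simp add: c_def)
  have "eventually (\<lambda>n. exp (\<theta> * a * ln (real n) - ln mm * real n powr d) \<le> 1 / 2) sequentially"
    using par K by (intro eventually_exp_small) auto
  moreover have "eventually (\<lambda>n. real n powr (1 - a) \<le> c * real n powr (\<nu> - d - \<theta> * a)) sequentially"
    using par c by (intro eventually_powr_le) auto
  moreover have "eventually (\<lambda>n. real n powr g \<le> c * real n powr (\<nu> - d - \<theta> * a)) sequentially"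
    using par c by (intro eventually_powr_le) auto
  moreover have "eventually (\<lambda>n. real n powr (\<nu> - d) / 4 \<le> (real n powr \<nu> - 2) / (real n powr d + 1) - 1) sequentially"
    using par by (intro eventually_ratio_ge) auto
  ultimately show ?thesis using eventually_ge_at_top[of 1]
  proof eventually_elim
    case (elim n)
    \<comment> \<open>A positive power of n is long enough for a block: \<open>mm ^ L\<close> then
      outgrows any power of n, as \<open>prob_climbs_ge\<close> requires.\<close>
    define L where "L = nat \<lceil>real n powr d\<rceil>"
    define A where "A = nat \<lfloor>real n powr \<nu>\<rfloor>"
    define N where "N = (A - 1) div L"
    define p where "p = (K * real n powr a) powr (- \<theta>) / 2"
    have n: "1 \<le> real n" using elim(5) by simp
    have pow1: "1 \<le> real n powr e" if "0 \<le> e" for e using n that by (rule ge_one_powr_ge_zero)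
    have L: "real n powr d \<le> real L" "real L \<le> real n powr d + 1" "0 < L"
      using pow1[of d] par unfolding L_def by linarith+
    have A: "int A = \<lfloor>real n powr \<nu>\<rfloor>" "1 \<le> A" "real n powr \<nu> \<le> real A + 1"
      using pow1[of \<nu>] par unfolding A_def by linarith+
    have "N * L \<le> A - 1" by (simp add: N_def)
    then have NL: "N * L < A" using A(2) by linarith
    have N: "real n powr (\<nu> - d) / 4 \<le> real N"
    proof -
      have "A - 1 < L * (N + 1)" unfolding N_def using L(3) by (metis Suc_eq_plus1 dividend_less_div_times mult.commute add.commute mult_Suc_right)
      then have "real (A - 1) < real L * (real N + 1)" by (metis of_nat_1 of_nat_add of_nat_less_iff of_nat_mult)
      then have "real n powr \<nu> - 2 \<le> real L * (real N + 1)" using A by linarith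
      also have "\<dots> \<le> (real n powr d + 1) * (real N + 1)" using L by (intro mult_right_mono) auto
      finally have "(real n powr \<nu> - 2) / (real n powr d + 1) \<le> real N + 1"
        by (simp add: pos_divide_le_eq add_nonneg_pos mult.commute)
      then show ?thesis using elim(4) by linarith
    qed
    have climb: "p \<le> prob {s \<in> space M. climbs b L (1 / (real n powr (- a))) (W s)}" for b
    proof -
      have x: "1 / (real n powr (- a)) = real n powr a" by (simp add: powr_minus_divide)
      have "mm powr (real n powr d) \<le> mm powr (real L)" using K L by (intro powr_mono) auto
      then have m: "mm powr (real n powr d) \<le> mm ^ L" using K by (simp add: powr_realpow)
      have "(real n powr a) powr \<theta> / mm ^ L \<le> (real n powr a) powr \<theta> / mm powr (real n powr d)"
        using m K by (intro divide_left_mono) auto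
      also have "\<dots> = exp (\<theta> * a * ln (real n) - ln mm * real n powr d)"
        using n K by (simp add: powr_def exp_diff mult_ac)
      also have "\<dots> \<le> 1 / 2" by (rule elim(1))
      finally show ?thesis
        unfolding x p_def using par by (intro prob_climbs_ge[OF \<theta> K step] pow1) auto
    qed
    have "(\<integral>s. hit (reflect (W s)) (int A) n 0 \<partial>M) \<le> exp (real n powr (- a) * n - p * N / 2)"
      by (rule expectation_hit_reflect_le[OF climb _ _ NL]) (use n in \<open>auto simp: p_def\<close>)
    also have "\<dots> \<le> exp (- (real n powr g))"
    proof -
      have "real n powr (- a) * n = real n powr (1 - a)"
        using n by (simp add: powr_diff powr_minus field_simps)
      moreover have "2 * c * real n powr (\<nu> - d - \<theta> * a) \<le> p * N / 2"
      proof -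
        have "p = 16 * c * real n powr (- \<theta> * a)"
          using n K by (simp add: p_def c_def powr_mult powr_powr mult.commute)
        then have "p * (real n powr (\<nu> - d) / 4) / 2 = 2 * c * real n powr (\<nu> - d - \<theta> * a)"
          by (simp flip: powr_add)
        moreover have "p * (real n powr (\<nu> - d) / 4) \<le> p * N"
          using N by (intro mult_left_mono) (auto simp: p_def)
        ultimately show ?thesis by linarith
      qed
      ultimately have "real n powr (- a) * n - p * N / 2 \<le> - (real n powr g)"
        using elim(2,3) by linarith
      then show ?thesis by simp
    qed
    finally show ?case by (simp add: A)
  qed
qed

lemma AE_eventually_hit_le:
  fixes \<nu> g :: real
  assumes \<nu>: "\<kappa> < \<nu>" "\<nu> < 1" and g: "0 < g" "g < (\<nu> - \<kappa>) / (1 - \<kappa>)"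
  shows "AE s in M. eventually (\<lambda>n. hit (reflect (W s)) \<lfloor>real n powr \<nu>\<rfloor> n 0 \<le> exp (- (real n powr g))) sequentially"
proof -
  obtain h where h: "g < h" "h < (\<nu> - \<kappa>) / (1 - \<kappa>)" using g(2) dense by blast
  have h0: "0 < h" using g(1) h(1) by linarith
  \<comment> \<open>The factor \<open>exp (real n powr g)\<close> turns the goal into
    \<open>Z n s \<le> 1\<close>. The larger exponent \<open>h\<close> leaves room to make the means
    summable.\<close>
  define Z where "Z n s = hit (reflect (W s)) \<lfloor>real n powr \<nu>\<rfloor> n 0 * exp (real n powr g)" for n s
  have Z0: "0 \<le> Z n s" if "s \<in> space M" for n s
    unfolding Z_def using hit_bounds[OF env_reflect[OF env_W[OF that]]] by simp
  have [measurable]: "(\<lambda>s. hit (reflect (W s)) a n 0) \<in> borel_measurable M" for a n by measurable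
  have "AE s in M. eventually (\<lambda>n. Z n s \<le> 1) sequentially"
  proof (rule AE_eventually_le[where c="\<lambda>n. 1 / real n ^ 2"])
    show "Z n \<in> borel_measurable M" for n unfolding Z_def by measurable
    show "summable (\<lambda>n. 1 / real n ^ 2)" using inverse_power_summable[of 2, where 'a=real] by (simp add: inverse_eq_divide)
    show "eventually (\<lambda>n. (\<integral>\<^sup>+s. ennreal (Z n s) \<partial>M) \<le> ennreal (1 / real n ^ 2)) sequentially"
      using eventually_exp_sq[OF h(1) h0] eventually_expectation_hit_le[OF \<nu> h0 h(2)]
    proof eventually_elim
      case (elim n)
      note int = integrable_hit[of "\<lfloor>real n powr \<nu>\<rfloor>" n 0]
      have "(\<integral>\<^sup>+s. ennreal (Z n s) \<partial>M) = ennreal (\<integral>s. Z n s \<partial>M)"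
        using int Z0 by (intro nn_integral_eq_integral) (auto simp: Z_def)
      also have "(\<integral>s. Z n s \<partial>M) = (\<integral>s. hit (reflect (W s)) \<lfloor>real n powr \<nu>\<rfloor> n 0 \<partial>M) * exp (real n powr g)"
        unfolding Z_def by (rule integral_mult_left_zero)
      also have "\<dots> \<le> exp (- (real n powr h)) * exp (real n powr g)"
        using elim(2) by (intro mult_right_mono) auto
      also have "\<dots> = exp (real n powr g - real n powr h)" by (simp flip: exp_add)
      finally show ?case using elim(1) by (meson ennreal_leI order_trans)
    qed
  qed (use Z0 in auto)
  then show ?thesis
    by eventually_elim (auto elim!: eventually_mono simp: Z_def exp_minus field_simps)
qed

section \<open>Lower bound: dyadic levels\<close>

lemma lower_exponents:
  fixes \<nu> g :: real
  assumes \<nu>: "\<kappa> < \<nu>" "\<nu> < 1" and g: "(\<nu> - \<kappa>) / (1 - \<kappa>) < g"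
  obtains a q d \<sigma> where "0 < a" "0 < d" "d < q" "q < \<kappa>" "q \<le> 1" "0 < \<sigma>"
    "\<nu> + \<sigma> + a * (1 - q) < 1" "\<nu> + \<sigma> - a * (q - d) < g"
proof -
  define b where "b = (\<nu> - \<kappa>) / (1 - \<kappa>)"
  have \<kappa>: "0 < \<kappa>" "\<kappa> < 1" using \<nu> kappa_pos by auto
  have b: "b * (1 - \<kappa>) = \<nu> - \<kappa>" "b < 1" "b < g" using \<kappa> \<nu> g by (auto simp: b_def field_simps)
  \<comment> \<open>The first term keeps a = 1 - b - \<eta> positive; the second keeps the exponent
    b + \<kappa> * \<eta> of the number of walls below g.\<close>
  define \<eta> where "\<eta> = min ((1 - b) / 2) ((g - b) / (2 * \<kappa>))"
  define a where "a = 1 - b - \<eta>"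
  have \<eta>: "0 < \<eta>" using b \<kappa> by (simp add: \<eta>_def)
  have \<eta>b: "\<eta> \<le> (1 - b) / 2" unfolding \<eta>_def by (rule min.cobounded1)
  have \<kappa>\<eta>: "\<kappa> * \<eta> \<le> (g - b) / 2"
  proof -
    have "\<kappa> * \<eta> \<le> \<kappa> * ((g - b) / (2 * \<kappa>))" using \<kappa> by (intro mult_left_mono) (auto simp: \<eta>_def)
    then show ?thesis using \<kappa> by simp
  qed
  have a: "0 < a" using \<eta>b b(2) by (simp add: a_def)
  have e1: "\<nu> + a * (1 - \<kappa>) = 1 - (1 - \<kappa>) * \<eta>" and e2: "\<nu> - a * \<kappa> = b + \<kappa> * \<eta>"
    using b(1) by (simp_all add: a_def algebra_simps)
  define \<sigma> where "\<sigma> = min ((1 - \<kappa>) * \<eta>) (g - b - \<kappa> * \<eta>) / 3"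
  have \<sigma>: "0 < \<sigma>" "3 * \<sigma> \<le> (1 - \<kappa>) * \<eta>" "3 * \<sigma> \<le> g - b - \<kappa> * \<eta>"
    using \<kappa> \<eta> \<kappa>\<eta> b(3) by (auto simp: \<sigma>_def)
  \<comment> \<open>With q = \<kappa> - r / 2 and d = r / 2, so q - d = \<kappa> - r, replacing
    \<kappa> changes the two exponents by at most \<open>a * r\<close>, hence by at most
    \<sigma>.\<close>
  define r where "r = min (\<kappa> / 2) (\<sigma> / a)"
  have "r \<le> \<kappa> / 2" unfolding r_def by (rule min.cobounded1)
  moreover have "0 < r" using \<kappa> \<sigma> a by (simp add: r_def)
  ultimately have r: "0 < r" "r \<le> \<kappa> / 2" by auto
  have ar: "0 < a * r" "a * r \<le> \<sigma>"
  proof -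
    have "a * r \<le> a * (\<sigma> / a)" using a by (intro mult_left_mono) (auto simp: r_def)
    then show "a * r \<le> \<sigma>" using a by simp
  qed (use a r in simp)
  show ?thesis
  proof (rule that[of a "r / 2" "\<kappa> - r / 2" \<sigma>])
    have "a * (1 - (\<kappa> - r / 2)) = a * (1 - \<kappa>) + a * r / 2" by (simp add: algebra_simps)
    then show "\<nu> + \<sigma> + a * (1 - (\<kappa> - r / 2)) < 1" using e1 \<sigma> ar by linarith
    have "a * (\<kappa> - r / 2 - r / 2) = a * \<kappa> - a * r" by (simp add: algebra_simps)
    then show "\<nu> + \<sigma> - a * (\<kappa> - r / 2 - r / 2) < g" using e2 \<sigma> ar by linarith
  qed (use a r \<sigma> \<kappa> in auto)
qed

text \<open>The deterministic core on the level from \<open>2 ^ k\<close> to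
  \<open>2 ^ (k + 1)\<close>. The site \<open>y\<close> belongs to the right end of the level, so
  one \<open>y\<close> and one \<open>m\<close> serve every \<open>n\<close> in it. The walk reaches
  \<open>m\<close> with the help of walls and then stays above \<open>y\<close>, from which
  \<open>m\<close> is \<open>k + 1\<close> sites away.\<close>

lemma above_ge_level:
  fixes q d a \<sigma> \<nu> g :: real
  assumes w: "env w" "\<And>x. 0 < w x"
    and par: "0 < a" "0 < d" "d < q" "q \<le> 1" "0 < \<nu>" "\<nu> < 1" "0 < g"
    and y: "y = nat \<lfloor>(2 * 2 ^ k) powr \<nu>\<rfloor>" and m: "m = y + k + 1"
    and S: "(\<Sum>z<m. cross w z powr q) \<le> real m * (2 ^ k) powr \<sigma>"
    and scale: "(\<Sum>x\<in>{int y + int (k + 1)..int y + int (k + 1) + int (2 * 2 ^ k)}. rho_prod w (int y) x) \<le> 1 / 2"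
    and mk: "(2 * 2 ^ k) powr \<nu> + real k + 1 \<le> 2 * (2 * 2 ^ k) powr \<nu>"
    and time: "4 * (2 ^ k) powr (\<nu> + \<sigma> + a * (1 - q)) \<le> (2::real) ^ k / 2"
    and cost: "ln (2 * 2 ^ k) + ln (cross w 0) + (ln (2 * 2 ^ k) + 1 / d) *
      (4 * (2 ^ k) powr (\<nu> + \<sigma> - a * (q - d))) \<le> (2 ^ k) powr g / 2"
    and n: "2 ^ k \<le> n" "n < 2 ^ (k + 1)"
  shows "exp (- (real n powr g / 2)) / 4 \<le> above_at w \<lfloor>real n powr \<nu>\<rfloor> n 0"
proof -
  define X where "X = (2::real) ^ k"
  have "real (2 ^ k) \<le> real n" "real n < real (2 ^ (k + 1))"
    using n by (simp_all only: of_nat_le_iff of_nat_less_iff)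
  then have X: "1 \<le> X" "X \<le> real n" "real n \<le> 2 * X"
    unfolding X_def by simp_all
  let ?S = "\<Sum>z<m. cross w z powr q" and ?H = "X powr a"
  have H: "1 \<le> ?H" using X par by (intro ge_one_powr_ge_zero) auto
  have "real y \<le> (2 * X) powr \<nu>" unfolding y X_def[symmetric] by (simp add: of_nat_nat)
  then have "real m \<le> 2 * (2 * X) powr \<nu>" using mk unfolding m X_def by simp
  also have "(2 * X) powr \<nu> = 2 powr \<nu> * X powr \<nu>" using X by (simp add: powr_mult)
  also have "2 * \<dots> \<le> 2 * (2 powr 1 * X powr \<nu>)"
    using par by (intro mult_left_mono mult_right_mono powr_mono) auto
  finally have m4: "real m \<le> 4 * X powr \<nu>" by simp
  have S4: "?S \<le> 4 * X powr (\<nu> + \<sigma>)"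
  proof -
    have "?S \<le> real m * X powr \<sigma>" using S unfolding X_def .
    also have "\<dots> \<le> 4 * X powr \<nu> * X powr \<sigma>" by (intro mult_right_mono m4) simp
    finally show ?thesis by (simp add: powr_add mult_ac)
  qed
  have S0: "0 \<le> ?S" by (intro sum_nonneg) simp
  have "?H powr (1 - q) * ?S \<le> ?H powr (1 - q) * (4 * X powr (\<nu> + \<sigma>))"
    using S4 by (intro mult_left_mono) auto
  also have "\<dots> = 4 * X powr (\<nu> + \<sigma> + a * (1 - q))"
    by (simp add: powr_powr powr_add mult_ac)
  also have "\<dots> \<le> real n / 2" using time X(2) unfolding X_def by linarith
  finally have tm: "?H powr (1 - q) * ?S \<le> real n / 2" .
  have n1: "1 \<le> n" using n(1) by (meson one_le_numeral one_le_power order_trans)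
  have hit: "exp (- (ln n + ln (cross w 0) + (ln n + 1 / d) * (?H powr (- (q - d)) * ?S))) / 2
      \<le> hit w (int m) n 0"
    by (rule hit_ge_cross[OF w H par(2,3,4) n1 _ tm]) (simp add: m)
  have lnn: "ln (real n) \<le> ln (2 * X)" using X by (intro ln_mono) auto
  have "?H powr (- (q - d)) * ?S \<le> ?H powr (- (q - d)) * (4 * X powr (\<nu> + \<sigma>))"
    using S4 by (intro mult_left_mono) auto
  also have "\<dots> = 4 * (X powr (a * - (q - d)) * X powr (\<nu> + \<sigma>))" by (simp add: powr_powr)
  also have "\<dots> = 4 * X powr (\<nu> + \<sigma> - a * (q - d))"
    by (simp only: powr_add[symmetric]) (simp add: algebra_simps)
  finally have B: "?H powr (- (q - d)) * ?S \<le> 4 * X powr (\<nu> + \<sigma> - a * (q - d))" .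
  have "(ln n + 1 / d) * (?H powr (- (q - d)) * ?S) \<le>
      (ln (2 * X) + 1 / d) * (4 * X powr (\<nu> + \<sigma> - a * (q - d)))"
    by (rule mult_mono[OF _ B]) (use lnn X par S0 in auto)
  then have "ln n + ln (cross w 0) + (ln n + 1 / d) * (?H powr (- (q - d)) * ?S) \<le>
      ln (2 * X) + ln (cross w 0) + (ln (2 * X) + 1 / d) * (4 * X powr (\<nu> + \<sigma> - a * (q - d)))"
    using lnn by linarith
  also have "\<dots> \<le> X powr g / 2" using cost unfolding X_def .
  also have "\<dots> \<le> real n powr g / 2" using X par by (intro divide_right_mono powr_mono2) auto
  finally have "exp (- (real n powr g / 2)) / 2 \<le>
      exp (- (ln n + ln (cross w 0) + (ln n + 1 / d) * (?H powr (- (q - d)) * ?S))) / 2"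
    by (simp only: exp_le_cancel_iff neg_le_iff_le divide_right_mono zero_le_numeral)
  then have hit': "exp (- (real n powr g / 2)) / 2 \<le> hit w (int m) n 0"
    using hit by (rule order_trans)
  \<comment> \<open>The scale sum covers \<open>2 * 2 ^ k\<close> sites beyond \<open>m\<close>,
    more than the walk can travel in the time left.\<close>
  have stay: "1 / 2 \<le> above_at w (int y) j (int m)" if "j \<le> n" for j
  proof -
    have "j < 2 * 2 ^ k" using that n(2) by simp
    then have j: "int j < int (2 * 2 ^ k)" by (simp only: of_nat_less_iff)
    have "1 - (\<Sum>x\<in>{int m..int m + int (2 * 2 ^ k)}. rho_prod w (int y) x) \<le> above_at w (int y) j (int m)"
      by (rule above_ge_scale[OF w]) (use j in \<open>auto simp: m\<close>)
    moreover have "int m = int y + int (k + 1)" by (simp add: m)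
    ultimately show ?thesis using scale by simp
  qed
  have "exp (- (real n powr g / 2)) / 4 \<le> 1 / 2 * hit w (int m) n 0" using hit' by simp
  also have "\<dots> \<le> above_at w (int y) n 0" by (rule above_ge_hit[OF w(1) _ stay]) auto
  also have "\<dots> \<le> above_at w \<lfloor>real n powr \<nu>\<rfloor> n 0"
  proof (rule above_antimono[OF w(1)])
    have "real n powr \<nu> \<le> (2 * 2 ^ k) powr \<nu>"
      using X par unfolding X_def by (intro powr_mono2) auto
    then show "\<lfloor>real n powr \<nu>\<rfloor> \<le> int y" unfolding y by (simp add: floor_mono)
  qed
  finally show ?thesis .
qed

lemma AE_eventually_above_ge:
  fixes \<nu> g :: real
  assumes \<nu>: "\<kappa> < \<nu>" "\<nu> < 1" and g: "(\<nu> - \<kappa>) / (1 - \<kappa>) < g"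
  shows "AE s in M. eventually (\<lambda>n. exp (- (real n powr g)) \<le> above_at (W s) \<lfloor>real n powr \<nu>\<rfloor> n 0) sequentially"
proof -
  obtain a q d \<sigma> where par: "0 < a" "0 < d" "d < q" "q < \<kappa>" "q \<le> 1" "0 < \<sigma>"
    "\<nu> + \<sigma> + a * (1 - q) < 1" "\<nu> + \<sigma> - a * (q - d) < g"
    by (rule lower_exponents[OF \<nu> g])
  have pos: "0 < \<nu>" "0 < q" "0 < (\<nu> - \<kappa>) / (1 - \<kappa>)" using \<nu> kappa_pos par by auto
  then have g0: "0 < g" using g by linarith
  define y where "y k = nat \<lfloor>((2::real) * 2 ^ k) powr \<nu>\<rfloor>" for k :: nat
  define m where "m k = y k + k + 1" for k
  define C where "C = 2 / (1 - moment q)"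
  have \<eta>: "0 \<le> moment q" "moment q < 1" using moment_bounds[OF pos(2) par(4)] by auto
  then have C: "0 \<le> C" by (simp add: C_def)
  \<comment> \<open>The mean of \<open>Z k\<close> is of order
    \<open>(2 ^ k) powr (- \<sigma>)\<close>. This is summable over levels, whereas the same power
    of n need not be summable over n; hence the dyadic levels.\<close>
  define Z where "Z k s = (\<Sum>z<m k. cross (W s) z powr q) / (real (m k) * (2 ^ k) powr \<sigma>)" for k s
  define Y where "Y k s = (\<Sum>x\<in>{int (y k) + int (k + 1)..int (y k) + int (k + 1) + int (2 * 2 ^ k)}.
    rho_prod (W s) (int (y k)) x)" for k s
  have mpos: "0 < real (m k)" for k by (simp add: m_def)
  have "AE s in M. eventually (\<lambda>k. Z k s \<le> 1) sequentially"
  proof (rule AE_eventually_le)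
    show "summable (\<lambda>k. C * (2 ^ k) powr (- \<sigma>))" by (rule summable_decay_powr[OF par(6)])
    show "Z k \<in> borel_measurable M" for k unfolding Z_def by measurable
    show "0 \<le> Z k s" for k s unfolding Z_def by (intro divide_nonneg_nonneg sum_nonneg) auto
    show "0 \<le> C * (2 ^ k) powr (- \<sigma>)" for k using C by simp
    have "(\<integral>\<^sup>+s. ennreal (Z k s) \<partial>M) \<le> ennreal (C * (2 ^ k) powr (- \<sigma>))" for k
    proof -
      define b where "b = 1 / (real (m k) * (2 ^ k) powr \<sigma>)"
      have b: "0 \<le> b" by (simp add: b_def)
      have "(\<integral>\<^sup>+s. ennreal (Z k s) \<partial>M) = (\<integral>\<^sup>+s. ennreal b * (\<Sum>z<m k. ennreal (cross (W s) z powr q)) \<partial>M)"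
      proof (rule nn_integral_cong)
        fix s
        have "ennreal (Z k s) = ennreal (b * (\<Sum>z<m k. cross (W s) z powr q))"
          by (simp add: Z_def b_def)
        also have "\<dots> = ennreal b * ennreal (\<Sum>z<m k. cross (W s) z powr q)"
          using b by (intro ennreal_mult sum_nonneg) auto
        also have "ennreal (\<Sum>z<m k. cross (W s) z powr q) = (\<Sum>z<m k. ennreal (cross (W s) z powr q))"
          by (rule sum_ennreal[symmetric]) simp
        finally show "ennreal (Z k s) = ennreal b * (\<Sum>z<m k. ennreal (cross (W s) z powr q))" .
      qed
      also have "\<dots> = ennreal b * (\<integral>\<^sup>+s. (\<Sum>z<m k. ennreal (cross (W s) z powr q)) \<partial>M)"
        by (rule nn_integral_cmult) measurable
      also have "(\<integral>\<^sup>+s. (\<Sum>z<m k. ennreal (cross (W s) z powr q)) \<partial>M) =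
          (\<Sum>z<m k. \<integral>\<^sup>+s. ennreal (cross (W s) z powr q) \<partial>M)"
        by (rule nn_integral_sum) measurable
      also have "ennreal b * \<dots> \<le> ennreal b * (\<Sum>z<m k. ennreal C)"
        unfolding C_def using par pos by (intro mult_left_mono sum_mono nn_integral_cross) auto
      also have "\<dots> = ennreal (b * (real (m k) * C))"
        using b C by (simp add: ennreal_mult ennreal_of_nat_eq_real_of_nat)
      also have "b * (real (m k) * C) = C * (2 ^ k) powr (- \<sigma>)"
        using mpos[of k] by (simp add: b_def powr_minus field_simps)
      finally show ?thesis .
    qed
    then show "eventually (\<lambda>k. (\<integral>\<^sup>+s. ennreal (Z k s) \<partial>M) \<le> ennreal (C * (2 ^ k) powr (- \<sigma>))) sequentially" by simp
  qed simp
  \<comment> \<open>The power \<open>q\<close> is kept because only moments of order below \<kappa>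
    are controlled; the threshold amounts to \<open>Y k s \<le> 1 / 2\<close>.\<close>
  moreover have "AE s in M. eventually (\<lambda>k. Y k s powr q \<le> (1 / 2) powr q) sequentially"
  proof (rule AE_eventually_le)
    show "summable (\<lambda>k. moment q ^ (k + 1) / (1 - moment q))"
      using \<eta> by (intro summable_divide summable_ignore_initial_segment summable_geometric) auto
    show "(\<lambda>s. Y k s powr q) \<in> borel_measurable M" for k unfolding Y_def by measurable
    show "0 \<le> moment q ^ (k + 1) / (1 - moment q)" for k using \<eta> by simp
    show "eventually (\<lambda>k. (\<integral>\<^sup>+s. ennreal (Y k s powr q) \<partial>M) \<le> ennreal (moment q ^ (k + 1) / (1 - moment q))) sequentially"
      unfolding Y_def by (intro always_eventually allI nn_integral_scale par pos)
  qed auto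
  ultimately show ?thesis using AE_space
  proof eventually_elim
    case (elim s)
    note w = env_W[OF elim(3)]
    have w0: "0 < \<omega> x s" for x using range[OF elim(3), of x] by simp
    have "eventually (\<lambda>k. \<forall>n. 2 ^ k \<le> n \<longrightarrow> n < 2 ^ (k + 1) \<longrightarrow>
        exp (- (real n powr g / 2)) / 4 \<le> above_at (W s) \<lfloor>real n powr \<nu>\<rfloor> n 0) sequentially"
      using elim(1,2) eventually_dyadic_m[OF pos(1)] eventually_dyadic_time[OF par(7)]
        eventually_dyadic_cost[OF par(8) g0, of "ln (cross (W s) 0)" "1 / d"]
    proof (eventually_elim, intro allI impI)
      fix k n :: nat
      assume lev: "Z k s \<le> 1" "Y k s powr q \<le> (1 / 2) powr q"
        "(2 * 2 ^ k) powr \<nu> + real k + 1 \<le> 2 * (2 * 2 ^ k) powr \<nu>"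
        "4 * (2 ^ k) powr (\<nu> + \<sigma> + a * (1 - q)) \<le> (2::real) ^ k / 2"
        "ln (2 * 2 ^ k) + ln (cross (W s) 0) + (ln (2 * 2 ^ k) + 1 / d) *
          (4 * (2 ^ k) powr (\<nu> + \<sigma> - a * (q - d))) \<le> (2 ^ k) powr g / 2"
        "2 ^ k \<le> n" "n < 2 ^ (k + 1)"
      have S: "(\<Sum>z<m k. cross (W s) z powr q) \<le> real (m k) * (2 ^ k) powr \<sigma>"
        using lev(1) mpos[of k] by (simp add: Z_def pos_divide_le_eq)
      have "0 \<le> Y k s" unfolding Y_def by (intro sum_nonneg rho_prod_nonneg w)
      then have "Y k s \<le> 1 / 2"
        using lev(2) pos(2) powr_less_mono2[of q "1 / 2" "Y k s"] by (auto simp: not_less[symmetric])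
      then show "exp (- (real n powr g / 2)) / 4 \<le> above_at (W s) \<lfloor>real n powr \<nu>\<rfloor> n 0"
        by (intro above_ge_level[OF w w0 par(1,2,3,5) pos(1) \<nu>(2) g0 y_def m_def S _ lev(3,4,5,6,7)])
           (simp add: Y_def)
    qed
    then obtain k0 where k0: "\<And>k n. k0 \<le> k \<Longrightarrow> 2 ^ k \<le> n \<Longrightarrow> n < 2 ^ (k + 1) \<Longrightarrow>
        exp (- (real n powr g / 2)) / 4 \<le> above_at (W s) \<lfloor>real n powr \<nu>\<rfloor> n 0"
      by (auto simp: eventually_sequentially)
    show ?case
      using eventually_ge_at_top[of "2 ^ k0"] eventually_quarter_exp[OF g0]
    proof eventually_elim
      case (elim n)
      have "1 \<le> n" using elim(1) by (meson one_le_numeral one_le_power order_trans)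
      then obtain k where k: "2 ^ k \<le> n" "n < 2 ^ (k + 1)"
        using ex_power_ivl1[of 2 n] by auto
      have "(2::nat) ^ k0 < 2 ^ (k + 1)" using elim(1) k(2) by linarith
      then have "k0 < k + 1" by (rule power_less_imp_less_exp[rotated]) simp
      then have "k0 \<le> k" by simp
      from k0[OF this k] elim(2) show ?case by linarith
    qed
  qed
qed

text \<open>Here the averaged bound follows from the almost sure one: the environments satisfying
  the quenched bound at time n have probability tending to 1, and half of them suffice after a small
  change of the exponent.\<close>

lemma eventually_expectation_above_ge:
  fixes \<nu> g :: real
  assumes \<nu>: "\<kappa> < \<nu>" "\<nu> < 1" and g: "(\<nu> - \<kappa>) / (1 - \<kappa>) < g"
  shows "eventually (\<lambda>n. exp (- (real n powr g)) \<le> (\<integral>s. above_at (W s) \<lfloor>real n powr \<nu>\<rfloor> n 0 \<partial>M)) sequentially"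
proof -
  obtain h where h: "(\<nu> - \<kappa>) / (1 - \<kappa>) < h" "h < g" using g dense by blast
  have "0 < (\<nu> - \<kappa>) / (1 - \<kappa>)" using \<nu> by simp
  then have h0: "0 < h" using h(1) by linarith
  define B where "B n = {s \<in> space M. exp (- (real n powr h)) \<le> above_at (W s) \<lfloor>real n powr \<nu>\<rfloor> n 0}" for n :: nat
  have [measurable]: "B n \<in> events" for n unfolding B_def by measurable
  have "(\<lambda>n. \<integral>s. indicator (B n) s \<partial>M) \<longlonglongrightarrow> (\<integral>s. (1 :: real) \<partial>M)"
  proof (rule integral_dominated_convergence[where w="\<lambda>_. 1 :: real"])
    show "AE s in M. (\<lambda>n. indicator (B n) s :: real) \<longlonglongrightarrow> 1"
      using AE_eventually_above_ge[OF \<nu> h(1)] AE_space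
    proof eventually_elim
      case (elim s)
      have "eventually (\<lambda>n. indicator (B n) s = (1 :: real)) sequentially"
        using elim(1) by eventually_elim (use elim(2) in \<open>simp add: B_def\<close>)
      then show ?case by (rule tendsto_eventually)
    qed
  qed (auto simp: indicator_def)
  then have "(\<lambda>n. prob (B n)) \<longlonglongrightarrow> 1" by (simp add: prob_space)
  then have "eventually (\<lambda>n. 1 / 2 < prob (B n)) sequentially" by (rule order_tendstoD) simp
  then show ?thesis using eventually_half_exp[OF h0 h(2)]
  proof eventually_elim
    case (elim n)
    have "exp (- (real n powr h)) * (1 / 2) \<le> exp (- (real n powr h)) * prob (B n)"
      using elim(1) by (intro mult_left_mono) auto
    also have "\<dots> = (\<integral>s. exp (- (real n powr h)) * indicator (B n) s \<partial>M)"
      by simp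
    also have "\<dots> \<le> (\<integral>s. above_at (W s) \<lfloor>real n powr \<nu>\<rfloor> n 0 \<partial>M)"
    proof (rule integral_mono)
      show "integrable M (\<lambda>s. exp (- (real n powr h)) * indicator (B n) s)"
        by (intro integrable_mult_right integrable_real_indicator) (auto simp: less_top[symmetric])
      show "exp (- (real n powr h)) * indicator (B n) s \<le> above_at (W s) \<lfloor>real n powr \<nu>\<rfloor> n 0"
        if "s \<in> space M" for s
        using above_bounds[OF env_W[OF that]] by (auto simp: B_def indicator_def)
    qed (rule integrable_above)
    finally show ?case using elim(2) by linarith
  qed
qed

section \<open>Comparison with the walks and passage to the limit\<close>

text \<open>Reflection speeds the walk up, and being above a level implies having hit it.\<close>

lemma quenched_sandwich:
  fixes \<nu> :: real
  assumes w: "env w" and w': "w' = w \<or> w' = reflect w" and "1 \<le> n"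
  shows "above_at w \<lfloor>real n powr \<nu>\<rfloor> n 0 \<le> measure (quenched_law w') {X. real n powr \<nu> < real_of_int (X n)} \<and>
      measure (quenched_law w') {X. real n powr \<nu> < real_of_int (X n)} \<le> hit (reflect w) \<lfloor>real n powr \<nu>\<rfloor> n 0"
    and "above_at w \<lfloor>real n powr \<nu>\<rfloor> n 0 \<le> measure (quenched_law w') {X. hitting_time (real n powr \<nu>) X < enat n} \<and>
      measure (quenched_law w') {X. hitting_time (real n powr \<nu>) X < enat n} \<le> hit (reflect w) \<lfloor>real n powr \<nu>\<rfloor> n 0"
proof -
  let ?a = "\<lfloor>real n powr \<nu>\<rfloor>"
  \<comment> \<open>A hitting time below n allows only the times 0 to k, so the recursion is
    evaluated at k and not at n.\<close>
  obtain k where k: "n = Suc k" using \<open>1 \<le> n\<close> by (cases n) auto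
  have r: "env (reflect w)" by (rule env_reflect[OF w])
  have e: "env w'" using w w' r by auto
  have le: "w x \<le> w' x" "w' x \<le> reflect w x" for x
    using w' envD(2)[OF w, of x] by (auto simp: reflect_def)
  have up: "hit w' ?a k 0 \<le> hit (reflect w) ?a n 0"
    using hit_mono_time_Suc[OF e, of ?a k 0] hit_mono_env[OF e r le(2), of ?a n 0] unfolding k by linarith
  have lo: "above_at w ?a n 0 \<le> above_at w' ?a n 0" by (rule above_mono_env[OF w e le(1)])
  have mid: "above_at w' ?a n 0 \<le> hit w' ?a k 0" unfolding k by (rule above_Suc_le_hit[OF e])
  have X: "measure (quenched_law w') {X. real n powr \<nu> < real_of_int (X n)} = above_at w' ?a n 0"
    unfolding event_above by (rule measure_quenched_above[OF e])
  have T: "measure (quenched_law w') {X. hitting_time (real n powr \<nu>) X < enat n} = hit w' ?a k 0"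
    unfolding event_hit k by (rule measure_quenched_hit[OF e]) simp
  show "above_at w ?a n 0 \<le> measure (quenched_law w') {X. real n powr \<nu> < real_of_int (X n)} \<and>
      measure (quenched_law w') {X. real n powr \<nu> < real_of_int (X n)} \<le> hit (reflect w) ?a n 0"
    unfolding X using lo mid up by linarith
  show "above_at w ?a n 0 \<le> measure (quenched_law w') {X. hitting_time (real n powr \<nu>) X < enat n} \<and>
      measure (quenched_law w') {X. hitting_time (real n powr \<nu>) X < enat n} \<le> hit (reflect w) ?a n 0"
    unfolding T using lo mid up by linarith
qed

lemma annealed_sandwich:
  assumes e: "\<And>i. (\<lambda>s. e s i) \<in> borel_measurable M" and A: "A \<in> sets path_space"
    and q: "\<And>s. s \<in> space M \<Longrightarrow> above_at (W s) y n 0 \<le> measure (quenched_law (e s)) A \<and>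
      measure (quenched_law (e s)) A \<le> hit (reflect (W s)) y n 0"
  shows "(\<integral>s. above_at (W s) y n 0 \<partial>M) \<le> measure (annealed_law M e) A \<and>
    measure (annealed_law M e) A \<le> (\<integral>s. hit (reflect (W s)) y n 0 \<partial>M)"
proof -
  have eq: "measure (annealed_law M e) A = (\<integral>s. measure (quenched_law (e s)) A \<partial>M)"
    by (rule measure_annealed_law[OF prob_space_axioms e A])
  have "e \<in> measurable M (PiM UNIV (\<lambda>_. borel))"
    by (rule measurable_PiM_single'[where f="\<lambda>i s. e s i"]) (use e in \<open>simp_all add: PiE_UNIV_domain\<close>)
  then have Q: "(\<lambda>s. quenched_law (e s)) \<in> measurable M (subprob_algebra path_space)"
    by (rule measurable_compose[OF _ measurable_quenched_law])
  have int: "integrable M (\<lambda>s. measure (quenched_law (e s)) A)"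
  proof (rule integrable_const_bound[of _ 1])
    show "(\<lambda>s. measure (quenched_law (e s)) A) \<in> borel_measurable M"
      using measurable_compose[OF Q measurable_measure_subprob_algebra[OF A]] .
    show "AE s in M. norm (measure (quenched_law (e s)) A) \<le> 1"
      using prob_space.prob_le_1[OF prob_space_quenched_law] by simp
  qed
  show ?thesis
    unfolding eq using q by (intro conjI integral_mono integrable_above integrable_hit int) auto
qed

text \<open>The probabilities \<open>p\<close> are arbitrary between the two bounds, so one
  statement covers both events and both walks.\<close>

lemma tendsto_quenched:
  fixes \<nu> :: real
  assumes \<nu>: "\<kappa> < \<nu>" "\<nu> < 1"
    and p: "\<And>n s. s \<in> space M \<Longrightarrow> 1 \<le> n \<Longrightarrow> above_at (W s) \<lfloor>real n powr \<nu>\<rfloor> n 0 \<le> p s n \<and>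
      p s n \<le> hit (reflect (W s)) \<lfloor>real n powr \<nu>\<rfloor> n 0"
  shows "AE s in M. (\<lambda>n. ln (- ln (p s n)) / ln (real n)) \<longlonglongrightarrow> (\<nu> - \<kappa>) / (1 - \<kappa>)"
proof -
  define b where "b = (\<nu> - \<kappa>) / (1 - \<kappa>)"
  have b: "0 < b" using \<nu> by (simp add: b_def)
  have "AE s in M. \<forall>j::nat. eventually (\<lambda>n. exp (- (real n powr (b + 1 / (real j + 1)))) \<le>
      above_at (W s) \<lfloor>real n powr \<nu>\<rfloor> n 0) sequentially"
    unfolding AE_all_countable by (intro allI AE_eventually_above_ge \<nu>) (simp add: b_def[symmetric])
  moreover have "AE s in M. \<forall>j::nat. eventually (\<lambda>n. hit (reflect (W s)) \<lfloor>real n powr \<nu>\<rfloor> n 0 \<le>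
      exp (- (real n powr (b - b / (real j + 2))))) sequentially"
    unfolding AE_all_countable
    by (intro allI AE_eventually_hit_le \<nu>) (use b in \<open>auto simp: b_def[symmetric] field_simps intro!: add_pos_nonneg\<close>)
  ultimately show ?thesis using AE_space unfolding b_def[symmetric]
  proof eventually_elim
    case (elim s)
    have "eventually (\<lambda>n. above_at (W s) \<lfloor>real n powr \<nu>\<rfloor> n 0 \<le> p s n \<and>
        p s n \<le> hit (reflect (W s)) \<lfloor>real n powr \<nu>\<rfloor> n 0) sequentially"
      using eventually_ge_at_top[of 1] by eventually_elim (rule p[OF elim(3)])
    with elim(1,2) show ?case by (intro filterlim_ln_ln[OF b]) auto
  qed
qed

lemma tendsto_annealed:
  fixes \<nu> :: real
  assumes \<nu>: "\<kappa> < \<nu>" "\<nu> < 1"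
    and p: "\<And>n. 1 \<le> n \<Longrightarrow> (\<integral>s. above_at (W s) \<lfloor>real n powr \<nu>\<rfloor> n 0 \<partial>M) \<le> p n \<and>
      p n \<le> (\<integral>s. hit (reflect (W s)) \<lfloor>real n powr \<nu>\<rfloor> n 0 \<partial>M)"
  shows "(\<lambda>n. ln (- ln (p n)) / ln (real n)) \<longlonglongrightarrow> (\<nu> - \<kappa>) / (1 - \<kappa>)"
proof -
  define b where "b = (\<nu> - \<kappa>) / (1 - \<kappa>)"
  have b: "0 < b" using \<nu> by (simp add: b_def)
  show ?thesis unfolding b_def[symmetric]
  proof (rule filterlim_ln_ln[OF b])
    show "eventually (\<lambda>n. exp (- (real n powr (b + 1 / (real j + 1)))) \<le>
        (\<integral>s. above_at (W s) \<lfloor>real n powr \<nu>\<rfloor> n 0 \<partial>M)) sequentially" for j :: nat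
      by (intro eventually_expectation_above_ge \<nu>) (simp add: b_def[symmetric])
    show "eventually (\<lambda>n. (\<integral>s. hit (reflect (W s)) \<lfloor>real n powr \<nu>\<rfloor> n 0 \<partial>M) \<le>
        exp (- (real n powr (b - b / (real j + 2))))) sequentially" for j :: nat
      by (intro eventually_expectation_hit_le \<nu>) (use b in \<open>auto simp: b_def[symmetric] field_simps intro!: add_pos_nonneg\<close>)
    show "eventually (\<lambda>n. (\<integral>s. above_at (W s) \<lfloor>real n powr \<nu>\<rfloor> n 0 \<partial>M) \<le> p n \<and>
        p n \<le> (\<integral>s. hit (reflect (W s)) \<lfloor>real n powr \<nu>\<rfloor> n 0 \<partial>M)) sequentially"
      using eventually_ge_at_top[of 1] by eventually_elim (rule p)
  qed
qed

end

theorem theorem1p5: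
  fixes M :: "'a measure" and \<omega> :: "int \<Rightarrow> 'a \<Rightarrow> real" and \<kappa> \<nu> :: real
  assumes "prob_space M"
    and "prob_space.indep_vars M (\<lambda>_. borel) \<omega> UNIV"
    and "\<And>i. distr M borel (\<omega> i) = distr M borel (\<omega> 0)"
    and "\<And>i s. s \<in> space M \<Longrightarrow> \<omega> i s \<in> {0<..<1}"
    and "(\<integral>s. ln (rho (\<omega> 0 s)) \<partial>M) < 0"
    and "\<kappa> > 0"
    and "(\<integral>s. rho (\<omega> 0 s) powr \<kappa> \<partial>M) = 1"
    and "integrable M (\<lambda>s. rho (\<omega> 0 s) powr \<kappa> * ln_plus (rho (\<omega> 0 s)))"
    and "\<And>\<kappa>'. \<kappa>' > 0 \<Longrightarrow> (\<integral>s. rho (\<omega> 0 s) powr \<kappa>' \<partial>M) = 1 \<Longrightarrow>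
           integrable M (\<lambda>s. rho (\<omega> 0 s) powr \<kappa>' * ln_plus (rho (\<omega> 0 s))) \<Longrightarrow> \<kappa>' = \<kappa>"
    and "\<exists>\<epsilon>\<^sub>0>0. integrable M (\<lambda>s. rho (\<omega> 0 s) powr (- \<epsilon>\<^sub>0))"
    and "\<kappa> < \<nu>" and "\<nu> < 1"
  shows
    "(AE s in M.
        ((\<lambda>n. ln (- ln \<P>(X in quenched_law (\<lambda>i. \<omega> i s). real_of_int (X n) > real n powr \<nu>))
               / ln (real n)) \<longlonglongrightarrow> (\<nu> - \<kappa>) / (1 - \<kappa>)) \<and>
        ((\<lambda>n. ln (- ln \<P>(X in quenched_law (\<lambda>i. \<omega> i s). hitting_time (real n powr \<nu>) X < enat n))
               / ln (real n)) \<longlonglongrightarrow> (\<nu> - \<kappa>) / (1 - \<kappa>))) \<and>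
     ((\<lambda>n. ln (- ln \<P>(X in annealed_law M (\<lambda>s i. \<omega> i s). real_of_int (X n) > real n powr \<nu>))
               / ln (real n)) \<longlonglongrightarrow> (\<nu> - \<kappa>) / (1 - \<kappa>)) \<and>
     ((\<lambda>n. ln (- ln \<P>(X in annealed_law M (\<lambda>s i. \<omega> i s). hitting_time (real n powr \<nu>) X < enat n))
               / ln (real n)) \<longlonglongrightarrow> (\<nu> - \<kappa>) / (1 - \<kappa>)) \<and>
     (AE s in M.
        ((\<lambda>n. ln (- ln \<P>(X in quenched_law (reflect (\<lambda>i. \<omega> i s)). real_of_int (X n) > real n powr \<nu>))
               / ln (real n)) \<longlonglongrightarrow> (\<nu> - \<kappa>) / (1 - \<kappa>)) \<and>
        ((\<lambda>n. ln (- ln \<P>(X in quenched_law (reflect (\<lambda>i. \<omega> i s)). hitting_time (real n powr \<nu>) X < enat n))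
               / ln (real n)) \<longlonglongrightarrow> (\<nu> - \<kappa>) / (1 - \<kappa>))) \<and>
     ((\<lambda>n. ln (- ln \<P>(X in annealed_law M (\<lambda>s. reflect (\<lambda>i. \<omega> i s)). real_of_int (X n) > real n powr \<nu>))
               / ln (real n)) \<longlonglongrightarrow> (\<nu> - \<kappa>) / (1 - \<kappa>)) \<and>
     ((\<lambda>n. ln (- ln \<P>(X in annealed_law M (\<lambda>s. reflect (\<lambda>i. \<omega> i s)). hitting_time (real n powr \<nu>) X < enat n))
               / ln (real n)) \<longlonglongrightarrow> (\<nu> - \<kappa>) / (1 - \<kappa>))"
proof -
  interpret iid_environment M \<omega> \<kappa>
    by (rule iid_environment.intro[OF assms(1) iid_environment_axioms.intro[OF assms(2-7)]])
  have sp: "space (annealed_law M (\<lambda>s i. \<omega> i s)) = UNIV"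
    "space (annealed_law M (\<lambda>s. reflect (\<lambda>i. \<omega> i s))) = UNIV"
    by (intro space_annealed_law prob_space_axioms; simp add: reflect_def)+
  have e: "(\<lambda>s. reflect (W s) i) \<in> borel_measurable M" for i
    by (simp add: reflect_def)
  have ev: "{X :: nat \<Rightarrow> int. t < real_of_int (X n)} \<in> sets path_space"
    "{X. hitting_time t X < enat n} \<in> sets path_space" for t n
    unfolding event_above event_hit by (rule sets_events)+
  note q = quenched_sandwich[OF env_W, where \<nu>=\<nu>]
  \<comment> \<open>\<open>lim(1)\<close> serves the four quenched limits and \<open>lim(2)\<close>,
    together with \<open>annealed_sandwich\<close>, the four annealed ones.\<close>
  note lim = tendsto_quenched[OF assms(11,12)] tendsto_annealed[OF assms(11,12)]
  show ?thesis
    unfolding sp space_quenched_law UNIV_I simp_thms AE_conj_iff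
    by (intro conjI; (rule lim(1) | rule lim(2), rule annealed_sandwich);
        (rule ev e measurable_omega q | simp)+)
qed

end
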